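(* Let $f$ be a convex function with $f(0)=0$ that is strictly increasing on $\mathbb{R}^+$, and for a connected graph $G$ let $\mathrm{W}_f(G)=\sum_{\{u,v\}\subset V(G)} f(d(u,v))$. If $G$ is a connected graph of order $n$ with independence number $\alpha$ satisfying $2\le\alpha<\frac n2$, then $\mathrm{W}_f(G)\le\mathrm{W}_f(\mathcal{D}_{n,\alpha})$, with equality if and only if $G\cong\mathcal{D}_{n,\alpha}$.
   Context: $d(u,v)$ is the graph distance and the sum runs over unordered pairs of distinct vertices. The independence number is the size of a largest independent vertex set. The balanced dumbbell graph $\mathcal{D}_{n,\alpha}$ is obtained from two disjoint cliques of orders $\lceil\frac n2\rceil-\alpha+2$ and $\lfloor\frac n2\rfloor-\alpha+2$ by joining a vertex of the first clique and a vertex of the second clique by a path of length $2\alpha-3$ (whose internal vertices are new); it has $n$ vertices and diameter $2\alpha-1$. *)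

theory Defs
  imports "HOL-Analysis.Convex" "Graph_Theory.Graph_Theory"
begin

text \<open>
  Finite simple graphs are the \<open>pair_graph\<close>s of the Graph Theory library: finite, loop-free,
  symmetric digraphs whose arcs are ordered pairs of vertices, so that an edge \<open>uv\<close> is
  represented by the two arcs \<open>(u, v)\<close> and \<open>(v, u)\<close>.
\<close>

definition independent_set :: "'a pair_pre_digraph \<Rightarrow> 'a set \<Rightarrow> bool" where
  "independent_set G S \<longleftrightarrow> S \<subseteq> pverts G \<and> (\<forall>u\<in>S. \<forall>v\<in>S. (u, v) \<notin> parcs G)"

definition independence_number :: "'a pair_pre_digraph \<Rightarrow> nat" where
  "independence_number G = Max {card S |S. independent_set G S}"

definition graph_dist :: "'a pair_pre_digraph \<Rightarrow> 'a \<Rightarrow> 'a \<Rightarrow> nat" where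
  "graph_dist G u v = (LEAST k. \<exists>p. pre_digraph.awalk (with_proj G) u p v \<and> length p = k)"

lemma graph_dist_commute:
  assumes "pair_graph G"
  shows "graph_dist G u v = graph_dist G v u"
proof -
  interpret pair_graph G by fact
  have length_rev: "length (rev_path p) = length p" for p :: "('a \<times> 'a) awalk"
    by (induction p) auto
  have "\<exists>q. awalk y q x \<and> length q = k" if "awalk x p y" "length p = k" for x y p k
    using that length_rev by (intro exI[of _ "rev_path p"]) simp
  then have "(\<exists>p. awalk u p v \<and> length p = k) \<longleftrightarrow> (\<exists>p. awalk v p u \<and> length p = k)" for k
    by blast
  then show ?thesis
    by (simp add: graph_dist_def)
qed

text \<open>
  By symmetry of the distance, the sum over ordered pairs counts every unordered pair of distinct
  vertices exactly twice.
\<close>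

definition wiener :: "(real \<Rightarrow> real) \<Rightarrow> 'a pair_pre_digraph \<Rightarrow> real" where
  "wiener f G = (\<Sum>u\<in>pverts G. \<Sum>v\<in>pverts G - {u}. f (real (graph_dist G u v))) / 2"

text \<open>
  Cliques on \<open>{0..<a}\<close> and \<open>{a + l - 1..<a + b + l - 1}\<close>, of orders \<open>a\<close> and \<open>b\<close>, and the path
  \<open>a - 1, a, \<dots>, a + l - 1\<close> of length \<open>l\<close> from the last vertex of the first clique to the first
  vertex of the second; meant for \<open>a, b, l \<ge> 1\<close>.
\<close>

definition dumbbell :: "nat \<Rightarrow> nat \<Rightarrow> nat \<Rightarrow> nat pair_pre_digraph" where
  "dumbbell a b l = \<lparr> pverts = {0..<a + b + l - 1},
     parcs = {(u, v). u \<noteq> v \<and> u \<in> {0..<a} \<and> v \<in> {0..<a}}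
       \<union> {(u, v). u \<noteq> v \<and> u \<in> {a + l - 1..<a + b + l - 1} \<and> v \<in> {a + l - 1..<a + b + l - 1}}
       \<union> (\<Union>i<l. {(a - 1 + i, a + i), (a + i, a - 1 + i)}) \<rparr>"

text \<open>
  Here \<open>(n + 1) div 2\<close> and \<open>n div 2\<close> are \<open>\<lceil>n / 2\<rceil>\<close> and \<open>\<lfloor>n / 2\<rfloor>\<close>; no subtraction is truncated when
  \<open>2 \<le> \<alpha> < n / 2\<close>.
\<close>

definition balanced_dumbbell :: "nat \<Rightarrow> nat \<Rightarrow> nat pair_pre_digraph" where
  "balanced_dumbbell n \<alpha> = dumbbell ((n + 1) div 2 - \<alpha> + 2) (n div 2 - \<alpha> + 2) (2 * \<alpha> - 3)"

lemma pair_graph_dumbbell: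
  assumes "a \<ge> 1" "b \<ge> 1" "l \<ge> 1"
  shows "pair_graph (dumbbell a b l)"
proof
  have "parcs (dumbbell a b l) \<subseteq> pverts (dumbbell a b l) \<times> pverts (dumbbell a b l)"
    using assms by (auto simp: dumbbell_def)
  then show "finite (parcs (dumbbell a b l))"
    by (rule finite_subset) (simp add: dumbbell_def)
qed (use assms in \<open>auto simp: dumbbell_def symmetric_def sym_def\<close>)

lemma card_balanced_dumbbell:
  assumes "2 \<le> \<alpha>" "real \<alpha> < real n / 2"
  shows "card (pverts (balanced_dumbbell n \<alpha>)) = n"
  using assms by (simp add: balanced_dumbbell_def dumbbell_def)

end

theory Submission
  imports Defs
begin

text \<open>
  The bound is proved by induction on the order, by deleting a pair of vertices. A path argument of
  Gyarfas yields an induced path such that every component of the graph outside its closed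
  neighbourhood has at most \<open>n/2 - 1\<close> vertices. Let \<open>x, y\<close> be the ends of a longest such path, of
  length \<open>e\<close>. A vertex at distance \<open>h \<ge> 1\<close> from the path satisfies
  \<open>d(x,z) + d(y,z) \<le> e + 2h\<close>, and \<open>\<le> e + 2h - 1\<close> if the path is reached in two vertices. On the
  other hand, alternate levels of the components together with alternate vertices of the path are
  independent, which bounds \<open>e\<close> plus the heights of the components by about \<open>2\<alpha>\<close>. Since no component
  contains half of the vertices, the sum of \<open>d(x,z) + d(y,z)\<close> is at most its value for a pair of
  opposite clique vertices of the dumbbell. Every distance up to the eccentricity occurs, hence
  the bound passes from distances to convex functions of distances. If the deletion of both ends
  disconnects the graph, the path closes to a cycle and deleting only one of the ends is enough.
  In the case of equality the path is a diametral path of length \<open>2\<alpha> - 1\<close>, and the structure of the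
  smaller graph extends.
\<close>

subsection \<open>Distances and connectivity\<close>

text \<open>The count behind the bound is a charging argument for plain distances. Let
  \<open>x, y\<close> be the ends of the path and \<open>e\<close> its length. Each of the other
  \<open>n - 2\<close> vertices is charged \<open>e + 1 + single + excess\<close>, which
  independence bounds by \<open>2 * \<alpha>\<close>; \<open>single\<close> is 1 if some vertex has
  just one neighbour on the path, and \<open>excess\<close> adds up the heights of the components,
  each less 1. A component \<open>B\<close> of height \<open>h\<close> needs
  \<open>2 * card B * (h - 1)\<close> beyond the basic charge, and
  \<open>2 * card B \<le> n - 2\<close> is exactly what allows this to be shared among all
  \<open>n - 2\<close> vertices. The \<open>e - 1\<close> inner vertices of the path save at least 1
  each, while \<open>d(x, y) \<le> e\<close> is added once: hence the budget
  \<open>2 * \<alpha> * (n - 2) + 1\<close>. Deleting a pair counts \<open>d(x, y)\<close> once, and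
  the roundings of \<open>n / 2\<close> at the orders \<open>n\<close> and \<open>n - 1\<close>
  cancel. Two separate transmissions count it twice, which the cycle case affords because there
  \<open>d(x, y) \<le> 2\<close>. Goodness passes to longer paths, so a longest one cannot be
  prolonged; this is why neither end is a cut vertex.\<close>

definition sdist :: "'a rel \<Rightarrow> 'a set \<Rightarrow> 'a \<Rightarrow> nat" where
  "sdist E S v = (LEAST k. \<exists>s\<in>S. (s, v) \<in> E ^^ k)"

abbreviation vdist :: "'a rel \<Rightarrow> 'a \<Rightarrow> 'a \<Rightarrow> nat" where
  "vdist E u v \<equiv> sdist E {u} v"

definition conn_on :: "'a rel \<Rightarrow> 'a set \<Rightarrow> bool" where
  "conn_on E B \<longleftrightarrow> (\<forall>u\<in>B. \<forall>v\<in>B. (u, v) \<in> (E \<inter> B \<times> B)\<^sup>*)"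

definition indep :: "'a rel \<Rightarrow> 'a set \<Rightarrow> bool" where
  "indep E I \<longleftrightarrow> (\<forall>u\<in>I. \<forall>v\<in>I. (u, v) \<notin> E)"

lemma sdist_le: "s \<in> S \<Longrightarrow> (s, v) \<in> E ^^ k \<Longrightarrow> sdist E S v \<le> k"
  unfolding sdist_def by (rule Least_le) blast

lemma conn_onI_root:
  assumes "sym E" "r \<in> B" "\<And>v. v \<in> B \<Longrightarrow> (r, v) \<in> (E \<inter> B \<times> B)\<^sup>*"
  shows "conn_on E B"
proof -
  have "sym (E \<inter> B \<times> B)"
    using assms(1) by (auto simp: sym_def)
  then have "sym ((E \<inter> B \<times> B)\<^sup>*)"
    by (rule sym_rtrancl)
  then show ?thesis
    unfolding conn_on_def using assms(3) by (meson rtrancl_trans symD)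
qed

lemma conn_on_insert:
  assumes "sym E" "conn_on E B" "b \<in> B" "(b, w) \<in> E"
  shows "conn_on E (insert w B)"
proof (rule conn_onI_root[OF assms(1), of b])
  let ?R = "E \<inter> insert w B \<times> insert w B"
  fix v assume v: "v \<in> insert w B"
  have mono: "(E \<inter> B \<times> B)\<^sup>* \<subseteq> ?R\<^sup>*"
    by (intro rtrancl_mono) auto
  show "(b, v) \<in> ?R\<^sup>*"
  proof (cases "v = w")
    case True
    then show ?thesis using assms(3,4) by auto
  next
    case False
    then have "(b, v) \<in> (E \<inter> B \<times> B)\<^sup>*"
      using v assms(2,3) by (auto simp: conn_on_def)
    then show ?thesis using mono by blast
  qed
qed (use assms in auto)

lemma conn_on_boundary:
  assumes "conn_on E B" "X \<subseteq> B" "u \<in> X" "v \<in> B - X"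
  obtains a b where "a \<in> X" "b \<in> B - X" "(a, b) \<in> E"
proof -
  have "(u, v) \<in> (E \<inter> B \<times> B)\<^sup>*"
    using assms by (auto simp: conn_on_def)
  then have "v \<in> X \<or> (\<exists>a\<in>X. \<exists>b\<in>B - X. (a, b) \<in> E)"
    by induction (use assms(3) in auto)
  then show ?thesis using that assms(4) by blast
qed

locale sgraph =
  fixes V :: "'a set" and E :: "'a rel"
  assumes finite_V: "finite V" and E_sub: "E \<subseteq> V \<times> V" and sym_E: "sym E"
    and irrefl_E: "(u, u) \<notin> E"
begin

lemma E_sym: "(u, v) \<in> E \<Longrightarrow> (v, u) \<in> E"
  using sym_E by (rule symD)

lemma E_comm: "(u, v) \<in> E \<longleftrightarrow> (v, u) \<in> E"
  using E_sym by blast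

lemma relpow_sym: "(u, v) \<in> E ^^ k \<Longrightarrow> (v, u) \<in> E ^^ k"
proof (induction k arbitrary: v)
  case (Suc k)
  then obtain w where "(u, w) \<in> E ^^ k" "(w, v) \<in> E"
    by auto
  with Suc show ?case
    by (meson E_sym relpow_Suc_I2)
qed simp

lemma sgraph_restrict: "sgraph (V - X) (E \<inter> (V - X) \<times> (V - X))"
  using finite_V sym_E irrefl_E by unfold_locales (auto simp: sym_def)

end

locale cgraph = sgraph +
  assumes conn: "conn_on E V"
begin

lemma reach: "u \<in> V \<Longrightarrow> v \<in> V \<Longrightarrow> (u, v) \<in> E\<^sup>*"
  using conn rtrancl_mono[of "E \<inter> V \<times> V" E] by (auto simp: conn_on_def)

lemma sdist_walk:
  assumes "S \<subseteq> V" "S \<noteq> {}" "v \<in> V"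
  shows "\<exists>s\<in>S. (s, v) \<in> E ^^ sdist E S v"
proof -
  obtain s where "s \<in> S" "(s, v) \<in> E\<^sup>*"
    using assms reach by blast
  then have "\<exists>k. \<exists>s\<in>S. (s, v) \<in> E ^^ k"
    using rtrancl_power by blast
  then show ?thesis
    unfolding sdist_def by (rule LeastI_ex)
qed

lemma sdist_eq_0:
  assumes "S \<subseteq> V" "S \<noteq> {}" "v \<in> V"
  shows "sdist E S v = 0 \<longleftrightarrow> v \<in> S"
  using sdist_walk[OF assms] sdist_le[of v S v 0 E] by auto

lemma sdist_step:
  assumes "S \<subseteq> V" "S \<noteq> {}" "(u, v) \<in> E"
  shows "sdist E S v \<le> Suc (sdist E S u)"
proof -
  have "u \<in> V" using assms E_sub by auto
  then obtain s where "s \<in> S" "(s, u) \<in> E ^^ sdist E S u"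
    using sdist_walk assms by blast
  then show ?thesis
    using assms(3) by (intro sdist_le[of s]) auto
qed

lemma sdist_pred:
  assumes "S \<subseteq> V" "S \<noteq> {}" "v \<in> V" "sdist E S v = Suc k"
  shows "\<exists>u. (u, v) \<in> E \<and> sdist E S u = k"
proof -
  obtain s where "s \<in> S" "(s, v) \<in> E ^^ Suc k"
    using sdist_walk[OF assms(1-3)] assms(4) by auto
  then obtain u where u: "(s, u) \<in> E ^^ k" "(u, v) \<in> E"
    by auto
  have "sdist E S u \<le> k"
    using sdist_le u \<open>s \<in> S\<close> by metis
  moreover have "k \<le> sdist E S u"
    using sdist_step[OF assms(1,2) u(2)] assms(4) by simp
  ultimately show ?thesis using u by auto
qed

lemma sdist_level:
  assumes "S \<subseteq> V" "S \<noteq> {}" "v \<in> V" "j \<le> sdist E S v"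
  shows "\<exists>w\<in>V. sdist E S w = j"
  using assms(3,4)
proof (induction "sdist E S v - j" arbitrary: v)
  case 0
  then show ?case by (intro bexI[of _ v]) auto
next
  case (Suc d)
  then obtain k where k: "sdist E S v = Suc k"
    by (cases "sdist E S v") auto
  then obtain u where "(u, v) \<in> E" "sdist E S u = k"
    using sdist_pred[OF assms(1,2) Suc.prems(1)] by blast
  then show ?case
    using Suc k E_sub by (intro Suc.hyps(1)[of u]) auto
qed

lemma vdist_eq_0: "u \<in> V \<Longrightarrow> v \<in> V \<Longrightarrow> vdist E u v = 0 \<longleftrightarrow> u = v"
  using sdist_eq_0[of "{u}" v] by auto

lemma vdist_self: "u \<in> V \<Longrightarrow> vdist E u u = 0"
  by (simp add: vdist_eq_0)

lemma vdist_walk: "u \<in> V \<Longrightarrow> v \<in> V \<Longrightarrow> (u, v) \<in> E ^^ vdist E u v"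
  using sdist_walk[of "{u}" v] by auto

lemma vdist_comm: "u \<in> V \<Longrightarrow> v \<in> V \<Longrightarrow> vdist E u v = vdist E v u"
  by (meson dual_order.antisym insertI1 relpow_sym sdist_le vdist_walk)

lemma vdist_triangle:
  assumes "u \<in> V" "v \<in> V" "w \<in> V"
  shows "vdist E u w \<le> vdist E u v + vdist E v w"
proof -
  have "(u, w) \<in> E ^^ (vdist E u v + vdist E v w)"
    using vdist_walk assms by (auto simp: relpow_add)
  then show ?thesis by (auto intro: sdist_le)
qed

lemma vdist_adj: "(u, v) \<in> E \<Longrightarrow> vdist E u v = 1"
  using sdist_le[of u "{u}" v 1 E] vdist_eq_0[of u v] E_sub irrefl_E[of u]
  by (cases "vdist E u v") auto

lemma vdist_eq_1: "u \<in> V \<Longrightarrow> v \<in> V \<Longrightarrow> vdist E u v = 1 \<longleftrightarrow> (u, v) \<in> E"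
  using vdist_adj vdist_walk[of u v] by auto

lemma vdist_restrict:
  assumes "W \<subseteq> V" "conn_on E W" "u \<in> W" "v \<in> W"
  shows "vdist E u v \<le> vdist (E \<inter> W \<times> W) u v"
proof -
  interpret W: cgraph W "E \<inter> W \<times> W"
    using assms finite_V sym_E irrefl_E finite_subset[OF assms(1)]
    by unfold_locales (auto simp: sym_def conn_on_def Int_assoc)
  have "(u, v) \<in> (E \<inter> W \<times> W) ^^ vdist (E \<inter> W \<times> W) u v"
    using W.vdist_walk assms by blast
  moreover have "(E \<inter> W \<times> W) ^^ k \<subseteq> E ^^ k" for k
    by (induction k) (auto intro: relcompI)
  ultimately show ?thesis
    by (intro sdist_le) auto
qed

text \<open>A vertex farthest from a root will do: no shortest path from the root to another vertex
  passes through it.\<close>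

lemma ex_noncut:
  assumes "card V \<ge> 2"
  shows "\<exists>x\<in>V. conn_on E (V - {x})"
proof -
  obtain r where r: "r \<in> V"
    using assms by (cases "V = {}") auto
  have "Max (vdist E r ` V) \<in> vdist E r ` V"
    using r finite_V by (intro Max_in) auto
  then obtain x where "x \<in> V" "vdist E r x = Max (vdist E r ` V)"
    by auto
  then have x: "x \<in> V" "\<And>v. v \<in> V \<Longrightarrow> vdist E r v \<le> vdist E r x"
    using finite_V by auto
  obtain v where "v \<in> V" "v \<noteq> r"
    using assms r by (metis One_nat_def card_1_singleton_iff card_le_Suc0_iff_eq finite_V not_less_eq_eq numeral_2_eq_2)
  then have rx: "r \<noteq> x"
    using x r vdist_eq_0[of r v] vdist_self[of r] by (metis le_zero_eq)
  have "(r, v) \<in> (E \<inter> (V - {x}) \<times> (V - {x}))\<^sup>*" if "v \<in> V - {x}" for v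
    using that
  proof (induction "vdist E r v" arbitrary: v)
    case 0
    then show ?case using vdist_eq_0[of r v] r by auto
  next
    case (Suc k)
    then obtain u where u: "(u, v) \<in> E" "vdist E r u = k"
      using sdist_pred[of "{r}" v k] r by auto
    have "u \<noteq> x"
      using u(2) Suc(2) x(2)[of v] Suc.prems by auto
    then have "u \<in> V - {x}"
      using u E_sub by auto
    then have "(r, u) \<in> (E \<inter> (V - {x}) \<times> (V - {x}))\<^sup>*"
      using Suc u by auto
    moreover have "(u, v) \<in> E \<inter> (V - {x}) \<times> (V - {x})"
      using u Suc.prems \<open>u \<in> V - {x}\<close> by auto
    ultimately show ?case by (rule rtrancl_into_rtrancl)
  qed
  then have "conn_on E (V - {x})"
    using r rx sym_E by (intro conn_onI_root[of E r]) auto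
  then show ?thesis using x by blast
qed

lemma cgraph_restrict:
  assumes "conn_on E (V - X)"
  shows "cgraph (V - X) (E \<inter> (V - X) \<times> (V - X))"
proof -
  interpret S: sgraph "V - X" "E \<inter> (V - X) \<times> (V - X)"
    by (rule sgraph_restrict)
  show ?thesis
    using assms by unfold_locales (simp add: conn_on_def Int_assoc)
qed

end

subsection \<open>Sums over pairs\<close>

definition psum :: "('a \<Rightarrow> 'a \<Rightarrow> real) \<Rightarrow> 'a set \<Rightarrow> real" where
  "psum g V = (\<Sum>u\<in>V. \<Sum>v\<in>V - {u}. g u v) / 2"

lemma psum_remove:
  assumes "finite V" "x \<in> V" "\<And>u v. u \<in> V \<Longrightarrow> v \<in> V \<Longrightarrow> g u v = g v u"
  shows "psum g V = psum g (V - {x}) + (\<Sum>v\<in>V - {x}. g x v)"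
proof -
  have "(\<Sum>u\<in>V. \<Sum>v\<in>V - {u}. g u v)
      = (\<Sum>v\<in>V - {x}. g x v) + (\<Sum>u\<in>V - {x}. \<Sum>v\<in>V - {u}. g u v)"
    using assms by (simp add: sum.remove)
  also have "(\<Sum>u\<in>V - {x}. \<Sum>v\<in>V - {u}. g u v)
      = (\<Sum>u\<in>V - {x}. g u x + (\<Sum>v\<in>V - {x} - {u}. g u v))"
  proof (rule sum.cong[OF refl])
    fix u assume u: "u \<in> V - {x}"
    have "V - {u} - {x} = V - {x} - {u}" by auto
    then show "(\<Sum>v\<in>V - {u}. g u v) = g u x + (\<Sum>v\<in>V - {x} - {u}. g u v)"
      using assms(1,2) u sum.remove[of "V - {u}" x "g u"] by auto
  qed
  also have "\<dots> = (\<Sum>u\<in>V - {x}. g x u) + (\<Sum>u\<in>V - {x}. \<Sum>v\<in>V - {x} - {u}. g u v)"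
    using assms(2,3) by (simp add: sum.distrib)
  finally show ?thesis
    by (simp add: psum_def field_simps)
qed

lemma psum_mono:
  assumes "\<And>u v. u \<in> V \<Longrightarrow> v \<in> V \<Longrightarrow> u \<noteq> v \<Longrightarrow> g u v \<le> h u v"
  shows "psum g V \<le> psum h V"
  unfolding psum_def using assms by (intro divide_right_mono sum_mono) auto

text \<open>One representative is kept for each value in \<open>A\<close>, and every other summand
  is bounded by \<open>c\<close>. In this form the fact that all small distances occur enters the
  estimates.\<close>

lemma sum_cover_le:
  fixes \<phi> :: "nat \<Rightarrow> real"
  assumes "finite Z" "A \<subseteq> d ` Z" "\<And>z. z \<in> Z \<Longrightarrow> \<phi> (d z) \<le> c"
  shows "(\<Sum>z\<in>Z. \<phi> (d z)) \<le> (\<Sum>t\<in>A. \<phi> t) + (real (card Z) - real (card A)) * c"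
proof -
  obtain Y where Y: "Y \<subseteq> Z" "inj_on d Y" "A = d ` Y"
    using assms(2) by (metis subset_image_inj)
  have fin: "finite Y" using Y assms(1) finite_subset by blast
  have "(\<Sum>z\<in>Z. \<phi> (d z)) = (\<Sum>z\<in>Y. \<phi> (d z)) + (\<Sum>z\<in>Z - Y. \<phi> (d z))"
    using sum.subset_diff[OF Y(1) assms(1)] by (simp add: add.commute)
  also have "(\<Sum>z\<in>Y. \<phi> (d z)) = (\<Sum>t\<in>A. \<phi> t)"
    using Y by (simp add: sum.reindex)
  also have "(\<Sum>z\<in>Z - Y. \<phi> (d z)) \<le> real (card (Z - Y)) * c"
    using assms(3) by (intro sum_bounded_above) auto
  also have "real (card (Z - Y)) = real (card Z) - real (card A)"
    using Y fin assms(1) by (simp add: card_Diff_subset card_mono card_image of_nat_diff)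
  finally show ?thesis by simp
qed

subsection \<open>Convex functions summed over distance profiles\<close>

text \<open>The discrete content of convexity, stated at the possible distances of distinct
  vertices. The number \<open>s\<close> is the slope of the chord over \<open>[1, e]\<close>; once
  the linear part is subtracted, the function is at most its common end value on
  \<open>[1, e]\<close> and nondecreasing from \<open>e\<close> on.\<close>

locale convex_inc =
  fixes f :: "nat \<Rightarrow> real"
  assumes f_less: "1 \<le> i \<Longrightarrow> i < j \<Longrightarrow> f i < f j"
    and f_chord: "1 \<le> e \<Longrightarrow> \<exists>s::real. 0 < s \<and> f e - s * real e = f 1 - s \<and> (\<forall>t\<in>{1..e}. f t - s * real t \<le> f 1 - s)
      \<and> (\<forall>t\<ge>e. \<forall>t'\<ge>t. f t - s * real t \<le> f t' - s * real t')"

lemma convex_inc_of_real: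
  fixes g :: "real \<Rightarrow> real"
  assumes cvx: "convex_on {0..} g" and mono: "strict_mono_on {0<..} g"
  shows "convex_inc (\<lambda>t. g (real t))"
proof
  show less: "g (real i) < g (real j)" if "1 \<le> i" "i < j" for i j
    using that by (intro strict_mono_onD[OF mono]) auto
  have chord: "\<exists>s::real. 0 < s \<and> g (real e) - s * real e = g (real 1) - s
      \<and> (\<forall>t\<in>{1..e}. g (real t) - s * real t \<le> g (real 1) - s)
      \<and> (\<forall>t\<ge>e. \<forall>t'\<ge>t. g (real t) - s * real t \<le> g (real t') - s * real t')" if "2 \<le> e" for e :: nat
  proof -
    define s where "s = (g e - g 1) / (real e - 1)"
    have s: "s * (real e - 1) = g e - g 1"
      using that by (simp add: s_def)
    have s_pos: "s > 0"
      using less[of 1 e] that by (simp add: s_def)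
    have below: "g t - s * t \<le> g 1 - s" if "t \<in> {1..e}" for t :: nat
    proof -
      have "convex_on {1..real e} g"
        using cvx by (rule convex_on_subset) auto
      from convex_onD_Icc'[OF this, of t] that have "g t \<le> s * (real t - 1) + g 1"
        by (simp add: s_def)
      then show ?thesis by (simp add: algebra_simps)
    qed
    have above: "g t - s * t \<le> g t' - s * t'" if "e \<le> t" "t \<le> t'" for t t' :: nat
    proof (cases "t = t'")
      case False
      then have tt: "1 < real t" "real t < real t'" "1 < real e" "real e < real t'"
        using that \<open>2 \<le> e\<close> by auto
      \<comment> \<open>Slopes of chords grow: first the right end moves from \<open>e\<close> to
        \<open>t'\<close>, then the left end from \<open>1\<close> to \<open>t\<close>.\<close>
      have "s \<le> (g 1 - g t') / (1 - real t')"
        using convex_on_slope_le(1)[OF cvx, of 1 "real t'" "real e"] tt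
        by (simp add: s_def) (metis minus_diff_eq minus_divide_divide)
      also have "\<dots> \<le> (g t - g t') / (real t - real t')"
        using convex_on_slope_le(2)[OF cvx, of 1 "real t'" "real t"] tt by simp
      finally have "s * (real t' - real t) \<le> g t' - g t"
        using tt by (simp add: field_simps)
      then show ?thesis by (simp add: algebra_simps)
    qed simp
    show ?thesis
      using s s_pos below above by (intro exI[of _ s]) (auto simp: algebra_simps)
  qed
  show "\<exists>s::real. 0 < s \<and> g (real e) - s * real e = g (real 1) - s
      \<and> (\<forall>t\<in>{1..e}. g (real t) - s * real t \<le> g (real 1) - s)
      \<and> (\<forall>t\<ge>e. \<forall>t'\<ge>t. g (real t) - s * real t \<le> g (real t') - s * real t')" if "1 \<le> e" for e
  proof (cases "e = 1")
    case True
    \<comment> \<open>For \<open>e = 1\<close> the chord degenerates. The slope over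
      \<open>[1, 2]\<close> serves instead, since no integer lies strictly between 1 and 2.\<close>
    obtain s where s: "s > 0" "g (real 2) - s * real 2 = g 1 - s"
      "\<forall>t\<ge>2. \<forall>t'\<ge>t. g (real t) - s * real t \<le> g (real t') - s * real t'"
      using chord[of 2] by auto
    have "g (real t) - s * t \<le> g (real t') - s * t'" if tt: "1 \<le> t" "t \<le> t'" for t t' :: nat
    proof -
      consider "t = t'" | "t = 1" "t' \<ge> 2" | "t \<ge> 2" using tt by linarith
      then show ?thesis
        using s(2) s(3)[rule_format, of 2 t'] s(3)[rule_format, of t t'] tt by cases auto
    qed
    then show ?thesis using s(1) True by (intro exI[of _ s]) auto
  next
    case False
    then show ?thesis using chord[of e] that by simp
  qed
qed

section \<open>Target values read off from the extremal graph\<close>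

definition pair_target :: "(nat \<Rightarrow> real) \<Rightarrow> nat \<Rightarrow> nat \<Rightarrow> real" where
  "pair_target f m n = (\<Sum>t=1..m. f t) + (\<Sum>t=1..m-1. f t) + (real n - 1 - real m) * (f 1 + f m)"

definition single_target :: "(nat \<Rightarrow> real) \<Rightarrow> nat \<Rightarrow> nat \<Rightarrow> real" where
  "single_target f \<alpha> n = (if n \<le> 2 * \<alpha> then \<Sum>t=1..<n. f t
    else (\<Sum>t=1..2*\<alpha>-1. f t) + real ((n + 1) div 2 - \<alpha>) * f 1 + real (n div 2 - \<alpha>) * f (2*\<alpha>-1))"

text \<open>For \<open>m = 2\<alpha> - 1\<close>, \<open>single_target\<close> is the transmission in the extremal graph of order \<open>n\<close> of a
  vertex of the larger clique off the path, and \<open>pair_target\<close> is the contribution of two such vertices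
  in opposite cliques. Below order \<open>2\<alpha>\<close> the extremal graph is a path.\<close>

definition wmax :: "(nat \<Rightarrow> real) \<Rightarrow> nat \<Rightarrow> nat \<Rightarrow> real" where
  "wmax f \<alpha> n = (\<Sum>i=1..n. single_target f \<alpha> i)"

lemma wmax_Suc: "wmax f \<alpha> (Suc n) = wmax f \<alpha> n + single_target f \<alpha> (Suc n)"
  by (simp add: wmax_def)

lemma single_target_big:
  assumes "n \<ge> 2 * \<alpha>" "\<alpha> \<ge> 1"
  shows "single_target f \<alpha> n
    = (\<Sum>t=1..2*\<alpha>-1. f t) + real ((n + 1) div 2 - \<alpha>) * f 1 + real (n div 2 - \<alpha>) * f (2*\<alpha>-1)"
proof (cases "n = 2 * \<alpha>")
  case True
  have "{1..<2 * \<alpha>} = {1..2*\<alpha>-1}" using assms by auto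
  then show ?thesis using True by (simp add: single_target_def)
qed (use assms in \<open>simp add: single_target_def\<close>)

text \<open>The orders \<open>n\<close> and \<open>n - 1\<close> have opposite parity, so the
  roundings in the two values of \<open>single_target\<close> cancel and the formula for the pair is
  free of parity.\<close>

lemma pair_target_eq:
  assumes "n \<ge> 2 * \<alpha> + 1" "\<alpha> \<ge> 1"
  shows "single_target f \<alpha> n + single_target f \<alpha> (n - 1) = pair_target f (2 * \<alpha> - 1) n"
proof -
  define m where "m = 2 * \<alpha> - 1"
  have m: "m \<ge> 1" using assms by (simp add: m_def)
  have sm: "(\<Sum>t=1..m. f t) = (\<Sum>t=1..m-1. f t) + f m"
    using m by (cases m) auto
  have A: "real ((n + 1) div 2 - \<alpha>) + real ((n - 1 + 1) div 2 - \<alpha>) = real n - 1 - real m"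
    using assms by (cases "even n") (auto simp: m_def elim!: evenE oddE simp flip: of_nat_add)
  have B: "real (n div 2 - \<alpha>) + real ((n - 1) div 2 - \<alpha>) = real n - 1 - real m - 1"
  proof (cases "even n")
    case True
    then obtain k where k: "n = 2 * k" by (rule evenE)
    then have "(n - 1) div 2 = k - 1" by simp
    then show ?thesis using assms k by (simp add: m_def of_nat_diff)
  next
    case False
    then show ?thesis using assms by (auto simp: m_def of_nat_diff elim!: oddE)
  qed
  have "single_target f \<alpha> n + single_target f \<alpha> (n - 1)
    = 2 * (\<Sum>t=1..m. f t) + (real ((n + 1) div 2 - \<alpha>) + real ((n - 1 + 1) div 2 - \<alpha>)) * f 1
      + (real (n div 2 - \<alpha>) + real ((n - 1) div 2 - \<alpha>)) * f m"
    using assms by (simp add: single_target_big m_def algebra_simps)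
  also have "\<dots> = pair_target f m n"
    unfolding A B pair_target_def sm by (simp add: algebra_simps)
  finally show ?thesis by (simp add: m_def)
qed

lemma wmax_pair:
  assumes "n \<ge> 2 * \<alpha> + 1" "\<alpha> \<ge> 1"
  shows "wmax f \<alpha> n = wmax f \<alpha> (n - 2) + pair_target f (2 * \<alpha> - 1) n"
proof -
  obtain k where k: "n = Suc (Suc k)"
    using assms by (metis One_nat_def add_Suc_right le_Suc_ex plus_1_eq_Suc add_leD2 mult_2 not_less_eq_eq add.commute le_add2 One_nat_def Suc_le_D)
  show ?thesis
    using pair_target_eq[OF assms, of f] by (simp add: k wmax_Suc)
qed

lemma gauss_real: "(\<Sum>t=1..m. real t) = real m * (real m + 1) / 2"
  by (induction m) (auto simp: field_simps)

lemma pair_target_real: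
  assumes "\<alpha> \<ge> 1"
  shows "pair_target real (2 * \<alpha> - 1) n = 2 * real \<alpha> * (real n - 2) + 1"
proof -
  obtain b where "\<alpha> = Suc b" using assms by (cases \<alpha>) auto
  then show ?thesis
    unfolding pair_target_def gauss_real by (simp add: field_simps)
qed

text \<open>The right-hand side is half of the pair budget
  \<open>2 * \<alpha> * (n - 2) + 1\<close>, rounded up; odd \<open>n\<close> gives equality. Hence
  a transmission of at most \<open>\<alpha> * (n - 2)\<close> is strictly below the target.\<close>

lemma single_target_real:
  assumes "\<alpha> \<ge> 1" "n \<ge> 2 * \<alpha>"
  shows "single_target real \<alpha> n \<ge> real \<alpha> * (real n - 2) + 1"
proof -
  have "real (2 * \<alpha> - 1) = 2 * real \<alpha> - 1" using assms by simp
  moreover have "real ((n + 1) div 2 - \<alpha>) = real ((n + 1) div 2) - \<alpha>"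
    "real (n div 2 - \<alpha>) = real (n div 2) - \<alpha>"
    using assms by (auto simp: of_nat_diff)
  ultimately have eq: "single_target real \<alpha> n = (2 * real \<alpha> - 1) * real \<alpha>
      + (real ((n + 1) div 2) - \<alpha>) + (real (n div 2) - \<alpha>) * (2 * real \<alpha> - 1)"
    using assms unfolding single_target_big[OF assms(2,1)] gauss_real by simp
  show ?thesis
  proof (cases "even n")
    case True
    then obtain k where "n = 2 * k" by (rule evenE)
    then show ?thesis using eq assms by (simp add: algebra_simps)
  next
    case False
    then obtain k where "n = 2 * k + 1" by (rule oddE)
    then show ?thesis using eq by (simp add: algebra_simps)
  qed
qed

context convex_inc
begin

lemma f_le: "1 \<le> i \<Longrightarrow> i \<le> j \<Longrightarrow> f i \<le> f j"
  using f_less[of i j] by (cases "i = j") auto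

text \<open>After one representative for each distance up to \<open>e\<close>, the remaining
  vertices have distance at most \<open>e\<close>, whereas on a path seen from its end the distances
  would go on growing.\<close>

lemma path_profile:
  assumes "finite Z" "d ` Z = {1..e}" "card Z = n - 1" "e \<ge> 1"
  shows "(\<Sum>z\<in>Z. f (d z)) \<le> (\<Sum>t=1..<n. f t)"
    and "e \<noteq> n - 1 \<Longrightarrow> (\<Sum>z\<in>Z. f (d z)) < (\<Sum>t=1..<n. f t)"
proof -
  have e: "e \<le> n - 1"
    using card_image_le[OF assms(1), of d] assms by simp
  have "(\<Sum>z\<in>Z. f (d z)) \<le> (\<Sum>t=1..e. f t) + (real (card Z) - real (card {1..e})) * f e"
    using assms by (intro sum_cover_le f_le) auto
  also have "(real (card Z) - real (card {1..e})) * f e = (\<Sum>t=e+1..<n. f e)"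
    using e assms by (simp add: of_nat_diff algebra_simps)
  finally have 1: "(\<Sum>z\<in>Z. f (d z)) \<le> (\<Sum>t=1..e. f t) + (\<Sum>t=e+1..<n. f e)" .
  have "{1..<n} = {1..e} \<union> {e+1..<n}"
    using e assms(4) by auto
  then have 2: "(\<Sum>t=1..<n. f t) = (\<Sum>t=1..e. f t) + (\<Sum>t=e+1..<n. f t)"
    by (simp only: \<open>{1..<n} = _\<close>) (rule sum.union_disjoint; auto)
  have "(\<Sum>t=e+1..<n. f e) \<le> (\<Sum>t=e+1..<n. f t)"
    using assms by (intro sum_mono f_le) auto
  then show "(\<Sum>z\<in>Z. f (d z)) \<le> (\<Sum>t=1..<n. f t)" using 1 2 by simp
  assume "e \<noteq> n - 1"
  then have "(\<Sum>t=e+1..<n. f e) < (\<Sum>t=e+1..<n. f t)"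
    using assms e by (intro sum_strict_mono f_less) auto
  then show "(\<Sum>z\<in>Z. f (d z)) < (\<Sum>t=1..<n. f t)" using 1 2 by simp
qed

text \<open>Subtract from \<open>f\<close> the chord over \<open>[1, e1]\<close>, where \<open>e1\<close> is the smaller eccentricity. The
  remainder is nonpositive on \<open>[1, e1]\<close> and increasing afterwards, and every distance up to the
  eccentricity is attained, so that only the comparison of the plain sums is left.\<close>

lemma pair_profile:
  assumes fin: "finite X" "finite Y" and card: "card X + 2 = n" "card Y + 1 = n"
    and e: "1 \<le> e1" "e1 \<le> e2" "e2 \<le> m" "m + 1 \<le> n"
    and dx: "dx ` X \<subseteq> {1..e1}" "{1..e1 - 1} \<subseteq> dx ` X" and dy: "dy ` Y = {1..e2}"
    and lin: "real (\<Sum>z\<in>X. dx z) + real (\<Sum>z\<in>Y. dy z) \<le> pair_target real m n"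
  shows "(\<Sum>z\<in>X. f (dx z)) + (\<Sum>z\<in>Y. f (dy z)) \<le> pair_target f m n"
    and "real (\<Sum>z\<in>X. dx z) + real (\<Sum>z\<in>Y. dy z) < pair_target real m n \<Longrightarrow>
      (\<Sum>z\<in>X. f (dx z)) + (\<Sum>z\<in>Y. f (dy z)) < pair_target f m n"
proof -
  obtain s where s: "s > 0" "f e1 - s * real e1 = f 1 - s" "\<forall>t\<in>{1..e1}. f t - s * real t \<le> f 1 - s"
    "\<forall>t\<ge>e1. \<forall>t'\<ge>t. f t - s * real t \<le> f t' - s * real t'"
    using f_chord[OF e(1)] by blast
  define c where "c = f 1 - s"
  define \<phi> where "\<phi> = (\<lambda>t. f t - s * real t - c)"
  have \<phi>0: "\<phi> 1 = 0" "\<phi> e1 = 0" and neg: "\<And>t. t \<in> {1..e1} \<Longrightarrow> \<phi> t \<le> 0"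
    and mono: "\<And>t t'. e1 \<le> t \<Longrightarrow> t \<le> t' \<Longrightarrow> \<phi> t \<le> \<phi> t'"
    using s by (auto simp: \<phi>_def c_def)
  have pos: "\<phi> t \<ge> 0" if "e1 \<le> t" for t
    using mono[of e1 t] that \<phi>0 by simp
  have f_eq: "f t = \<phi> t + s * real t + c" for t
    by (simp add: \<phi>_def)
  have sum_eq: "(\<Sum>t\<in>A. f t) = (\<Sum>t\<in>A. \<phi> t) + s * (\<Sum>t\<in>A. real t) + c * real (card A)" for A
    by (simp add: f_eq sum.distrib sum_distrib_left)
  \<comment> \<open>Level \<open>e1\<close> may be missing from \<open>X\<close>, namely if the
    deleted partner was its only vertex. This costs nothing because
    \<open>\<phi> e1 = 0\<close>.\<close>
  have X: "(\<Sum>z\<in>X. \<phi> (dx z)) \<le> (\<Sum>t=1..e1. \<phi> t)"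
  proof -
    have "(\<Sum>z\<in>X. \<phi> (dx z)) \<le> (\<Sum>t\<in>{1..e1 - 1}. \<phi> t) + (real (card X) - real (card {1..e1 - 1})) * 0"
      using fin dx neg by (intro sum_cover_le) auto
    also have "(\<Sum>t\<in>{1..e1 - 1}. \<phi> t) = (\<Sum>t=1..e1. \<phi> t)"
      using \<phi>0(2) e(1) by (cases e1) auto
    finally show ?thesis by simp
  qed
  have "\<phi> t \<le> \<phi> e2" if "t \<in> {1..e2}" for t
    using neg[of t] mono[of t e2] pos[of e2] e(2) that by (cases "t \<le> e1") auto
  then have "(\<Sum>z\<in>Y. \<phi> (dy z)) \<le> (\<Sum>t\<in>{1..e2}. \<phi> t) + (real (card Y) - real (card {1..e2})) * \<phi> e2"
    using fin dy by (intro sum_cover_le) blast+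
  then have Y: "(\<Sum>z\<in>Y. \<phi> (dy z)) \<le> (\<Sum>t=1..e2. \<phi> t) + (real n - 1 - real e2) * \<phi> e2"
    using card(2) by (simp add: algebra_simps flip: card(2))
  \<comment> \<open>Raising the eccentricity from \<open>e2\<close> to \<open>m\<close> replaces
    copies of \<open>\<phi> e2\<close> by values that are at least as large.\<close>
  have Ym: "(\<Sum>t=1..e2. \<phi> t) + (real n - 1 - real e2) * \<phi> e2 \<le> (\<Sum>t=1..m. \<phi> t) + (real n - 1 - real m) * \<phi> m"
  proof -
    have "{1..m} = {1..e2} \<union> {e2+1..m}" using e by auto
    then have "(\<Sum>t=1..m. \<phi> t) = (\<Sum>t=1..e2. \<phi> t) + (\<Sum>t=e2+1..m. \<phi> t)"
      by (simp add: sum.union_disjoint)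
    moreover have "(\<Sum>t=e2+1..m. \<phi> t) \<ge> (\<Sum>t=e2+1..m. \<phi> e2)"
      using e by (intro sum_mono mono) auto
    moreover have "(\<Sum>t=e2+1..m. \<phi> e2) = (real m - real e2) * \<phi> e2"
      using e by (simp add: of_nat_diff)
    moreover have "(real n - 1 - real m) * \<phi> e2 \<le> (real n - 1 - real m) * \<phi> m"
      using e mono[of e2 m] by (intro mult_left_mono) auto
    ultimately show ?thesis by (simp add: algebra_simps)
  qed
  have Xm: "(\<Sum>t=1..e1. \<phi> t) \<le> (\<Sum>t=1..m-1. \<phi> t)"
  proof (cases "e1 = m")
    case True
    then show ?thesis using \<phi>0(2) e(1) by (cases m) auto
  next
    case False
    then show ?thesis
      using e pos by (intro sum_mono2) auto
  qed
  have \<phi>: "(\<Sum>z\<in>X. \<phi> (dx z)) + (\<Sum>z\<in>Y. \<phi> (dy z)) \<le> pair_target \<phi> m n"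
    using X Xm Y Ym unfolding pair_target_def \<phi>0(1) by simp
  \<comment> \<open>\<open>pair_target\<close> is linear in the function and counts
    \<open>2 * n - 3\<close> distances, the number of pairs of vertices that meet a given
    pair.\<close>
  have "pair_target f m n = pair_target \<phi> m n + s * pair_target real m n + c * (2 * real n - 3)"
    using e unfolding pair_target_def sum_eq by (simp add: f_eq algebra_simps of_nat_diff)
  moreover have "(\<Sum>z\<in>X. f (dx z)) + (\<Sum>z\<in>Y. f (dy z)) = (\<Sum>z\<in>X. \<phi> (dx z)) + (\<Sum>z\<in>Y. \<phi> (dy z))
      + s * (real (\<Sum>z\<in>X. dx z) + real (\<Sum>z\<in>Y. dy z)) + c * (2 * real n - 3)"
  proof -
    have cc: "real (card X) = real n - 2" "real (card Y) = real n - 1"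
      using card by auto
    show ?thesis
      by (simp add: f_eq sum.distrib sum_distrib_left cc)
        (simp add: sum_distrib_left algebra_simps)
  qed
  ultimately have diff: "pair_target f m n - ((\<Sum>z\<in>X. f (dx z)) + (\<Sum>z\<in>Y. f (dy z)))
      \<ge> s * (pair_target real m n - (real (\<Sum>z\<in>X. dx z) + real (\<Sum>z\<in>Y. dy z)))"
    using \<phi> by (simp add: algebra_simps)
  show "(\<Sum>z\<in>X. f (dx z)) + (\<Sum>z\<in>Y. f (dy z)) \<le> pair_target f m n"
    using diff lin s(1) mult_nonneg_nonneg[of s] by (smt (verit))
  show "(\<Sum>z\<in>X. f (dx z)) + (\<Sum>z\<in>Y. f (dy z)) < pair_target f m n"
    if "real (\<Sum>z\<in>X. dx z) + real (\<Sum>z\<in>Y. dy z) < pair_target real m n"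
    using diff that s(1) mult_pos_pos[of s] by (smt (verit))
qed

text \<open>The chord is taken over the range \<open>[1, e]\<close> of distances that occur, so the
  remainder is nonpositive at every vertex, while in the target the additional terms are
  nonnegative. Only the linear parts are left to compare.\<close>

lemma single_profile:
  assumes fin: "finite X" and card: "card X + 1 = n"
    and e: "1 \<le> e" "e \<le> 2 * \<alpha> - 1" "2 * \<alpha> \<le> n" "1 \<le> \<alpha>"
    and d: "d ` X = {1..e}"
    and lin: "real (\<Sum>z\<in>X. d z) < single_target real \<alpha> n"
  shows "(\<Sum>z\<in>X. f (d z)) < single_target f \<alpha> n"
proof -
  define m where "m = 2 * \<alpha> - 1"
  obtain s where s: "s > 0" "f e - s * real e = f 1 - s" "\<forall>t\<in>{1..e}. f t - s * real t \<le> f 1 - s"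
    "\<forall>t\<ge>e. \<forall>t'\<ge>t. f t - s * real t \<le> f t' - s * real t'"
    using f_chord[OF e(1)] by blast
  define c where "c = f 1 - s"
  define \<phi> where "\<phi> = (\<lambda>t. f t - s * real t - c)"
  have \<phi>0: "\<phi> 1 = 0" "\<phi> e = 0" and neg: "\<And>t. t \<in> {1..e} \<Longrightarrow> \<phi> t \<le> 0"
    and mono: "\<And>t t'. e \<le> t \<Longrightarrow> t \<le> t' \<Longrightarrow> \<phi> t \<le> \<phi> t'"
    using s by (auto simp: \<phi>_def c_def)
  have pos: "\<phi> t \<ge> 0" if "e \<le> t" for t
    using mono[of e t] that \<phi>0 by simp
  have f_eq: "f t = \<phi> t + s * real t + c" for t
    by (simp add: \<phi>_def)
  have "(\<Sum>z\<in>X. \<phi> (d z)) \<le> (\<Sum>t\<in>{1..e}. \<phi> t) + (real (card X) - real (card {1..e})) * 0"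
    using fin d neg by (intro sum_cover_le) blast+
  also have "\<dots> \<le> (\<Sum>t=1..m. \<phi> t)"
    using e pos by (auto simp: m_def intro!: sum_mono2)
  also have "\<dots> \<le> single_target \<phi> \<alpha> n"
    using e pos[of m] unfolding m_def by (simp add: single_target_big \<phi>0[simplified])
  finally have \<phi>: "(\<Sum>z\<in>X. \<phi> (d z)) \<le> single_target \<phi> \<alpha> n" .
  have cnt: "real m + real ((n + 1) div 2 - \<alpha>) + real (n div 2 - \<alpha>) = real n - 1"
    using e unfolding m_def by (cases "even n") (auto simp: of_nat_diff elim!: evenE oddE)
  have "single_target f \<alpha> n = single_target \<phi> \<alpha> n + s * single_target real \<alpha> n
      + c * (real m + real ((n + 1) div 2 - \<alpha>) + real (n div 2 - \<alpha>))"
    using e unfolding single_target_big[OF e(3,4)] m_def[symmetric]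
    by (simp add: f_eq sum.distrib sum_distrib_left algebra_simps)
  moreover have "(\<Sum>z\<in>X. f (d z)) = (\<Sum>z\<in>X. \<phi> (d z)) + s * real (\<Sum>z\<in>X. d z) + c * (real n - 1)"
    using card by (simp add: f_eq sum.distrib sum_distrib_left algebra_simps flip: card)
  moreover have "s * real (\<Sum>z\<in>X. d z) < s * single_target real \<alpha> n"
    using lin s(1) by simp
  ultimately show ?thesis
    using \<phi> unfolding cnt by simp
qed

end

subsection \<open>Induced paths with small complementary components\<close>

context sgraph
begin

definition ipath :: "(nat \<Rightarrow> 'a) \<Rightarrow> nat \<Rightarrow> bool" where
  "ipath p e \<longleftrightarrow> p ` {..e} \<subseteq> V \<and> inj_on p {..e}
    \<and> (\<forall>i\<le>e. \<forall>j\<le>e. (p i, p j) \<in> E \<longleftrightarrow> i = Suc j \<or> j = Suc i)"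

definition ball1 :: "'a set \<Rightarrow> 'a set" where
  "ball1 S = S \<union> E `` S"

text \<open>Because \<open>ball1 S\<close> has at least two vertices, at most one component of its complement violates
  the bound \<open>2 |B| + 2 \<le> |V|\<close>.\<close>

definition good :: "'a set \<Rightarrow> bool" where
  "good S \<longleftrightarrow> (\<forall>B. B \<subseteq> V - ball1 S \<longrightarrow> conn_on E B \<longrightarrow> 2 * card B + 2 \<le> card V)"

lemma good_mono: "good S \<Longrightarrow> ball1 S \<subseteq> ball1 T \<Longrightarrow> good T"
  unfolding good_def by blast

lemma ball1_mono: "S \<subseteq> T \<Longrightarrow> ball1 S \<subseteq> ball1 T"
  unfolding ball1_def by blast

lemma ipath_extend:
  assumes "ipath p e" "w \<in> V" "w \<notin> p ` {..e}" "E `` {w} \<inter> p ` {..e} = {p e}"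
  shows "ipath (p(Suc e := w)) (Suc e)"
    and "p(Suc e := w) ` {..Suc e} = insert w (p ` {..e})"
proof -
  have w: "(p i, w) \<in> E \<longleftrightarrow> i = e" "(w, p i) \<in> E \<longleftrightarrow> i = e" if "i \<le> e" for i
  proof -
    have "(w, p i) \<in> E \<longleftrightarrow> p i = p e"
      using assms(4) that by (auto simp: set_eq_iff)
    then show "(w, p i) \<in> E \<longleftrightarrow> i = e"
      using assms(1) that by (auto simp: ipath_def inj_on_def)
    then show "(p i, w) \<in> E \<longleftrightarrow> i = e" using E_comm by blast
  qed
  show "p(Suc e := w) ` {..Suc e} = insert w (p ` {..e})"
    by (auto simp: image_iff le_Suc_eq)
  then show "ipath (p(Suc e := w)) (Suc e)"
    using assms(1-3) w irrefl_E unfolding ipath_def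
    by (auto simp: inj_on_def le_Suc_eq)
qed

lemma ipath_rev:
  assumes "ipath p e"
  shows "ipath (\<lambda>i. p (e - i)) e" and "(\<lambda>i. p (e - i)) ` {..e} = p ` {..e}"
proof -
  have "j \<in> (\<lambda>i. e - i) ` {..e}" if "j \<le> e" for j
    using that by (intro image_eqI[of _ _ "e - j"]) auto
  then have "(\<lambda>i. e - i) ` {..e} = {..e}"
    by auto
  then show im: "(\<lambda>i. p (e - i)) ` {..e} = p ` {..e}"
    by (metis image_image)
  have "i = j" if "i \<le> e" "j \<le> e" "p (e - i) = p (e - j)" for i j
  proof -
    have "e - i = e - j"
      using assms that by (auto simp: ipath_def inj_on_def)
    then show ?thesis using that by simp
  qed
  then have "inj_on (\<lambda>i. p (e - i)) {..e}"
    by (simp add: inj_on_def)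
  moreover have "(p (e - i), p (e - j)) \<in> E \<longleftrightarrow> i = Suc j \<or> j = Suc i" if "i \<le> e" "j \<le> e" for i j
  proof -
    have "(p (e - i), p (e - j)) \<in> E \<longleftrightarrow> e - i = Suc (e - j) \<or> e - j = Suc (e - i)"
      using assms by (simp add: ipath_def)
    then show ?thesis using that by linarith
  qed
  ultimately show "ipath (\<lambda>i. p (e - i)) e"
    using assms unfolding ipath_def im by simp
qed

lemma ipath_length: "ipath p e \<Longrightarrow> e < card V"
  using card_mono[OF finite_V, of "p ` {..e}"] by (auto simp: ipath_def card_image)

text \<open>A maximal connected subset of \<open>U\<close> above \<open>B\<close> is closed under
  adjacency within \<open>U\<close>, since any neighbour could be added to it.\<close>

lemma component_above:
  assumes "U \<subseteq> V" "B \<subseteq> U" "conn_on E B" "B \<noteq> {}"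
  obtains C where "B \<subseteq> C" "C \<subseteq> U" "conn_on E C" "\<And>c w. c \<in> C \<Longrightarrow> w \<in> U \<Longrightarrow> (c, w) \<in> E \<Longrightarrow> w \<in> C"
proof -
  let ?P = "\<lambda>C. B \<subseteq> C \<and> C \<subseteq> U \<and> conn_on E C"
  have fin: "finite U" using assms(1) finite_V finite_subset by blast
  have "finite {C. ?P C}" "B \<in> {C. ?P C}"
    using fin assms by (auto intro: finite_subset[of _ "Pow U"])
  then obtain C where C: "?P C" "\<And>D. ?P D \<Longrightarrow> C \<subseteq> D \<Longrightarrow> C = D"
    using finite_has_maximal[of "{C. ?P C}"] by (metis (no_types, lifting) empty_iff mem_Collect_eq)
  have "w \<in> C" if "c \<in> C" "w \<in> U" "(c, w) \<in> E" for c w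
    using C(2)[of "insert w C"] conn_on_insert[OF sym_E, of C c w] C(1) that by auto
  then show ?thesis using that C(1) by blast
qed

end

context cgraph
begin

text \<open>Gyarfas' path argument: as long as some component is too large, extend the path into it.\<close>

lemma ex_good_ipath:
  assumes "card V \<ge> 2"
  shows "\<exists>p e. ipath p e \<and> good (p ` {..e})"
proof (rule ccontr)
  assume "\<not> ?thesis"
  then have bad: "\<And>p e. ipath p e \<Longrightarrow> \<not> good (p ` {..e})" by blast
  \<comment> \<open>\<open>B\<close> is the oversized connected part into which the path can still
    grow. It meets the neighbourhood of the path only through the last vertex, which keeps every
    extension induced.\<close>
  define valid where "valid = (\<lambda>p e B. ipath p e \<and> B \<subseteq> V \<and> B \<inter> p ` {..e} = {} \<and> conn_on E B
    \<and> card V < 2 * card B + 2 \<and> (\<exists>b\<in>B. (p e, b) \<in> E) \<and> (\<forall>i<e. \<forall>b\<in>B. (p i, b) \<notin> E))"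
  have "\<exists>e p B. valid p e B"
  proof -
    obtain v where v: "v \<in> V" using assms by (cases "V = {}") auto
    have ip: "ipath (\<lambda>_. v) 0" using v irrefl_E by (auto simp: ipath_def)
    obtain B where B: "B \<subseteq> V - ball1 {v}" "conn_on E B" "card V < 2 * card B + 2"
      using bad[OF ip] by (auto simp: good_def not_le)
    have "B \<noteq> {}" using B(3) assms by auto
    then obtain C where C: "B \<subseteq> C" "C \<subseteq> V - {v}" "conn_on E C"
      "\<And>c w. c \<in> C \<Longrightarrow> w \<in> V - {v} \<Longrightarrow> (c, w) \<in> E \<Longrightarrow> w \<in> C"
      using component_above[of "V - {v}" B] B by (auto simp: ball1_def)
    obtain c w where "c \<in> C" "w \<in> V - C" "(c, w) \<in> E"
      using conn_on_boundary[OF conn, of C _ v] C(1,2) v \<open>B \<noteq> {}\<close> by blast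
    then have "(v, c) \<in> E" using C(4) E_comm by blast
    moreover have "card B \<le> card C"
      using C finite_V by (meson card_mono finite_Diff finite_subset)
    ultimately have "valid (\<lambda>_. v) 0 C"
      using ip C B(3) \<open>c \<in> C\<close> by (auto simp: valid_def)
    then show ?thesis by blast
  qed
  moreover have bound: "\<forall>e. (\<exists>p B. valid p e B) \<longrightarrow> e \<le> card V"
    unfolding valid_def using less_imp_le_nat[OF ipath_length] by blast
  ultimately have "\<exists>p B. valid p (GREATEST e. \<exists>p B. valid p e B) B"
    using GreatestI_ex_nat[of "\<lambda>e. \<exists>p B. valid p e B" "card V"] by simp
  moreover have "e' \<le> (GREATEST e. \<exists>p B. valid p e B)" if "\<exists>p B. valid p e' B" for e'
    using Greatest_le_nat[of "\<lambda>e. \<exists>p B. valid p e B" e' "card V"] that bound by simp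
  ultimately obtain e where e: "\<exists>p B. valid p e B" "\<And>e'. \<exists>p B. valid p e' B \<Longrightarrow> e' \<le> e"
    by metis
  then obtain p B where v: "valid p e B" by blast
  define P where "P = p ` {..e}"
  have ip: "ipath p e" using v by (simp add: valid_def)
  define U where "U = V - ball1 (p ` {..<e}) - {p e}"
  have "B \<subseteq> U"
    using v by (auto simp: U_def valid_def ball1_def)
  moreover have Bne: "B \<noteq> {}" using v by (auto simp: valid_def)
  ultimately obtain C where C: "B \<subseteq> C" "C \<subseteq> U" "conn_on E C"
    "\<And>c w. c \<in> C \<Longrightarrow> w \<in> U \<Longrightarrow> (c, w) \<in> E \<Longrightarrow> w \<in> C"
    using component_above[of U B] v by (auto simp: valid_def U_def)
  have fin: "finite C" "C \<subseteq> V" using C finite_V by (auto simp: U_def intro: finite_subset)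
  have cardC: "card V < 2 * card C + 2"
    using v card_mono[OF fin(1) C(1)] by (auto simp: valid_def)
  obtain B' where B': "B' \<subseteq> V - ball1 P" "conn_on E B'" "card V < 2 * card B' + 2"
    using bad[OF ip] by (auto simp: good_def not_le P_def)
  have "B' \<noteq> {}" using B'(3) assms by auto
  then obtain C' where C': "B' \<subseteq> C'" "C' \<subseteq> V - ball1 P" "conn_on E C'"
    "\<And>c w. c \<in> C' \<Longrightarrow> w \<in> V - ball1 P \<Longrightarrow> (c, w) \<in> E \<Longrightarrow> w \<in> C'"
    using component_above[of "V - ball1 P" B'] B' by auto
  have fin': "finite C'" "C' \<subseteq> V" using C' finite_V by (auto intro: finite_subset)
  have C'ne: "C' \<noteq> {}" using C'(1) \<open>B' \<noteq> {}\<close> by auto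
  have cardC': "card V < 2 * card C' + 2"
    using B'(3) card_mono[OF fin'(1) C'(1)] by auto
  have "ball1 (p ` {..<e}) \<subseteq> ball1 P" "p e \<in> ball1 P"
    by (intro ball1_mono) (auto simp: P_def ball1_def)
  then have C'U: "C' \<subseteq> U"
    using C'(2) unfolding U_def by blast
  have pe: "p e \<in> V" "p e \<notin> C" "p e \<notin> C'"
    using ip C(2) C'(2) by (auto simp: ipath_def U_def P_def ball1_def)
  have far: "(p i, c) \<notin> E" "(c, p i) \<notin> E" if "c \<in> C'" "i \<le> e" for c i
  proof -
    have "c \<notin> E `` P" using C'(2) that by (auto simp: ball1_def)
    then show "(p i, c) \<notin> E" using that by (auto simp: P_def)
    then show "(c, p i) \<notin> E" using E_comm by blast
  qed
  \<comment> \<open>Two disjoint oversized sets and \<open>p e\<close> would exhaust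
    \<open>V\<close>. As \<open>C'\<close> sees no vertex of the path, it would have to be adjacent
    to \<open>C\<close>, and since \<open>C\<close> is closed within \<open>U\<close>, it would then
    share a vertex with \<open>C\<close>.\<close>
  have meet: "C' \<inter> C \<noteq> {}"
  proof
    assume disj: "C' \<inter> C = {}"
    have "card (insert (p e) (C \<union> C')) = card C + card C' + 1"
      using disj fin fin' pe by (simp add: card_Un_disjoint Int_commute)
    then have all: "insert (p e) (C \<union> C') = V"
      using cardC cardC' fin fin' pe finite_V
      by (intro card_seteq) (auto simp del: card_insert_disjoint)
    obtain a b where ab: "a \<in> C'" "b \<in> V - C'" "(a, b) \<in> E"
      using conn_on_boundary[OF conn fin'(2)] C'ne pe by blast
    have "b \<noteq> p e" using ab far by auto
    then have "b \<in> C" using ab all by auto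
    then have "a \<in> C" using C(4)[of b a] ab C'U E_comm by blast
    then show False using ab disj by auto
  qed
  have sub: "C' \<subseteq> C"
  proof (rule ccontr)
    assume "\<not> C' \<subseteq> C"
    then obtain a b where "a \<in> C' \<inter> C" "b \<in> C' - (C' \<inter> C)" "(a, b) \<in> E"
      using conn_on_boundary[OF C'(3), of "C' \<inter> C"] meet by blast
    then show False using C(4) C'U by blast
  qed
  obtain b0 where "b0 \<in> C" "(p e, b0) \<in> E" using v C(1) by (auto simp: valid_def)
  moreover from this have "b0 \<notin> C'" using far by auto
  ultimately obtain a w where aw: "a \<in> C'" "w \<in> C - C'" "(a, w) \<in> E"
    using conn_on_boundary[OF C(3) sub, of _ b0] C'ne by blast
  have wU: "w \<in> U" using aw C(2) by auto
  \<comment> \<open>Outside the closed neighbourhood of \<open>P\<close>, \<open>w\<close> would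
    belong to \<open>C'\<close>. Being in \<open>U\<close>, it sees only \<open>p e\<close> on the
    path; so it prolongs the path, with \<open>C'\<close> as the new oversized part.\<close>
  have "w \<in> ball1 P" using C'(4) aw wU by (auto simp: U_def)
  then have pw: "(p e, w) \<in> E" "w \<notin> P" "\<And>i. i < e \<Longrightarrow> (p i, w) \<notin> E"
  proof -
    have notin: "w \<notin> p ` {..<e}" "w \<notin> E `` (p ` {..<e})" "w \<noteq> p e"
      using wU by (auto simp: U_def ball1_def)
    have split: "{..e} = insert e {..<e}" by auto
    show "(p e, w) \<in> E" "w \<notin> P" "\<And>i. i < e \<Longrightarrow> (p i, w) \<notin> E"
      using notin \<open>w \<in> ball1 P\<close> unfolding P_def split by (auto simp: ball1_def)
  qed
  have "E `` {w} \<inter> P = {p e}"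
  proof -
    have "(w, p e) \<in> E" "\<And>i. i < e \<Longrightarrow> (w, p i) \<notin> E"
      using pw E_comm by blast+
    moreover have "P = insert (p e) (p ` {..<e})" by (auto simp: P_def nat_less_le)
    ultimately show ?thesis by auto
  qed
  then have ext: "ipath (p(Suc e := w)) (Suc e)" "p(Suc e := w) ` {..Suc e} = insert w P"
    using ipath_extend[OF ip, of w] pw wU by (auto simp: P_def U_def)
  have "valid (p(Suc e := w)) (Suc e) C'"
    using ext fin' C'(2,3) cardC' aw E_sym[OF aw(3)] far unfolding valid_def ext(2)
    by (auto simp: ball1_def less_Suc_eq_le)
  then show False using e(2)[of "Suc e"] by auto
qed

lemma longest_good_ipath:
  assumes "card V \<ge> 2"
  obtains p e where "ipath p e" "good (p ` {..e})" "\<And>q d. ipath q d \<Longrightarrow> good (q ` {..d}) \<Longrightarrow> d \<le> e"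
proof -
  have "\<exists>e. \<exists>p. ipath p e \<and> good (p ` {..e})" using ex_good_ipath[OF assms] by blast
  then obtain e where "\<exists>p. ipath p e \<and> good (p ` {..e})"
    "\<And>d. \<exists>p. ipath p d \<and> good (p ` {..d}) \<Longrightarrow> d \<le> e"
    using ex_has_greatest_nat[of "\<lambda>e. \<exists>p. ipath p e \<and> good (p ` {..e})" _ "\<lambda>e. e" "card V"] ipath_length
    by (metis less_imp_le_nat)
  then show ?thesis using that by blast
qed

end

subsection \<open>Transmissions of the ends of a good induced path\<close>

lemma card_same_parity: "card {j. j \<le> n \<and> even (n + j)} = n div 2 + 1"
proof (induction n rule: nat_less_induct)
  case (1 n)
  show ?case
  proof (cases "n < 2")
    case True
    then consider "n = 0" | "n = 1" by linarith
    then show ?thesis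
    proof cases
      case 1
      have "{j. j \<le> (0::nat) \<and> even (0 + j)} = {0}" by auto
      then show ?thesis using 1 by simp
    next
      case 2
      have "{j. j \<le> (1::nat) \<and> even (1 + j)} = {1}" by (auto simp: le_Suc_eq)
      then show ?thesis using 2 by simp
    qed
  next
    case False
    then obtain k where k: "n = Suc (Suc k)" by (metis less_2_cases_iff not0_implies_Suc One_nat_def)
    have "{j. j \<le> n \<and> even (n + j)} = insert n {j. j \<le> k \<and> even (k + j)}"
      by (auto simp: k le_Suc_eq)
    moreover have "n \<notin> {j. j \<le> k \<and> even (k + j)}" using k by auto
    ultimately show ?thesis using 1 k by simp
  qed
qed

context cgraph
begin

lemma sdist_ge_2:
  assumes "S \<subseteq> V" "S \<noteq> {}" "z \<in> V"
  shows "2 \<le> sdist E S z \<longleftrightarrow> z \<notin> ball1 S"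
proof
  assume 2: "2 \<le> sdist E S z"
  then have "z \<notin> S" using sdist_eq_0[OF assms] by auto
  moreover have "z \<notin> E `` S"
  proof
    assume "z \<in> E `` S"
    then obtain s where s: "s \<in> S" "(s, z) \<in> E" by auto
    then have "sdist E S s = 0" using sdist_eq_0[of S s] assms by auto
    then show False using sdist_step[OF assms(1,2) s(2)] 2 by simp
  qed
  ultimately show "z \<notin> ball1 S" by (simp add: ball1_def)
next
  assume n: "z \<notin> ball1 S"
  show "2 \<le> sdist E S z"
  proof (rule ccontr)
    assume "\<not> ?thesis"
    then consider "sdist E S z = 0" | "sdist E S z = Suc 0" by linarith
    then show False
    proof cases
      case 1
      then show False using n sdist_eq_0[OF assms] by (auto simp: ball1_def)
    next
      case 2
      then obtain u where u: "(u, z) \<in> E" "sdist E S u = 0"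
        using sdist_pred[OF assms, of 0] by auto
      then have "u \<in> S" using sdist_eq_0[OF assms(1,2), of u] E_sub by auto
      then show False using n u by (auto simp: ball1_def)
    qed
  qed
qed

section \<open>Components outside a closed neighbourhood and their heights\<close>

definition far :: "'a set \<Rightarrow> 'a set" where
  "far S = V - ball1 S"

definition crel :: "'a set \<Rightarrow> 'a rel" where
  "crel S = {(u, v). u \<in> far S \<and> v \<in> far S \<and> (u, v) \<in> (E \<inter> far S \<times> far S)\<^sup>*}"

definition hgt :: "'a set \<Rightarrow> 'a set \<Rightarrow> nat" where
  "hgt S B = Max (sdist E S ` B)"

lemma equiv_crel: "equiv (far S) (crel S)"
proof (rule equivI)
  show "crel S \<subseteq> far S \<times> far S" "refl_on (far S) (crel S)"
    by (auto simp: crel_def refl_on_def)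
  have "sym (E \<inter> far S \<times> far S)" using sym_E by (auto simp: sym_def)
  then have "sym ((E \<inter> far S \<times> far S)\<^sup>*)" by (rule sym_rtrancl)
  then show "sym (crel S)" by (auto simp: crel_def sym_def)
  show "trans (crel S)" by (auto simp: crel_def trans_def)
qed

lemma comp_closed:
  assumes "B \<in> far S // crel S" "c \<in> B" "w \<in> far S" "(c, w) \<in> E"
  shows "w \<in> B"
proof -
  have "c \<in> far S" using assms(1,2) equiv_crel[of S]
    by (meson in_quotient_imp_subset subsetD)
  then have "(c, w) \<in> crel S" using assms by (auto simp: crel_def)
  then show ?thesis
    using assms(1,2) equiv_crel[of S] by (meson in_quotient_imp_closed)
qed

lemma comp_conn:
  assumes "B \<in> far S // crel S"
  shows "conn_on E B"
  unfolding conn_on_def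
proof (intro ballI)
  fix u v assume u: "u \<in> B" and v: "v \<in> B"
  have "(u, v) \<in> crel S"
    using assms u v equiv_crel[of S] by (meson quotient_eq_iff)
  then have "(u, v) \<in> (E \<inter> far S \<times> far S)\<^sup>*" by (simp add: crel_def)
  then have "(u, v) \<in> (E \<inter> B \<times> B)\<^sup>* \<and> v \<in> B"
  proof induction
    case base
    then show ?case using u by simp
  next
    case (step y z)
    then have "z \<in> B" using comp_closed[OF assms, of y z] by auto
    then show ?case using step by (auto intro: rtrancl_into_rtrancl)
  qed
  then show "(u, v) \<in> (E \<inter> B \<times> B)\<^sup>*" by simp
qed

lemma finite_far: "finite (far S)"
  using finite_V by (simp add: far_def)

lemma finite_comps: "finite (far S // crel S)"
  using finite_quotient[OF finite_far, of "crel S"] equiv_crel by (auto simp: equiv_def)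

lemma comp_subset: "B \<in> far S // crel S \<Longrightarrow> B \<subseteq> far S"
  using equiv_crel by (rule in_quotient_imp_subset)

lemma comp_nonempty: "B \<in> far S // crel S \<Longrightarrow> B \<noteq> {}"
  using equiv_crel by (metis in_quotient_imp_non_empty)

lemma comp_finite: "B \<in> far S // crel S \<Longrightarrow> finite B"
  using comp_subset finite_far finite_subset by metis

lemma comp_disjoint: "B \<in> far S // crel S \<Longrightarrow> B' \<in> far S // crel S \<Longrightarrow> B \<noteq> B' \<Longrightarrow> B \<inter> B' = {}"
  using quotient_disj[OF equiv_crel] by metis

lemma comp_nonadj:
  assumes "B \<in> far S // crel S" "B' \<in> far S // crel S" "B \<noteq> B'" "b \<in> B" "b' \<in> B'"
  shows "(b, b') \<notin> E"
  using comp_closed[OF assms(1,4), of b'] comp_disjoint[OF assms(1-3)] comp_subset[OF assms(2)] assms(5)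
  by blast

lemma hgt_ge: "B \<in> far S // crel S \<Longrightarrow> z \<in> B \<Longrightarrow> sdist E S z \<le> hgt S B"
  unfolding hgt_def using comp_finite by (intro Max_ge) auto

text \<open>Descending from a highest vertex along predecessors stays outside \<open>ball1 S\<close>
  as long as the distance is at least 2, and hence stays in the same component.\<close>

lemma comp_level:
  assumes S: "S \<subseteq> V" "S \<noteq> {}" and B: "B \<in> far S // crel S" and j: "2 \<le> j" "j \<le> hgt S B"
  shows "\<exists>w\<in>B. sdist E S w = j"
proof -
  have "hgt S B \<in> sdist E S ` B"
    unfolding hgt_def using B comp_finite comp_nonempty by (intro Max_in) auto
  then obtain z where z: "z \<in> B" "sdist E S z = hgt S B" by auto
  have "\<exists>w\<in>B. sdist E S w = j" if "z \<in> B" "j \<le> sdist E S z" for z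
    using that
  proof (induction "sdist E S z - j" arbitrary: z)
    case 0
    then show ?case by (intro bexI[of _ z]) auto
  next
    case (Suc d)
    then obtain k where k: "sdist E S z = Suc k" by (cases "sdist E S z") auto
    have zV: "z \<in> V" using Suc.prems comp_subset[OF B] by (auto simp: far_def)
    obtain u where u: "(u, z) \<in> E" "sdist E S u = k"
      using sdist_pred[OF S zV k] by blast
    have "u \<in> far S"
      using sdist_ge_2[OF S, of u] u E_sub Suc.hyps(2) k j by (auto simp: far_def)
    then have "u \<in> B" using comp_closed[OF B Suc.prems(1), of u] u E_sym by blast
    then show ?case using Suc u k by (intro Suc.hyps(1)[of u]) auto
  qed
  then show ?thesis using z j by simp
qed

lemma hgt_ge_2:
  assumes "S \<subseteq> V" "S \<noteq> {}" "B \<in> far S // crel S"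
  shows "2 \<le> hgt S B"
proof -
  obtain z where z: "z \<in> B" using comp_nonempty[OF assms(3)] by auto
  then have "2 \<le> sdist E S z"
    using sdist_ge_2[OF assms(1,2), of z] comp_subset[OF assms(3)] by (auto simp: far_def)
  then show ?thesis using hgt_ge[OF assms(3) z] by simp
qed

text \<open>In every component take one vertex on each of the levels \<open>H, H - 2, \<dots> \<ge> 2\<close>, where \<open>H\<close> is its
  height. If \<open>H\<close> is odd, level \<open>2\<close> is not used, which leaves room for neighbours of \<open>S\<close>.\<close>

lemma far_indep:
  assumes S: "S \<subseteq> V" "S \<noteq> {}"
  obtains T where "T \<subseteq> far S" "indep E T"
    "(\<Sum>B\<in>far S // crel S. hgt S B - 1) \<le> 2 * card T"
    "\<And>B. B \<in> far S // crel S \<Longrightarrow> even (hgt S B) \<Longrightarrow> (\<Sum>B\<in>far S // crel S. hgt S B - 1) + 1 \<le> 2 * card T"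
    "\<forall>B\<in>far S // crel S. odd (hgt S B) \<Longrightarrow> \<forall>t\<in>T. 3 \<le> sdist E S t"
proof -
  let ?C = "far S // crel S"
  have "\<forall>B\<in>?C. \<forall>j. \<exists>w. 2 \<le> j \<longrightarrow> j \<le> hgt S B \<longrightarrow> w \<in> B \<and> sdist E S w = j"
    using comp_level[OF S] by meson
  then obtain w where w: "\<And>B j. B \<in> ?C \<Longrightarrow> 2 \<le> j \<Longrightarrow> j \<le> hgt S B \<Longrightarrow> w B j \<in> B \<and> sdist E S (w B j) = j"
    by metis
  define J where "J = (\<lambda>H::nat. {j. 2 \<le> j \<and> j \<le> H \<and> even (H + j)})"
  define I where "I = (\<lambda>B. w B ` J (hgt S B))"
  define T where "T = (\<Union>B\<in>?C. I B)"
  have I_sub: "I B \<subseteq> B" if "B \<in> ?C" for B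
    using w that by (auto simp: I_def J_def)
  have cardJ: "card (J H) = H div 2" if "2 \<le> H" for H
  proof -
    \<comment> \<open>\<open>H mod 2\<close> is the one level of the right parity that lies below 2
      and is therefore left out of \<open>J H\<close>.\<close>
    have "{j. j \<le> H \<and> even (H + j)} = insert (H mod 2) (J H)"
      using that by (auto simp: J_def) presburger+
    moreover have "H mod 2 \<notin> J H" by (auto simp: J_def)
    moreover have "finite (J H)" by (simp add: J_def)
    ultimately show ?thesis using card_same_parity[of H] by simp
  qed
  have cardI: "card (I B) = hgt S B div 2" if "B \<in> ?C" for B
  proof -
    have "inj_on (w B) (J (hgt S B))"
      using w[OF that] by (intro inj_on_inverseI[where g = "sdist E S"]) (auto simp: J_def)
    then show ?thesis
      using cardJ hgt_ge_2[OF S that] by (simp add: I_def card_image)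
  qed
  have finI: "finite (I B)" for B by (simp add: I_def J_def)
  have cardT: "card T = (\<Sum>B\<in>?C. hgt S B div 2)"
  proof -
    have "card T = (\<Sum>B\<in>?C. card (I B))"
      unfolding T_def using finite_comps finI comp_disjoint I_sub by (intro card_UN_disjoint) blast+
    then show ?thesis using cardI by simp
  qed
  have 1: "T \<subseteq> far S" unfolding T_def using I_sub comp_subset by blast
  have 2: "indep E T"
    unfolding indep_def
  proof (intro ballI notI)
    fix u v assume "u \<in> T" "v \<in> T" and uv: "(u, v) \<in> E"
    then obtain B B' where B: "B \<in> ?C" "u \<in> I B" and B': "B' \<in> ?C" "v \<in> I B'"
      by (auto simp: T_def)
    then have [simp]: "B' = B" using comp_nonadj uv I_sub by (metis subsetD)
    obtain i j where ij: "i \<in> J (hgt S B)" "j \<in> J (hgt S B)" "u = w B i" "v = w B j"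
      using B B' by (auto simp: I_def)
    have d: "sdist E S u = i" "sdist E S v = j"
      using w[OF B(1)] ij by (auto simp: J_def)
    have "i \<noteq> j" using uv irrefl_E ij by auto
    moreover have "even (i + j)" using ij(1,2) by (auto simp: J_def)
    ultimately have "i \<ge> j + 2 \<or> j \<ge> i + 2" by presburger
    then show False
      using sdist_step[OF S uv] sdist_step[OF S E_sym[OF uv]] d by auto
  qed
  have ge: "hgt S B - 1 \<le> 2 * (hgt S B div 2)" for B by simp
  then have 3: "(\<Sum>B\<in>?C. hgt S B - 1) \<le> 2 * card T"
    unfolding cardT sum_distrib_left by (rule sum_mono)
  \<comment> \<open>For odd height \<open>H\<close> the number \<open>2 * (H div 2)\<close> is
    exactly \<open>H - 1\<close>; an even height gains one unit.\<close>
  have 4: "(\<Sum>B\<in>?C. hgt S B - 1) + 1 \<le> 2 * card T" if "B \<in> ?C" "even (hgt S B)" for B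
  proof -
    have "hgt S B - 1 < 2 * (hgt S B div 2)"
      using hgt_ge_2[OF S that(1)] that(2) by auto
    then have "(\<Sum>B\<in>?C. hgt S B - 1) < (\<Sum>B\<in>?C. 2 * (hgt S B div 2))"
      using ge finite_comps that(1) by (intro sum_strict_mono_ex1) auto
    then show ?thesis by (simp add: cardT sum_distrib_left)
  qed
  have 5: "\<forall>t\<in>T. 3 \<le> sdist E S t" if odd: "\<forall>B\<in>?C. odd (hgt S B)"
  proof
    fix t assume t: "t \<in> T"
    obtain B j where B: "B \<in> ?C" "j \<in> J (hgt S B)" "t = w B j" using t by (auto simp: T_def I_def)
    then have "sdist E S t = j" using w[OF B(1)] by (auto simp: J_def)
    moreover have "j \<noteq> 2" "2 \<le> j" using odd B(1,2) by (auto simp: J_def)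
    ultimately show "3 \<le> sdist E S t" by simp
  qed
  show ?thesis by (rule that[OF 1 2 3 4 5])
qed

end

lemma (in sgraph) indep_Un:
  assumes "indep E A" "indep E B" "\<And>a b. a \<in> A \<Longrightarrow> b \<in> B \<Longrightarrow> (a, b) \<notin> E"
  shows "indep E (A \<union> B)"
  using assms E_sym unfolding indep_def by blast

section \<open>Independence and transmission bounds along a good induced path\<close>

locale gpath = cgraph +
  fixes p :: "nat \<Rightarrow> 'a" and e \<alpha> :: nat
  assumes ip: "ipath p e" and gd: "good (p ` {..e})" and e_pos: "1 \<le> e"
    and alpha: "\<And>I. I \<subseteq> V \<Longrightarrow> indep E I \<Longrightarrow> card I \<le> \<alpha>"
begin

definition P :: "'a set" where "P = p ` {..e}"

text \<open>A neighbour of the path with distance sum \<open>e + 2\<close> to the two ends forces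
  the value 1. The loss is recovered from independence, because such a vertex can replace a single
  vertex in an independent set.\<close>

definition single :: nat where
  "single = of_bool (\<exists>w\<in>V - P. card (E `` {w} \<inter> P) = 1)"

definition comps :: "'a set set" where "comps = far P // crel P"

definition excess :: nat where "excess = (\<Sum>B\<in>comps. hgt P B - 1)"

lemma PV: "P \<subseteq> V" "P \<noteq> {}" "finite P"
  using ip by (auto simp: P_def ipath_def)

lemma pV: "i \<le> e \<Longrightarrow> p i \<in> V" "i \<le> e \<Longrightarrow> p i \<in> P"
  using PV(1) by (auto simp: P_def)

lemma p_inj: "i \<le> e \<Longrightarrow> j \<le> e \<Longrightarrow> p i = p j \<longleftrightarrow> i = j"
  using ip by (auto simp: ipath_def inj_on_def)

lemma p_adj: "i \<le> e \<Longrightarrow> j \<le> e \<Longrightarrow> (p i, p j) \<in> E \<longleftrightarrow> i = Suc j \<or> j = Suc i"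
  using ip by (auto simp: ipath_def)

lemma card_P: "card P = e + 1"
  using ip by (simp add: P_def ipath_def card_image)

lemma far_nonadj: "t \<in> far P \<Longrightarrow> u \<in> P \<Longrightarrow> (u, t) \<notin> E"
  by (auto simp: far_def ball1_def)

lemma indep_parity:
  "indep E (p ` {j. j \<le> e \<and> even (k + j)})" "card (p ` A) = card A" if "A \<subseteq> {..e}" for A
proof -
  show "indep E (p ` {j. j \<le> e \<and> even (k + j)})"
    using p_adj by (auto simp: indep_def)
  show "card (p ` A) = card A"
    using ip that by (auto simp: ipath_def card_image inj_on_subset)
qed

text \<open>\<open>A\<close> is united with the independent set of \<open>far_indep\<close>. No edge
  joins the two: either \<open>A\<close> lies on the path, which vertices of \<open>far P\<close> do
  not see, or all heights are odd, and then the far set starts at level 3 while \<open>A\<close>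
  ends at level 1.\<close>

lemma excess_le_of_indep:
  assumes "A \<subseteq> ball1 P" "A \<subseteq> V" "indep E A"
    and "A \<subseteq> P \<or> (\<forall>B\<in>comps. odd (hgt P B))"
  shows "2 * card A + excess \<le> 2 * \<alpha>"
    and "B \<in> comps \<Longrightarrow> even (hgt P B) \<Longrightarrow> 2 * card A + excess + 1 \<le> 2 * \<alpha>"
proof -
  obtain T where T: "T \<subseteq> far P" "indep E T" "excess \<le> 2 * card T"
    "\<And>B. B \<in> comps \<Longrightarrow> even (hgt P B) \<Longrightarrow> excess + 1 \<le> 2 * card T"
    "\<forall>B\<in>comps. odd (hgt P B) \<Longrightarrow> \<forall>t\<in>T. 3 \<le> sdist E P t"
    using far_indep[OF PV(1,2)] unfolding comps_def excess_def by metis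
  have "(a, t) \<notin> E" if at: "a \<in> A" "t \<in> T" for a t
    using assms(4)
  proof
    assume "A \<subseteq> P"
    then show ?thesis using far_nonadj T(1) at by blast
  next
    assume "\<forall>B\<in>comps. odd (hgt P B)"
    then have 3: "3 \<le> sdist E P t" using T(5) at by blast
    have "\<not> 2 \<le> sdist E P a" using sdist_ge_2[OF PV(1,2), of a] at assms(1,2) by blast
    then show ?thesis using 3 sdist_step[OF PV(1,2), of a t] by auto
  qed
  then have "indep E (A \<union> T)" using T(2) assms(3) by (intro indep_Un) auto
  moreover have TV: "T \<subseteq> V" using T(1) by (auto simp: far_def)
  ultimately have "card (A \<union> T) \<le> \<alpha>" using assms(2) by (intro alpha) auto
  moreover have "card (A \<union> T) = card A + card T"
    using assms(1,2) T(1) TV finite_V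
    by (intro card_Un_disjoint) (auto simp: far_def intro: finite_subset)
  ultimately have "card A + card T \<le> \<alpha>" by simp
  then show "2 * card A + excess \<le> 2 * \<alpha>"
    "B \<in> comps \<Longrightarrow> even (hgt P B) \<Longrightarrow> 2 * card A + excess + 1 \<le> 2 * \<alpha>"
    using T(3) T(4)[of B] by auto
qed

text \<open>The first two bounds use \<open>p e, p (e - 2), ...\<close> as the set on the path. In
  the third, the unit \<open>single\<close> is paid by the surplus of a component of even height. If
  there is none, a vertex \<open>w\<close> whose only neighbour on the path is \<open>p i\<close>
  joins the path vertices of parity opposite to \<open>i\<close>.\<close>

lemma excess_bounds:
  shows "2 * (e div 2 + 1) + excess \<le> 2 * \<alpha>"
    and "B \<in> comps \<Longrightarrow> even (hgt P B) \<Longrightarrow> e + 2 + excess \<le> 2 * \<alpha>"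
    and "e + 1 + single + excess \<le> 2 * \<alpha>"
proof -
  let ?J = "{j. j \<le> e \<and> even (e + j)}"
  have J: "p ` ?J \<subseteq> P" "indep E (p ` ?J)" "card (p ` ?J) = e div 2 + 1"
    using indep_parity[of ?J] card_same_parity[of e] by (auto simp: P_def)
  have JV: "p ` ?J \<subseteq> ball1 P" "p ` ?J \<subseteq> V" using J(1) PV by (auto simp: ball1_def)
  show 1: "2 * (e div 2 + 1) + excess \<le> 2 * \<alpha>"
    using excess_le_of_indep(1)[OF JV J(2)] J by auto
  show 2: "e + 2 + excess \<le> 2 * \<alpha>" if "B \<in> comps" "even (hgt P B)" for B
    using excess_le_of_indep(2)[OF JV J(2) _ that] J by auto
  show "e + 1 + single + excess \<le> 2 * \<alpha>"
  proof (cases "single = 0 \<or> (\<exists>B\<in>comps. even (hgt P B))")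
    case True
    then show ?thesis
    proof
      assume "single = 0"
      then show ?thesis using 1 by simp
    next
      assume "\<exists>B\<in>comps. even (hgt P B)"
      moreover have "single \<le> 1" by (simp add: single_def)
      ultimately show ?thesis using 2 by fastforce
    qed
  next
    case False
    then have odd: "\<forall>B\<in>comps. odd (hgt P B)" and "single \<noteq> 0" by auto
    then obtain w where w: "w \<in> V - P" "card (E `` {w} \<inter> P) = 1"
      by (auto simp: single_def split: if_splits)
    then obtain u where "E `` {w} \<inter> P = {u}" by (auto simp: card_1_singleton_iff)
    moreover from this obtain i where i: "i \<le> e" "u = p i" by (auto simp: P_def)
    ultimately have wi: "E `` {w} \<inter> P = {p i}" by simp
    let ?K = "{j. j \<le> e \<and> even (Suc i + j)}"
    \<comment> \<open>Even the poorer parity class contains at least \<open>e / 2\<close> of the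
      \<open>e + 1\<close> path vertices. Together with \<open>w\<close> this gives
      \<open>2 * card ?A \<ge> e + 2\<close>.\<close>
    have cardK: "e \<le> 2 * card ?K"
    proof (cases "even (i + e)")
      case True
      have "?K = {..e} - {j. j \<le> e \<and> even (e + j)}" using True by auto
      then have "card ?K = card {..e} - card {j. j \<le> e \<and> even (e + j)}"
        by (simp add: card_Diff_subset subset_eq)
      then show ?thesis using card_same_parity[of e] by simp
    next
      case False
      then have "?K = {j. j \<le> e \<and> even (e + j)}" by auto
      then show ?thesis using card_same_parity[of e] by simp
    qed
    let ?A = "insert w (p ` ?K)"
    have nadj: "(w, p j) \<notin> E" if "j \<in> ?K" for j
    proof
      assume "(w, p j) \<in> E"
      then have "p j \<in> E `` {w} \<inter> P" using that pV by auto
      then have "p j = p i" using wi by simp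
      moreover have "j \<le> e" "odd (i + j)" using that by simp_all
      ultimately have "j = i" using p_inj i(1) by blast
      then show False using \<open>odd (i + j)\<close> by simp
    qed
    have "indep E ({w} \<union> p ` ?K)"
    proof (rule indep_Un)
      show "indep E {w}" using irrefl_E by (simp add: indep_def)
      show "indep E (p ` ?K)" by (rule indep_parity(1)[of "{}"]) simp
      show "(a, b) \<notin> E" if "a \<in> {w}" "b \<in> p ` ?K" for a b using nadj that by blast
    qed
    moreover have "?A \<subseteq> V" "?A \<subseteq> ball1 P"
    proof -
      have "(p i, w) \<in> E" using wi E_sym by blast
      then show "?A \<subseteq> V" "?A \<subseteq> ball1 P"
        using w PV pV i by (auto simp: ball1_def)
    qed
    ultimately have "2 * card ?A + excess \<le> 2 * \<alpha>"
      using odd by (intro excess_le_of_indep(1)) auto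
    moreover have "card ?A = card ?K + 1"
    proof -
      have "w \<notin> p ` ?K" using w by (auto simp: P_def)
      then show ?thesis using indep_parity(2)[of ?K] by auto
    qed
    moreover have "single = 1" using \<open>single \<noteq> 0\<close> by (simp add: single_def)
    ultimately show ?thesis using cardK by simp
  qed
qed

abbreviation dx :: "'a \<Rightarrow> nat" where "dx z \<equiv> vdist E (p 0) z"
abbreviation dy :: "'a \<Rightarrow> nat" where "dy z \<equiv> vdist E (p e) z"

lemma vdist_p: "i \<le> j \<Longrightarrow> j \<le> e \<Longrightarrow> vdist E (p i) (p j) \<le> j - i"
proof (induction j)
  case 0
  then show ?case using vdist_self[of "p 0"] pV by auto
next
  case (Suc j)
  show ?case
  proof (cases "i = Suc j")
    case True
    then show ?thesis using vdist_self pV Suc by simp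
  next
    case False
    then have "vdist E (p i) (p j) \<le> j - i" using Suc by auto
    moreover have "(p j, p (Suc j)) \<in> E" using p_adj Suc by auto
    ultimately show ?thesis
      using sdist_step[of "{p i}" "p j" "p (Suc j)"] pV[of i] Suc False by auto
  qed
qed

lemma dxp: "i \<le> e \<Longrightarrow> dx (p i) \<le> i" "i \<le> e \<Longrightarrow> dy (p i) \<le> e - i"
  using vdist_p[of 0 i] vdist_p[of i e] vdist_comm[of "p i" "p e"] pV by auto

lemma dist_nbr:
  assumes "(p i, z) \<in> E" "i \<le> e"
  shows "dx z \<le> i + 1" "dy z \<le> e - i + 1"
proof -
  have "dx z \<le> Suc (dx (p i))" "dy z \<le> Suc (dy (p i))"
    using assms pV by (auto intro!: sdist_step)
  then show "dx z \<le> i + 1" "dy z \<le> e - i + 1"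
    using dxp[OF assms(2)] by auto
qed

lemma dist_two_nbrs:
  assumes "(p i, z) \<in> E" "(p j, z) \<in> E" "i < j" "j \<le> e"
  shows "dx z + dy z + (j - i) \<le> e + 2"
  using dist_nbr(1)[OF assms(1)] dist_nbr(2)[OF assms(2)] assms by auto

text \<open>Each level beyond the first costs at most one step towards either end. On the first
  level, two neighbours \<open>p i\<close>, \<open>p j\<close> with \<open>i < j\<close> save
  \<open>j - i \<ge> 1\<close> against the \<open>e + 2\<close> available through one
  neighbour.\<close>

lemma dist_sum_le:
  assumes "z \<in> V - P"
  shows "dx z + dy z \<le> e + 1 + single + 2 * (sdist E P z - 1)"
proof -
  have "sdist E P z \<noteq> 0" using sdist_eq_0[OF PV(1,2)] assms by auto
  then obtain k where "sdist E P z = Suc k" by (cases "sdist E P z") auto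
  then show ?thesis using assms
  proof (induction k arbitrary: z)
    case 0
    obtain u where u: "(u, z) \<in> E" "sdist E P u = 0"
      using sdist_pred[OF PV(1,2), of z 0] 0 by auto
    then have "u \<in> P" using sdist_eq_0[OF PV(1,2), of u] E_sub by auto
    then obtain i where i: "i \<le> e" "u = p i" by (auto simp: P_def)
    show ?case
    proof (cases "\<exists>j\<le>e. j \<noteq> i \<and> (p j, z) \<in> E")
      case True
      then obtain j where j: "j \<le> e" "j \<noteq> i" "(p j, z) \<in> E" by blast
      have "dx z + dy z \<le> e + 1"
        using dist_two_nbrs[of i z j] dist_two_nbrs[of j z i] j i u by (cases "i < j") auto
      then show ?thesis by simp
    next
      case False
      have "E `` {z} \<inter> P = {p i}"
        using False i u E_comm[of z] by (auto simp: P_def)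
      then have "card (E `` {z} \<inter> P) = 1" by simp
      then have "single = 1" using 0 unfolding single_def by (simp add: Bex_def) blast
      then show ?thesis using dist_nbr[of i z] i u by simp
    qed
  next
    case (Suc k)
    obtain u where u: "(u, z) \<in> E" "sdist E P u = Suc k"
      using sdist_pred[OF PV(1,2), of z "Suc k"] Suc.prems by auto
    have uV: "u \<in> V - P" using u sdist_eq_0[OF PV(1,2), of u] E_sub by auto
    have "dx z \<le> Suc (dx u)" "dy z \<le> Suc (dy u)"
      using u pV by (auto intro!: sdist_step)
    then show ?case using Suc.IH[OF u(2) uV] u Suc.prems by simp
  qed
qed

text \<open>The distance from the path is coarsened to the height of the component, so that the
  bound is constant on each component. The value 1 for neighbours of the path makes the surplus
  \<open>ht z - 1\<close> vanish there.\<close>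

definition ht :: "'a \<Rightarrow> nat" where
  "ht z = (if z \<in> far P then hgt P (crel P `` {z}) else 1)"

lemma ht_comp: "B \<in> comps \<Longrightarrow> z \<in> B \<Longrightarrow> ht z = hgt P B"
proof -
  assume B: "B \<in> comps" "z \<in> B"
  then obtain x where x: "B = crel P `` {x}"
    by (auto simp: comps_def quotient_def)
  then have "crel P `` {z} = B"
    using equiv_class_eq[OF equiv_crel, of x z P] B by auto
  moreover have "z \<in> far P" using B comp_subset unfolding comps_def by blast
  ultimately show ?thesis by (simp add: ht_def)
qed

lemma sdist_le_ht: "z \<in> V - P \<Longrightarrow> sdist E P z \<le> ht z"
proof (cases "z \<in> far P")
  case True
  then have B: "crel P `` {z} \<in> far P // crel P" "z \<in> crel P `` {z}"
    using equiv_crel[of P] by (auto simp: quotient_def equiv_def refl_on_def)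
  then show ?thesis using hgt_ge[OF B] True by (simp add: ht_def)
next
  case False
  assume z: "z \<in> V - P"
  then show ?thesis using sdist_ge_2[OF PV(1,2), of z] False by (auto simp: far_def ht_def)
qed

text \<open>\<open>g\<close> records by how much individual vertices fall short of their bound,
  which is exploited both for equality and for the cycle case. The summand
  \<open>(e - 1) * (1 + single)\<close> is the saving of the inner path vertices, whose distance sum
  is at most \<open>e\<close>.\<close>

lemma transmission_bound:
  assumes n: "card V = n" and slack: "\<And>z. z \<in> V - P \<Longrightarrow> dx z + dy z + g z \<le> e + 1 + single + 2 * (ht z - 1)"
  shows "(\<Sum>z\<in>V - {p 0, p e}. dx z + dy z) + (e - 1) * (1 + single) + (\<Sum>z\<in>V - P. g z)
    \<le> (n - 2) * (e + 1 + single + excess)"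
proof -
  let ?s = "e + 1 + single"
  have ends: "p 0 \<in> P" "p e \<in> P" "p 0 \<noteq> p e" using pV p_inj[of 0 e] e_pos by auto
  have fin: "finite (V - P)" "finite (P - {p 0, p e})" using finite_V PV by auto
  have split: "V - {p 0, p e} = (P - {p 0, p e}) \<union> (V - P)" using ends PV by auto
  have cP: "card (P - {p 0, p e}) = e - 1"
    using ends PV card_P by (simp add: card_Diff_subset)
  have cV: "card (V - P) = n - (e + 1)" "e + 1 \<le> n"
    using PV card_P n card_mono[OF finite_V PV(1)] by (auto simp: card_Diff_subset)
  have inner: "(\<Sum>z\<in>P - {p 0, p e}. dx z + dy z) \<le> (e - 1) * e"
  proof -
    have "dx z + dy z \<le> e" if "z \<in> P - {p 0, p e}" for z
      using that dxp by (force simp: P_def)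
    then have "(\<Sum>z\<in>P - {p 0, p e}. dx z + dy z) \<le> of_nat (card (P - {p 0, p e})) * e"
      by (intro sum_bounded_above)
    then show ?thesis using cP by simp
  qed
  have "(\<Sum>z\<in>V - P. dx z + dy z) + (\<Sum>z\<in>V - P. g z) \<le> (\<Sum>z\<in>V - P. ?s + 2 * (ht z - 1))"
    unfolding sum.distrib[symmetric] using slack by (intro sum_mono) simp
  also have "\<dots> = (n - (e + 1)) * ?s + (\<Sum>z\<in>V - P. 2 * (ht z - 1))"
    by (simp only: sum.distrib sum_constant cV) (simp add: algebra_simps)
  also have "(\<Sum>z\<in>V - P. 2 * (ht z - 1)) = (\<Sum>z\<in>far P. 2 * (ht z - 1))"
    using fin by (intro sum.mono_neutral_right) (auto simp: far_def ball1_def ht_def)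
  also have "\<dots> = (\<Sum>B\<in>comps. \<Sum>z\<in>B. 2 * (ht z - 1))"
  proof -
    have "far P = \<Union>comps" unfolding comps_def using Union_quotient[OF equiv_crel] by metis
    moreover have "(\<Sum>z\<in>\<Union>comps. 2 * (ht z - 1)) = (\<Sum>B\<in>comps. \<Sum>z\<in>B. 2 * (ht z - 1))"
      using comp_finite comp_disjoint unfolding comps_def by (subst sum.Union_disjoint) auto
    ultimately show ?thesis by simp
  qed
  \<comment> \<open>This is where goodness is used: twice the size of a component is at most
    \<open>n - 2\<close>.\<close>
  also have "\<dots> \<le> (\<Sum>B\<in>comps. (n - 2) * (hgt P B - 1))"
  proof (rule sum_mono)
    fix B assume B: "B \<in> comps"
    have "2 * card B + 2 \<le> n"
      using gd n comp_subset comp_conn B unfolding good_def comps_def far_def P_def by metis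
    then have "(2 * card B) * (hgt P B - 1) \<le> (n - 2) * (hgt P B - 1)"
      by (intro mult_right_mono) auto
    moreover have "(\<Sum>z\<in>B. 2 * (ht z - 1)) = (2 * card B) * (hgt P B - 1)"
      using ht_comp[OF B] by simp
    ultimately show "(\<Sum>z\<in>B. 2 * (ht z - 1)) \<le> (n - 2) * (hgt P B - 1)" by simp
  qed
  also have "\<dots> = (n - 2) * excess" by (simp add: excess_def sum_distrib_left)
  finally have outer: "(\<Sum>z\<in>V - P. dx z + dy z) + (\<Sum>z\<in>V - P. g z)
    \<le> (n - (e + 1)) * ?s + (n - 2) * excess" by simp
  have "(\<Sum>z\<in>V - {p 0, p e}. dx z + dy z)
      = (\<Sum>z\<in>P - {p 0, p e}. dx z + dy z) + (\<Sum>z\<in>V - P. dx z + dy z)"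
    unfolding split using fin by (intro sum.union_disjoint) auto
  then have "(\<Sum>z\<in>V - {p 0, p e}. dx z + dy z) + (e - 1) * (1 + single) + (\<Sum>z\<in>V - P. g z)
     \<le> (e - 1) * e + (e - 1) * (1 + single) + (n - (e + 1)) * ?s + (n - 2) * excess"
    using inner outer by linarith
  also have "(e - 1) * e + (e - 1) * (1 + single) + (n - (e + 1)) * ?s = ((e - 1) + (n - (e + 1))) * ?s"
    by (simp add: algebra_simps)
  also have "(e - 1) + (n - (e + 1)) = n - 2" using cV e_pos by simp
  finally show ?thesis by (simp add: algebra_simps)
qed

end

subsection \<open>Removing one or two vertices\<close>

definition wien :: "(nat \<Rightarrow> real) \<Rightarrow> 'a set \<Rightarrow> 'a rel \<Rightarrow> real" where
  "wien f V E = psum (\<lambda>u v. f (vdist E u v)) V"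

context cgraph
begin

lemma vdist_ge_1: "u \<in> V \<Longrightarrow> v \<in> V \<Longrightarrow> u \<noteq> v \<Longrightarrow> 1 \<le> vdist E u v"
  using vdist_eq_0[of u v] by linarith

lemma ecc_profile:
  assumes "x \<in> V" "card V \<ge> 2"
  shows "\<exists>e\<ge>1. vdist E x ` (V - {x}) = {1..e}"
proof -
  define e where "e = Max (vdist E x ` V)"
  have "e \<in> vdist E x ` V" unfolding e_def using finite_V assms by (intro Max_in) auto
  then obtain w where w: "w \<in> V" "vdist E x w = e" by auto
  have le: "vdist E x v \<le> e" if "v \<in> V" for v
    unfolding e_def using finite_V that by auto
  have "V - {x} \<noteq> {}"
  proof
    assume "V - {x} = {}"
    then have "card V \<le> card {x}" by (intro card_mono) auto
    then show False using assms by simp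
  qed
  then obtain v where "v \<in> V - {x}" by auto
  then have "1 \<le> e" using le[of v] vdist_ge_1[of x v] assms by auto
  moreover have "vdist E x ` (V - {x}) = {1..e}"
  proof
    show "vdist E x ` (V - {x}) \<subseteq> {1..e}"
    proof (rule image_subsetI)
      fix v assume "v \<in> V - {x}"
      then show "vdist E x v \<in> {1..e}" using le[of v] vdist_ge_1[of x v] assms by auto
    qed
    show "{1..e} \<subseteq> vdist E x ` (V - {x})"
    proof
      fix j assume j: "j \<in> {1..e}"
      then obtain z where "z \<in> V" "vdist E x z = j"
        using sdist_level[of "{x}" w j] w assms by auto
      moreover from this have "z \<noteq> x" using j vdist_self[of x] assms by auto
      ultimately show "j \<in> vdist E x ` (V - {x})" by auto
    qed
  qed
  ultimately show ?thesis by blast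
qed

text \<open>Picking one vertex from every second distance level from \<open>u\<close>, starting with
  the level of \<open>v\<close>, gives an independent set of \<open>d div 2 + 1\<close>
  vertices.\<close>

lemma vdist_le_alpha:
  assumes alpha: "\<forall>I. I \<subseteq> V \<longrightarrow> indep E I \<longrightarrow> card I \<le> \<alpha>" and uv: "u \<in> V" "v \<in> V"
  shows "vdist E u v \<le> 2 * \<alpha> - 1"
proof -
  let ?d = "vdist E u v"
  have "\<forall>j\<in>{..?d}. \<exists>w. w \<in> V \<and> vdist E u w = j" using sdist_level[of "{u}" v] uv by blast
  then obtain w where w: "\<And>j. j \<le> ?d \<Longrightarrow> w j \<in> V \<and> vdist E u (w j) = j" by (metis atMost_iff)
  let ?J = "{j. j \<le> ?d \<and> even (?d + j)}"
  have "inj_on w ?J" using w by (intro inj_on_inverseI[where g = "vdist E u"]) auto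
  then have "card (w ` ?J) = ?d div 2 + 1" using card_same_parity by (simp add: card_image)
  moreover have "indep E (w ` ?J)"
    unfolding indep_def
  proof (intro ballI notI)
    fix a b assume a: "a \<in> w ` ?J" "b \<in> w ` ?J" and ab: "(a, b) \<in> E"
    then obtain i j where ij: "i \<in> ?J" "j \<in> ?J" "a = w i" "b = w j" by blast
    then have "i \<noteq> j" using irrefl_E ab by auto
    moreover have "even (i + j)" using ij(1,2) by auto
    ultimately have "i \<ge> j + 2 \<or> j \<ge> i + 2" by presburger
    moreover have "vdist E u a = i" "vdist E u b = j" using w ij by auto
    ultimately show False
      using sdist_step[of "{u}" a b] sdist_step[of "{u}" b a] ab E_sym[OF ab] uv by auto
  qed
  ultimately have "?d div 2 + 1 \<le> \<alpha>" using alpha[rule_format, of "w ` ?J"] w by auto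
  then show ?thesis by linarith
qed

text \<open>A vertex that is not a cut vertex cannot form a whole distance level, except the last one.\<close>

lemma profile_without:
  assumes x: "x \<in> V" and y: "y \<in> V" "x \<noteq> y" and cy: "conn_on E (V - {y})"
    and e: "vdist E x ` (V - {x}) = {1..e}"
  shows "{1..e - 1} \<subseteq> vdist E x ` (V - {x, y})"
proof
  fix t assume t: "t \<in> {1..e - 1}"
  then have "t \<in> vdist E x ` (V - {x})" using e by auto
  then obtain z where z: "z \<in> V - {x}" "vdist E x z = t" by auto
  show "t \<in> vdist E x ` (V - {x, y})"
  proof (cases "z = y")
    case False
    then show ?thesis using z by auto
  next
    case True
    have "e \<in> vdist E x ` (V - {x})" using e t by auto
    then obtain w where w: "w \<in> V" "vdist E x w = e" by auto
    let ?X = "{v \<in> V - {y}. vdist E x v < t}"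
    have "x \<in> ?X" using x y t vdist_self by auto
    moreover have "w \<in> V - {y} - ?X" using w t z True by auto
    ultimately obtain a b where ab: "a \<in> ?X" "b \<in> V - {y} - ?X" "(a, b) \<in> E"
      using conn_on_boundary[OF cy, of ?X x w] by blast
    then have "vdist E x b = t" using sdist_step[of "{x}" a b] x by auto
    moreover have "b \<noteq> x" using ab \<open>x \<in> ?X\<close> by auto
    ultimately show ?thesis using ab by auto
  qed
qed

end

locale cgraph_f = cgraph + convex_inc
begin

lemma wien_remove:
  assumes "x \<in> V" "conn_on E (V - {x})"
  shows "wien f V E \<le> wien f (V - {x}) (E \<inter> (V - {x}) \<times> (V - {x})) + (\<Sum>z\<in>V - {x}. f (vdist E x z))"
proof -
  have "wien f V E = psum (\<lambda>u v. f (vdist E u v)) (V - {x}) + (\<Sum>z\<in>V - {x}. f (vdist E x z))"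
    unfolding wien_def using finite_V assms(1) vdist_comm by (intro psum_remove) auto
  also have "psum (\<lambda>u v. f (vdist E u v)) (V - {x}) \<le> wien f (V - {x}) (E \<inter> (V - {x}) \<times> (V - {x}))"
    unfolding wien_def using vdist_restrict[of "V - {x}"] assms vdist_ge_1
    by (intro psum_mono f_le) auto
  finally show ?thesis by simp
qed

lemma wien_remove2:
  assumes "x \<in> V" "y \<in> V" "x \<noteq> y" "conn_on E (V - {x, y})"
  shows "wien f V E \<le> wien f (V - {x, y}) (E \<inter> (V - {x, y}) \<times> (V - {x, y}))
    + ((\<Sum>z\<in>V - {x, y}. f (vdist E x z) + f (vdist E y z)) + f (vdist E x y))"
proof -
  let ?g = "\<lambda>u v. f (vdist E u v)"
  have V: "V - {x} - {y} = V - {x, y}" by auto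
  have "wien f V E = psum ?g (V - {x}) + (\<Sum>z\<in>V - {x}. ?g x z)"
    unfolding wien_def using finite_V assms(1) vdist_comm by (intro psum_remove) auto
  also have "psum ?g (V - {x}) = psum ?g (V - {x} - {y}) + (\<Sum>z\<in>V - {x} - {y}. ?g y z)"
    using finite_V assms vdist_comm by (intro psum_remove) auto
  also have "(\<Sum>z\<in>V - {x}. ?g x z) = ?g x y + (\<Sum>z\<in>V - {x} - {y}. ?g x z)"
    using finite_V assms by (intro sum.remove) auto
  also have "psum ?g (V - {x} - {y}) \<le> wien f (V - {x, y}) (E \<inter> (V - {x, y}) \<times> (V - {x, y}))"
    unfolding wien_def V using vdist_restrict[of "V - {x, y}"] assms vdist_ge_1
    by (intro psum_mono f_le) auto
  finally show ?thesis by (simp add: V sum.distrib algebra_simps)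
qed

text \<open>The distance between \<open>x\<close> and \<open>y\<close> is counted once, in the list
  of the vertex \<open>y\<close> of larger eccentricity, which is therefore complete. The list of
  \<open>x\<close> lacks \<open>y\<close>, and since \<open>y\<close> is not a cut vertex, at most
  the last level of \<open>x\<close> is lost.\<close>

lemma pair_step_aux:
  assumes alpha: "\<forall>I. I \<subseteq> V \<longrightarrow> indep E I \<longrightarrow> card I \<le> \<alpha>" and \<alpha>: "1 \<le> \<alpha>"
    and n: "card V = n" "2 * \<alpha> + 1 \<le> n"
    and xy: "x \<in> V" "y \<in> V" "x \<noteq> y" and cy: "conn_on E (V - {y})"
    and e1: "vdist E x ` (V - {x}) = {1..e1}" "1 \<le> e1"
    and e2: "vdist E y ` (V - {y}) = {1..e2}" "e1 \<le> e2"
    and lin: "(\<Sum>z\<in>V - {x, y}. vdist E x z + vdist E y z) + vdist E x y \<le> 2 * \<alpha> * (n - 2) + 1"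
  shows "(\<Sum>z\<in>V - {x, y}. f (vdist E x z) + f (vdist E y z)) + f (vdist E x y) \<le> pair_target f (2 * \<alpha> - 1) n"
    and "(\<Sum>z\<in>V - {x, y}. vdist E x z + vdist E y z) + vdist E x y < 2 * \<alpha> * (n - 2) + 1 \<Longrightarrow>
      (\<Sum>z\<in>V - {x, y}. f (vdist E x z) + f (vdist E y z)) + f (vdist E x y) < pair_target f (2 * \<alpha> - 1) n"
proof -
  let ?X = "V - {x, y}" and ?Y = "V - {y}"
  have X: "?Y - {x} = ?X" by auto
  have Y: "(\<Sum>z\<in>?Y. h (vdist E y z)) = h (vdist E x y) + (\<Sum>z\<in>?X. h (vdist E y z))"
    for h :: "nat \<Rightarrow> 'z::comm_monoid_add"
    using sum.remove[of ?Y x "\<lambda>z. h (vdist E y z)"] finite_V xy X vdist_comm[of x y] by simp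
  have "e2 \<in> vdist E y ` (V - {y})" using e1 e2 by auto
  then have e2m: "e2 \<le> 2 * \<alpha> - 1" using vdist_le_alpha[OF alpha] xy by auto
  have card: "card ?X + 2 = n" "card ?Y + 1 = n"
    using finite_V xy n \<alpha> by (simp_all add: card_Diff_subset)
  have sub: "vdist E x ` ?X \<subseteq> {1..e1}" using e1(1) by auto
  have target: "pair_target real (2 * \<alpha> - 1) n = real (2 * \<alpha> * (n - 2) + 1)"
    using pair_target_real[OF \<alpha>, of n] n \<alpha> by (simp add: of_nat_diff)
  have lhs: "real (\<Sum>z\<in>?X. vdist E x z) + real (\<Sum>z\<in>?Y. vdist E y z)
      = real ((\<Sum>z\<in>?X. vdist E x z + vdist E y z) + vdist E x y)"
    unfolding Y[of "\<lambda>t. t"] by (simp add: sum.distrib)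
  have lhsf: "(\<Sum>z\<in>?X. f (vdist E x z)) + (\<Sum>z\<in>?Y. f (vdist E y z))
      = (\<Sum>z\<in>?X. f (vdist E x z) + f (vdist E y z)) + f (vdist E x y)"
    unfolding Y[of f] by (simp add: sum.distrib)
  have fin: "finite ?X" "finite ?Y" using finite_V by auto
  have m: "2 * \<alpha> - 1 + 1 \<le> n" using n by simp
  note prof = pair_profile[OF fin card e1(2) e2(2) e2m m sub
      profile_without[OF xy(1,2,3) cy e1(1)] e2(1), unfolded lhs lhsf target]
  show "(\<Sum>z\<in>V - {x, y}. f (vdist E x z) + f (vdist E y z)) + f (vdist E x y) \<le> pair_target f (2 * \<alpha> - 1) n"
    by (rule prof(1)) (use lin in \<open>simp only: of_nat_le_iff\<close>)
  show "(\<Sum>z\<in>V - {x, y}. f (vdist E x z) + f (vdist E y z)) + f (vdist E x y) < pair_target f (2 * \<alpha> - 1) n"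
    if "(\<Sum>z\<in>V - {x, y}. vdist E x z + vdist E y z) + vdist E x y < 2 * \<alpha> * (n - 2) + 1"
    by (rule prof(2)) (use lin that in \<open>simp_all only: of_nat_le_iff of_nat_less_iff\<close>)
qed

lemma pair_step:
  assumes alpha: "\<forall>I. I \<subseteq> V \<longrightarrow> indep E I \<longrightarrow> card I \<le> \<alpha>" and \<alpha>: "1 \<le> \<alpha>"
    and n: "card V = n" "2 * \<alpha> + 1 \<le> n"
    and xy: "x \<in> V" "y \<in> V" "x \<noteq> y" and c: "conn_on E (V - {x})" "conn_on E (V - {y})"
    and lin: "(\<Sum>z\<in>V - {x, y}. vdist E x z + vdist E y z) + vdist E x y \<le> 2 * \<alpha> * (n - 2) + 1"
  shows "(\<Sum>z\<in>V - {x, y}. f (vdist E x z) + f (vdist E y z)) + f (vdist E x y) \<le> pair_target f (2 * \<alpha> - 1) n"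
    and "(\<Sum>z\<in>V - {x, y}. vdist E x z + vdist E y z) + vdist E x y < 2 * \<alpha> * (n - 2) + 1 \<Longrightarrow>
      (\<Sum>z\<in>V - {x, y}. f (vdist E x z) + f (vdist E y z)) + f (vdist E x y) < pair_target f (2 * \<alpha> - 1) n"
proof -
  obtain e1 where e1: "1 \<le> e1" "vdist E x ` (V - {x}) = {1..e1}" using ecc_profile[of x] xy n \<alpha> by auto
  obtain e2 where e2: "1 \<le> e2" "vdist E y ` (V - {y}) = {1..e2}" using ecc_profile[of y] xy n \<alpha> by auto
  have sw: "V - {y, x} = V - {x, y}" by auto
  have swap: "(\<Sum>z\<in>V - {x, y}. h (vdist E y z) + h (vdist E x z)) = (\<Sum>z\<in>V - {x, y}. h (vdist E x z) + h (vdist E y z))"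
    for h :: "nat \<Rightarrow> 'z::comm_monoid_add" by (simp add: add.commute)
  note swaps = sw vdist_comm[OF xy(2,1)] swap[of f] swap[of "\<lambda>t. t"]
  note A = pair_step_aux[OF alpha \<alpha> n xy c(2) e1(2,1) e2(2) _ lin]
  note B = pair_step_aux[OF alpha \<alpha> n xy(2,1) xy(3)[symmetric] c(1) e2(2,1) e1(2), unfolded swaps, OF _ lin]
  show "(\<Sum>z\<in>V - {x, y}. f (vdist E x z) + f (vdist E y z)) + f (vdist E x y) \<le> pair_target f (2 * \<alpha> - 1) n"
    using A(1) B(1) by (cases "e1 \<le> e2") auto
  show "(\<Sum>z\<in>V - {x, y}. f (vdist E x z) + f (vdist E y z)) + f (vdist E x y) < pair_target f (2 * \<alpha> - 1) n"
    if "(\<Sum>z\<in>V - {x, y}. vdist E x z + vdist E y z) + vdist E x y < 2 * \<alpha> * (n - 2) + 1"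
    using A(2) B(2) that by (cases "e1 \<le> e2") auto
qed

lemma single_step:
  assumes alpha: "\<forall>I. I \<subseteq> V \<longrightarrow> indep E I \<longrightarrow> card I \<le> \<alpha>" and \<alpha>: "1 \<le> \<alpha>"
    and n: "card V = n" "2 * \<alpha> + 1 \<le> n" and x: "x \<in> V"
    and lin: "(\<Sum>z\<in>V - {x}. vdist E x z) \<le> \<alpha> * (n - 2)"
  shows "(\<Sum>z\<in>V - {x}. f (vdist E x z)) < single_target f \<alpha> n"
proof -
  obtain e where e: "1 \<le> e" "vdist E x ` (V - {x}) = {1..e}" using ecc_profile[of x] x n \<alpha> by auto
  then have "e \<in> vdist E x ` (V - {x})" by auto
  then have em: "e \<le> 2 * \<alpha> - 1" using vdist_le_alpha[OF alpha] x by auto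
  have "real (\<Sum>z\<in>V - {x}. vdist E x z) \<le> real (\<alpha> * (n - 2))"
    using lin by (simp only: of_nat_le_iff)
  also have "\<dots> = real \<alpha> * (real n - 2)" using n \<alpha> by (simp add: of_nat_diff)
  also have "\<dots> < single_target real \<alpha> n"
    using single_target_real[OF \<alpha>, of n] n by simp
  finally show ?thesis
    using finite_V x n \<alpha> e em by (intro single_profile[of "V - {x}" n e]) auto
qed

end

subsection \<open>Dumbbell structure\<close>

text \<open>A dumbbell is encoded by the position of its vertices: the ends of the cliques on the path
  have positions \<open>1\<close> and \<open>2\<alpha> - 2\<close>, the other vertices of the cliques positions \<open>0\<close> and \<open>2\<alpha> - 1\<close>,
  and two vertices are adjacent if and only if their positions differ by at most one.\<close>

definition dumb_pos :: "'a set \<Rightarrow> 'a rel \<Rightarrow> nat \<Rightarrow> ('a \<Rightarrow> nat) \<Rightarrow> bool" where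
  "dumb_pos V E \<alpha> pos \<longleftrightarrow> (\<forall>v\<in>V. pos v \<le> 2 * \<alpha> - 1)
    \<and> (\<forall>u\<in>V. \<forall>v\<in>V. (u, v) \<in> E \<longleftrightarrow> u \<noteq> v \<and> pos u \<le> Suc (pos v) \<and> pos v \<le> Suc (pos u))
    \<and> (\<forall>i. 1 \<le> i \<longrightarrow> i \<le> 2 * \<alpha> - 2 \<longrightarrow> card {v \<in> V. pos v = i} = 1)
    \<and> card {v \<in> V. pos v = 0} = (card V + 1) div 2 + 1 - \<alpha>
    \<and> card {v \<in> V. pos v = 2 * \<alpha> - 1} = card V div 2 + 1 - \<alpha>"

text \<open>All distances from \<open>x\<close> are different, so the graph is a path starting at
  \<open>x\<close>. For \<open>n = 2 * \<alpha> - 1\<close> the last position stays empty, for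
  \<open>n = 2 * \<alpha>\<close> each position is taken once.\<close>

lemma (in cgraph) geodesic_dumb_pos:
  assumes x: "x \<in> V" "vdist E x ` (V - {x}) = {1..n - 1}"
    and n: "card V = n" "n = 2 * \<alpha> - 1 \<or> n = 2 * \<alpha>" and \<alpha>: "2 \<le> \<alpha>"
  shows "dumb_pos V E \<alpha> (vdist E x)"
proof -
  let ?d = "vdist E x"
  have im: "?d ` V = {..<n}"
  proof -
    have "?d ` V = insert (?d x) (?d ` (V - {x}))" using x(1) by blast
    also have "\<dots> = insert 0 {1..n - 1}" using x vdist_self by simp
    also have "\<dots> = {..<n}" using n \<alpha> by auto
    finally show ?thesis .
  qed
  have inj: "inj_on ?d V"
    using finite_V im n by (intro eq_card_imp_inj_on) auto
  have fib: "card {v \<in> V. ?d v = i} = 1" if "i < n" for i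
  proof -
    have "i \<in> ?d ` V" using im that by auto
    then obtain v where "v \<in> V" "?d v = i" by auto
    then have "{v \<in> V. ?d v = i} = {v}" using inj by (auto dest: inj_onD)
    then show ?thesis by simp
  qed
  have fib0: "card {v \<in> V. ?d v = i} = 0" if "n \<le> i" for i
  proof -
    have "i \<notin> ?d ` V" using im that by simp
    then have "{v \<in> V. ?d v = i} = {}" by blast
    then show ?thesis by (simp only: card.empty)
  qed
  have pred: "(u, v) \<in> E" if uv: "u \<in> V" "v \<in> V" "?d v = Suc (?d u)" for u v
  proof -
    obtain w where w: "(w, v) \<in> E" "?d w = ?d u"
      using sdist_pred[of "{x}" v "?d u"] uv x(1) by auto
    then have "w = u" using inj uv E_sub by (auto dest: inj_onD)
    then show ?thesis using w by simp
  qed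
  have adj: "(u, v) \<in> E \<longleftrightarrow> u \<noteq> v \<and> ?d u \<le> Suc (?d v) \<and> ?d v \<le> Suc (?d u)" if uv: "u \<in> V" "v \<in> V" for u v
  proof
    assume E: "(u, v) \<in> E"
    then show "u \<noteq> v \<and> ?d u \<le> Suc (?d v) \<and> ?d v \<le> Suc (?d u)"
      using sdist_step[of "{x}" u v] sdist_step[of "{x}" v u] E_sym[OF E] irrefl_E x(1) by auto
  next
    assume a: "u \<noteq> v \<and> ?d u \<le> Suc (?d v) \<and> ?d v \<le> Suc (?d u)"
    then have "?d u \<noteq> ?d v" using inj uv by (auto dest: inj_onD)
    then consider "?d v = Suc (?d u)" | "?d u = Suc (?d v)" using a by linarith
    then show "(u, v) \<in> E" using pred[of u v] pred[of v u] uv E_sym by cases auto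
  qed
  have "?d v \<le> 2 * \<alpha> - 1" if "v \<in> V" for v
  proof -
    have "?d v \<in> {..<n}" using im that by blast
    then show ?thesis using n by auto
  qed
  then show ?thesis
    unfolding dumb_pos_def using adj fib fib0 n \<alpha> by auto
qed

text \<open>The path supplies one vertex for each of the \<open>2 * \<alpha>\<close> positions. The
  sizes of \<open>L\<close> and \<open>R\<close> are those of the end fibres in the dumbbell of
  order \<open>n - 2\<close>; adding \<open>p 0\<close> and \<open>p e\<close> produces the sizes
  for order \<open>n\<close>.\<close>

lemma (in sgraph) dumb_pos_glue:
  assumes ip: "ipath p e" and e: "e = 2 * \<alpha> - 1" "2 \<le> \<alpha>" and n: "card V = n" "2 * \<alpha> + 1 \<le> n"
    and LR: "V - p ` {..e} = L \<union> R" "L \<inter> R = {}"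
    and L: "\<And>z j. z \<in> L \<Longrightarrow> j \<le> e \<Longrightarrow> (p j, z) \<in> E \<longleftrightarrow> j = 0 \<or> j = 1"
    and R: "\<And>z j. z \<in> R \<Longrightarrow> j \<le> e \<Longrightarrow> (p j, z) \<in> E \<longleftrightarrow> j = e - 1 \<or> j = e"
    and LL: "\<And>z z'. z \<in> L \<Longrightarrow> z' \<in> L \<Longrightarrow> z \<noteq> z' \<Longrightarrow> (z, z') \<in> E"
    and RR: "\<And>z z'. z \<in> R \<Longrightarrow> z' \<in> R \<Longrightarrow> z \<noteq> z' \<Longrightarrow> (z, z') \<in> E"
    and nLR: "\<And>z z'. z \<in> L \<Longrightarrow> z' \<in> R \<Longrightarrow> (z, z') \<notin> E"
    and card: "card L = (n - 1) div 2 + 1 - \<alpha>" "card R = (n - 2) div 2 + 1 - \<alpha>"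
  shows "\<exists>pos. dumb_pos V E \<alpha> pos"
proof -
  define pos where "pos = (\<lambda>v. if v \<in> L then 0 else if v \<in> R then e else inv_into {..e} p v)"
  have injp: "inj_on p {..e}" and pV: "p ` {..e} \<subseteq> V" using ip by (auto simp: ipath_def)
  have pos_p: "pos (p i) = i" if "i \<le> e" for i
  proof -
    have "p i \<notin> L" "p i \<notin> R" using LR that by auto
    then show ?thesis using injp that by (simp add: pos_def)
  qed
  have pos_L: "pos v = 0" if "v \<in> L" for v using that by (simp add: pos_def)
  have pos_R: "pos v = e" if "v \<in> R" for v using that LR(2) by (auto simp: pos_def)
  have cases: "v \<in> L \<or> v \<in> R \<or> (\<exists>i\<le>e. v = p i)" if "v \<in> V" for v
    using LR(1) that by blast
  have LV: "L \<subseteq> V" "R \<subseteq> V" "L \<inter> p ` {..e} = {}" "R \<inter> p ` {..e} = {}" using LR(1) by blast+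
  have e3: "3 \<le> e" using e by auto
  have adj: "(u, v) \<in> E \<longleftrightarrow> u \<noteq> v \<and> pos u \<le> Suc (pos v) \<and> pos v \<le> Suc (pos u)"
    if uv: "u \<in> V" "v \<in> V" for u v
  proof -
    have Lp: "(z, p j) \<in> E \<longleftrightarrow> j = 0 \<or> j = 1" if "z \<in> L" "j \<le> e" for z j
      using L[OF that] E_comm by blast
    have Rp: "(z, p j) \<in> E \<longleftrightarrow> j = e - 1 \<or> j = e" if "z \<in> R" "j \<le> e" for z j
      using R[OF that] E_comm by blast
    have RL: "(z, z') \<notin> E" if "z \<in> R" "z' \<in> L" for z z'
      using nLR[OF that(2,1)] E_comm by blast
    have pne: "z \<noteq> p j" if "z \<in> L \<union> R" "j \<le> e" for z j
      using LV that by blast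
    have ppE: "(p i, p j) \<in> E \<longleftrightarrow> i = Suc j \<or> j = Suc i" "p i = p j \<longleftrightarrow> i = j" if "i \<le> e" "j \<le> e" for i j
      using ip that injp by (auto simp: ipath_def dest: inj_onD)
    consider (LL) "u \<in> L" "v \<in> L" | (LR) "u \<in> L" "v \<in> R" | (RL) "u \<in> R" "v \<in> L" | (RR) "u \<in> R" "v \<in> R"
      | (Lp) j where "u \<in> L" "j \<le> e" "v = p j" | (Rp) j where "u \<in> R" "j \<le> e" "v = p j"
      | (pL) j where "v \<in> L" "j \<le> e" "u = p j" | (pR) j where "v \<in> R" "j \<le> e" "u = p j"
      | (pp) i j where "i \<le> e" "j \<le> e" "u = p i" "v = p j"
      using cases[OF uv(1)] cases[OF uv(2)] by blast
    then show ?thesis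
    proof cases
      case LL
      then show ?thesis using \<open>\<And>z z'. z \<in> L \<Longrightarrow> z' \<in> L \<Longrightarrow> z \<noteq> z' \<Longrightarrow> (z, z') \<in> E\<close> irrefl_E by (auto simp: pos_L)
    next
      case LR
      then show ?thesis using nLR e3 by (auto simp: pos_L pos_R)
    next
      case RL
      then show ?thesis using \<open>\<And>z z'. z \<in> R \<Longrightarrow> z' \<in> L \<Longrightarrow> (z, z') \<notin> E\<close> e3 by (auto simp: pos_L pos_R)
    next
      case RR
      then show ?thesis using \<open>\<And>z z'. z \<in> R \<Longrightarrow> z' \<in> R \<Longrightarrow> z \<noteq> z' \<Longrightarrow> (z, z') \<in> E\<close> irrefl_E by (auto simp: pos_R)
    next
      case Lp
      then have "u \<noteq> v" using pne by blast
      then show ?thesis using Lp L[OF Lp(1,2)] E_comm[of u v] by (auto simp: pos_L pos_p)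
    next
      case Rp
      then have "u \<noteq> v" using pne by blast
      then show ?thesis using Rp R[OF Rp(1,2)] E_comm[of u v] e3 by (auto simp: pos_R pos_p)
    next
      case pL
      then have "u \<noteq> v" using pne by blast
      then show ?thesis using pL L[OF pL(1,2)] by (auto simp: pos_L pos_p)
    next
      case pR
      then have "u \<noteq> v" using pne by blast
      then show ?thesis using pR R[OF pR(1,2)] e3 by (auto simp: pos_R pos_p)
    next
      case (pp i j)
      have ij: "pos u = i" "pos v = j" using pp pos_p by simp_all
      have "(u, v) \<in> E \<longleftrightarrow> i = Suc j \<or> j = Suc i" "u = v \<longleftrightarrow> i = j"
        using ppE[OF pp(1,2)] pp(3,4) by simp_all
      then show ?thesis unfolding ij by arith
    qed
  qed
  have bound: "pos v \<le> 2 * \<alpha> - 1" if "v \<in> V" for v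
    using cases[OF that] pos_L pos_R pos_p e(1) by auto
  have fib: "{v \<in> V. pos v = i} = (if i = 0 then L else {}) \<union> (if i = e then R else {}) \<union> {p i}"
    if "i \<le> e" for i
  proof (intro set_eqI iffI)
    fix v assume v: "v \<in> {v \<in> V. pos v = i}"
    then consider "v \<in> L" | "v \<in> R" | j where "j \<le> e" "v = p j" using cases by blast
    then show "v \<in> (if i = 0 then L else {}) \<union> (if i = e then R else {}) \<union> {p i}"
      using v pos_L pos_R pos_p by cases auto
  next
    fix v assume "v \<in> (if i = 0 then L else {}) \<union> (if i = e then R else {}) \<union> {p i}"
    then show "v \<in> {v \<in> V. pos v = i}"
      using LV pos_L pos_R pos_p that pV by (auto split: if_splits)
  qed
  have fib0: "{v \<in> V. pos v = 0} = insert (p 0) L" and fibe: "{v \<in> V. pos v = e} = insert (p e) R"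
    using fib[of 0] fib[of e] e3 by auto
  have fin: "finite L" "finite R" using LV finite_V finite_subset by blast+
  have "p 0 \<notin> L" "p e \<notin> R" using LV by blast+
  then have "card {v \<in> V. pos v = 0} = (n - 1) div 2 + 1 - \<alpha> + 1"
    "card {v \<in> V. pos v = e} = (n - 2) div 2 + 1 - \<alpha> + 1"
    unfolding fib0 fibe using fin card by auto
  moreover have "(n - 1) div 2 + 1 - \<alpha> + 1 = (n + 1) div 2 + 1 - \<alpha>"
    "(n - 2) div 2 + 1 - \<alpha> + 1 = n div 2 + 1 - \<alpha>"
    using n e(2) by linarith+
  moreover have "card {v \<in> V. pos v = i} = 1" if "1 \<le> i" "i \<le> 2 * \<alpha> - 2" for i
  proof -
    have "i \<le> e" "i \<noteq> 0" "i \<noteq> e" using that e by auto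
    then show ?thesis using fib[of i] by simp
  qed
  ultimately have "dumb_pos V E \<alpha> pos"
    unfolding dumb_pos_def using bound adj n e by simp
  then show ?thesis by blast
qed

section \<open>Connectivity after deleting ends of the path\<close>

lemma (in sgraph) conn_segment:
  assumes "ipath p e" "a \<le> b" "b \<le> e"
  shows "conn_on E (p ` {a..b})"
  using assms(2,3)
proof (induction b)
  case 0
  then show ?case by (simp add: conn_on_def)
next
  case (Suc b)
  show ?case
  proof (cases "a = Suc b")
    case True
    then show ?thesis by (simp add: conn_on_def)
  next
    case False
    then have "conn_on E (p ` {a..b})" using Suc by auto
    moreover have "(p b, p (Suc b)) \<in> E" using assms(1) Suc by (auto simp: ipath_def)
    ultimately have "conn_on E (insert (p (Suc b)) (p ` {a..b}))"
      using sym_E False Suc by (intro conn_on_insert[of E _ "p b"]) auto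
    moreover have "{a..Suc b} = insert (Suc b) {a..b}" using Suc by auto
    ultimately show ?thesis by simp
  qed
qed

text \<open>By induction on the distance from \<open>S\<close>: a vertex outside \<open>S\<close> is
  attached either to a vertex nearer to \<open>S\<close> that survives, or directly to
  \<open>S\<close>, and then by \<open>nbr\<close> also to \<open>S - X\<close>.\<close>

lemma (in cgraph) conn_remove:
  assumes S: "S \<subseteq> V" "X \<subseteq> S" "S - X \<noteq> {}" "conn_on E (S - X)"
    and nbr: "\<And>w. w \<in> V - S \<Longrightarrow> w \<in> E `` S \<Longrightarrow> w \<in> E `` (S - X)"
  shows "conn_on E (V - X)"
proof -
  obtain r where r: "r \<in> S - X" using S(3) by blast
  let ?R = "E \<inter> (V - X) \<times> (V - X)"
  have Sne: "S \<noteq> {}" using S by auto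
  have in_S: "(r, v) \<in> ?R\<^sup>*" if "v \<in> S - X" for v
  proof -
    have "(r, v) \<in> (E \<inter> (S - X) \<times> (S - X))\<^sup>*" using S(4) r that by (auto simp: conn_on_def)
    moreover have "(E \<inter> (S - X) \<times> (S - X))\<^sup>* \<subseteq> ?R\<^sup>*" using S(1) by (intro rtrancl_mono) auto
    ultimately show ?thesis by blast
  qed
  have "(r, v) \<in> ?R\<^sup>*" if "v \<in> V - X" for v
    using that
  proof (induction "sdist E S v" arbitrary: v)
    case 0
    then show ?case using sdist_eq_0[OF S(1) Sne, of v] in_S by auto
  next
    case (Suc k)
    then have vS: "v \<notin> S" using sdist_eq_0[OF S(1) Sne, of v] by auto
    obtain u where u: "(u, v) \<in> E" "sdist E S u = k"
      using sdist_pred[OF S(1) Sne, of v k] Suc by auto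
    have uV: "u \<in> V" using u E_sub by auto
    show ?case
    proof (cases "u \<in> S")
      case True
      then obtain w where w: "w \<in> S - X" "(w, v) \<in> E" using nbr[of v] vS Suc.prems u by auto
      then have "(w, v) \<in> ?R" using S(1) Suc.prems by blast
      then show ?thesis using in_S[OF w(1)] by (rule rtrancl_into_rtrancl[rotated])
    next
      case False
      then have "u \<in> V - X" using S(2) uV by auto
      then have "(r, u) \<in> ?R\<^sup>*" "(u, v) \<in> ?R"
        using Suc.hyps(1)[of u] u Suc.prems by simp_all
      then show ?thesis by (rule rtrancl_into_rtrancl)
    qed
  qed
  moreover have "r \<in> V - X" using r S(1) by blast
  ultimately show ?thesis using sym_E by (intro conn_onI_root[of E r])
qed

lemma (in sgraph) ipath3:
  assumes "a \<in> V" "c \<in> V" "(a, b) \<in> E" "(b, c) \<in> E" "(a, c) \<notin> E" "a \<noteq> c"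
  shows "ipath (\<lambda>i. if i = 0 then a else if i = 1 then b else c) 2"
    and "(\<lambda>i. if i = 0 then a else if i = (1::nat) then b else c) ` {..2} = {a, b, c}"
proof -
  have s: "{..2} = {0, 1, 2::nat}" by auto
  have "a \<noteq> b" "b \<noteq> c" using assms irrefl_E by auto
  moreover have "b \<in> V" using assms E_sub by auto
  ultimately show "ipath (\<lambda>i. if i = 0 then a else if i = 1 then b else c) 2"
    using assms E_sym[OF assms(3)] E_sym[OF assms(4)] E_comm[of c a] irrefl_E
    unfolding ipath_def s by (auto simp: le_Suc_eq numeral_2_eq_2)
  show "(\<lambda>i. if i = 0 then a else if i = (1::nat) then b else c) ` {..2} = {a, b, c}"
    unfolding s by auto
qed

text \<open>The saving on the path is at least \<open>e - 1\<close> and the added distance at most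
  \<open>e\<close>, so the final \<open>+ 1\<close> of the budget is already used up. Every further
  loss, including any admissible slack \<open>g\<close>, must vanish.\<close>

lemma (in gpath) equality_slack:
  assumes n: "card V = n" "3 \<le> n" and e2: "2 \<le> e"
    and eq: "(\<Sum>z\<in>V - {p 0, p e}. dx z + dy z) + vdist E (p 0) (p e) = 2 * \<alpha> * (n - 2) + 1"
    and g: "\<And>z. z \<in> V - P \<Longrightarrow> dx z + dy z + g z \<le> e + 1 + single + 2 * (ht z - 1)"
  shows "single = 0" "(\<Sum>z\<in>V - P. g z) = 0" "e + 1 + excess = 2 * \<alpha>"
proof -
  let ?t = "\<Sum>z\<in>V - {p 0, p e}. dx z + dy z"
  have tb: "?t + (e - 1) * (1 + single) + (\<Sum>z\<in>V - P. g z) \<le> (n - 2) * (e + 1 + single + excess)"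
    using transmission_bound[OF n(1) g] .
  have "(n - 2) * (e + 1 + single + excess) \<le> (n - 2) * (2 * \<alpha>)"
    using excess_bounds(3) by (intro mult_left_mono) auto
  moreover have \<delta>: "vdist E (p 0) (p e) \<le> e" using vdist_p[of 0 e] by simp
  moreover have comm: "(n - 2) * (2 * \<alpha>) = 2 * \<alpha> * (n - 2)" by simp
  ultimately have le: "(e - 1) * (1 + single) + (\<Sum>z\<in>V - P. g z) + 1 \<le> e"
    using tb eq by linarith
  have "(e - 1) * (1 + single) = (e - 1) + (e - 1) * single" by simp
  then have "(e - 1) * single = 0" using le e2 by linarith
  then show s: "single = 0" using e2 by simp
  then show "(\<Sum>z\<in>V - P. g z) = 0" using le e2 by simp
  have "(n - 2) * (2 * \<alpha>) \<le> (n - 2) * (e + 1 + excess)"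
    using tb eq \<delta> e2 unfolding s comm by simp
  moreover have "(n - 2) * (e + 1 + excess) < (n - 2) * (2 * \<alpha>)" if "e + 1 + excess < 2 * \<alpha>"
    using that n(2) by (intro mult_strict_left_mono) auto
  ultimately have "2 * \<alpha> \<le> e + 1 + excess" by linarith
  then show "e + 1 + excess = 2 * \<alpha>" using excess_bounds(3) s by simp
qed

lemma (in gpath) equality_structure:
  assumes n: "card V = n" "3 \<le> n" and e2: "2 \<le> e"
    and eq: "(\<Sum>z\<in>V - {p 0, p e}. dx z + dy z) + vdist E (p 0) (p e) = 2 * \<alpha> * (n - 2) + 1"
  shows "e = 2 * \<alpha> - 1"
    and "z \<in> V - P \<Longrightarrow> \<exists>i<e. \<forall>j\<le>e. (p j, z) \<in> E \<longleftrightarrow> j = i \<or> j = Suc i"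
proof -
  have bnd: "dx z + dy z \<le> e + 1 + single + 2 * (ht z - 1)" if "z \<in> V - P" for z
    using dist_sum_le[OF that] sdist_le_ht[OF that] by (meson add_left_mono diff_le_mono le_trans mult_le_mono2)
  note sl = equality_slack[OF n e2 eq]
  have s0: "single = 0" and ex: "e + 1 + excess = 2 * \<alpha>"
    using sl[of "\<lambda>_. 0"] bnd by simp_all
  have tight: "dx w + dy w = e + 1 + single + 2 * (ht w - 1)" if w: "w \<in> V - P" for w
  proof (rule ccontr)
    assume "\<not> ?thesis"
    then have "dx w + dy w < e + 1 + single + 2 * (ht w - 1)" using bnd[OF w] by simp
    \<comment> \<open>A slack of one unit concentrated at \<open>w\<close> would be admissible but
      has nonzero sum.\<close>
    then have "(\<Sum>z\<in>V - P. of_bool (z = w)) = (0::nat)"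
      using bnd by (intro sl(2)) auto
    then show False using w finite_V by simp
  qed
  have far: "far P = {}"
  proof (rule ccontr)
    assume "far P \<noteq> {}"
    then have "comps \<noteq> {}" unfolding comps_def by (simp add: quotient_is_empty)
    then obtain B where B: "B \<in> comps" by blast
    \<comment> \<open>An even height would improve the independence bound by one unit beyond the
      equality \<open>ex\<close>.\<close>
    have odd: "odd (hgt P B)" using excess_bounds(2)[OF B] ex by auto
    have h2: "2 \<le> hgt P B" using hgt_ge_2[OF PV(1,2)] B by (simp add: comps_def)
    then have h3: "3 \<le> hgt P B" using odd by (cases "hgt P B = 2") auto
    \<comment> \<open>The bound at \<open>w\<close> is stated with the height of its component, at
      least 3, but \<open>w\<close> is only on level 2 and so cannot be tight.\<close>
    obtain w where w: "w \<in> B" "sdist E P w = 2"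
      using comp_level[OF PV(1,2), of B 2] B h2 by (auto simp: comps_def)
    have "w \<in> V - P" using w(1) comp_subset B unfolding comps_def far_def ball1_def by blast
    then show False using tight[of w] dist_sum_le[of w] w(2) ht_comp[OF B w(1)] h3 by simp
  qed
  have "comps = {}" using far by (simp add: comps_def)
  then have "excess = 0" by (simp add: excess_def)
  then show "e = 2 * \<alpha> - 1" using ex by simp
  assume z: "z \<in> V - P"
  have hz: "ht z = 1" using far by (simp add: ht_def)
  have sum: "dx z + dy z = e + 1" using tight[OF z] hz s0 by simp
  have "z \<in> ball1 P" using z far by (auto simp: far_def)
  then have "E `` {z} \<inter> P \<noteq> {}" using z E_sym by (auto simp: ball1_def)
  moreover have "card (E `` {z} \<inter> P) \<noteq> 1" using s0 z by (auto simp: single_def split: if_splits)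
  ultimately have "2 \<le> card (E `` {z} \<inter> P)"
    using PV(3) by (metis One_nat_def Suc_1 card_0_eq finite_Int leI less_2_cases)
  then obtain u v where uv: "u \<in> E `` {z} \<inter> P" "v \<in> E `` {z} \<inter> P" "u \<noteq> v"
    by (metis card_le_Suc0_iff_eq finite_Int PV(3) not_less_eq_eq numeral_2_eq_2)
  then obtain a b where ab: "a \<le> e" "b \<le> e" "u = p a" "v = p b" by (auto simp: P_def)
  \<comment> \<open>Neighbours further apart on the path would provide a shortcut through
    \<open>z\<close> and push its distance sum below \<open>e + 1\<close>.\<close>
  have close: "j - i \<le> 1" if "(p i, z) \<in> E" "(p j, z) \<in> E" "i < j" "j \<le> e" for i j
    using dist_two_nbrs[OF that] sum by simp
  have nb: "(p a, z) \<in> E" "(p b, z) \<in> E" "a \<noteq> b" using uv ab E_sym by auto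
  define i where "i = min a b"
  have i: "(p i, z) \<in> E" "(p (Suc i), z) \<in> E" "i < e"
  proof -
    have "max a b = Suc i"
      using close[of a b] close[of b a] nb ab by (cases "a < b") (auto simp: i_def)
    then show "(p i, z) \<in> E" "(p (Suc i), z) \<in> E" "i < e"
      using nb ab by (auto simp: i_def min_def max_def split: if_splits)
  qed
  have "j = i \<or> j = Suc i" if "j \<le> e" "(p j, z) \<in> E" for j
  proof (rule ccontr)
    assume "\<not> ?thesis"
    then consider "j < i" | "Suc i < j" by linarith
    then show False
      using close[of j "Suc i"] close[of i j] i that by cases auto
  qed
  then show "\<exists>i<e. \<forall>j\<le>e. (p j, z) \<in> E \<longleftrightarrow> j = i \<or> j = Suc i"
    using i by (intro exI[of _ i]) auto
qed

text \<open>An off-path vertex in position 0 can have only \<open>p 1\<close> as an inner neighbour,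
  since position 1 has just one vertex; its two consecutive neighbours are therefore
  \<open>p 0\<close> and \<open>p 1\<close>. The same reasoning in position \<open>e\<close> gives
  \<open>p (e - 1)\<close> and \<open>p e\<close>, so \<open>dumb_pos_glue\<close> applies.\<close>

lemma (in sgraph) dumb_pos_extend_oriented:
  assumes ip: "ipath p e" and e: "e = 2 * \<alpha> - 1" "2 \<le> \<alpha>" and n: "card V = n" "2 * \<alpha> + 1 \<le> n"
    and nb: "\<And>z. z \<in> V - p ` {..e} \<Longrightarrow> \<exists>i<e. \<forall>j\<le>e. (p j, z) \<in> E \<longleftrightarrow> j = i \<or> j = Suc i"
    and d: "dumb_pos (V - {p 0, p e}) (E \<inter> (V - {p 0, p e}) \<times> (V - {p 0, p e})) \<alpha> pos"
    and mid: "p ` {1..e - 1} = {v \<in> V - {p 0, p e}. 1 \<le> pos v \<and> pos v \<le> e - 1}"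
    and p1: "pos (p 1) = 1"
  shows "\<exists>pos. dumb_pos V E \<alpha> pos"
proof -
  let ?V = "V - {p 0, p e}"
  have e3: "3 \<le> e" using e by simp
  have pV: "p i \<in> V" if "i \<le> e" for i using ip that by (auto simp: ipath_def)
  have p_inj: "p i = p j \<longleftrightarrow> i = j" if "i \<le> e" "j \<le> e" for i j
    using ip that by (auto simp: ipath_def inj_on_def)
  have pV': "p i \<in> ?V" if "1 \<le> i" "i \<le> e - 1" for i
    using pV[of i] p_inj[of i 0] p_inj[of i e] that e3 by auto
  have adj: "(u, v) \<in> E \<longleftrightarrow> u \<noteq> v \<and> pos u \<le> Suc (pos v) \<and> pos v \<le> Suc (pos u)" if "u \<in> ?V" "v \<in> ?V" for u v
    using d that by (auto simp: dumb_pos_def)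
  have split: "{..e} = insert 0 (insert e {1..e - 1})" using e3 by auto
  define L where "L = {v \<in> ?V. pos v = 0}"
  define R where "R = {v \<in> ?V. pos v = e}"
  have out: "V - p ` {..e} = L \<union> R"
  proof -
    have "pos v \<le> e" if "v \<in> ?V" for v using d that e by (auto simp: dumb_pos_def)
    then have "\<not> (1 \<le> pos v \<and> pos v \<le> e - 1) \<longleftrightarrow> pos v = 0 \<or> pos v = e" if "v \<in> ?V" for v
      using e3 that by fastforce
    then have "?V - {v \<in> ?V. 1 \<le> pos v \<and> pos v \<le> e - 1} = L \<union> R"
      unfolding L_def R_def by blast
    moreover have "V - p ` {..e} = ?V - p ` {1..e - 1}" unfolding split by auto
    ultimately show ?thesis using mid by simp
  qed
  have uniq: "u = v" if uv: "u \<in> ?V" "v \<in> ?V" "pos u = i" "pos v = i" "1 \<le> i" "i \<le> e - 1" for u v i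
  proof -
    have "card {v \<in> ?V. pos v = i} = 1" using d uv e by (auto simp: dumb_pos_def)
    then obtain w where w: "{v \<in> ?V. pos v = i} = {w}" by (auto simp: card_1_singleton_iff)
    have "u \<in> {v \<in> ?V. pos v = i}" "v \<in> {v \<in> ?V. pos v = i}" using uv by simp_all
    then show ?thesis unfolding w by simp
  qed
  have pmid: "1 \<le> pos (p j) \<and> pos (p j) \<le> e - 1" if "1 \<le> j" "j \<le> e - 1" for j
  proof -
    have "p j \<in> p ` {1..e - 1}" using that by auto
    then show ?thesis unfolding mid by simp
  qed
  have LL: "(p j, z) \<in> E \<longleftrightarrow> j = 0 \<or> j = 1" if z: "z \<in> L" and j: "j \<le> e" for z j
  proof -
    have zV: "z \<in> ?V" "pos z = 0" "z \<in> V - p ` {..e}" using z out by (auto simp: L_def)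
    obtain i where i: "i < e" "\<And>j. j \<le> e \<Longrightarrow> (p j, z) \<in> E \<longleftrightarrow> j = i \<or> j = Suc i" using nb[OF zV(3)] by blast
    have one: "k = 1" if "1 \<le> k" "k \<le> e - 1" "(p k, z) \<in> E" for k
    proof -
      have "pos (p k) = 1" using adj[OF pV'[OF that(1,2)] zV(1)] that(3) zV(2) pmid[OF that(1,2)] by auto
      then have "p k = p 1" using uniq[of "p k" "p 1" 1] pV' that p1 e3 by auto
      moreover have "k \<le> e" "1 \<le> e" using that e3 by simp_all
      ultimately show ?thesis using p_inj[of k 1] by blast
    qed
    have "(p 1, z) \<in> E" using adj[OF pV'[of 1] zV(1)] p1 zV e3 by auto
    then have "1 = i \<or> 1 = Suc i" using i(2)[of 1] e3 by auto
    moreover have "i \<noteq> 1"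
    proof
      assume "i = 1"
      then have "(p 2, z) \<in> E" using i(2)[of 2] e3 by simp
      moreover have "2 \<le> e - 1" using e3 by simp
      ultimately show False using one[of 2] by simp
    qed
    ultimately have "i = 0" by auto
    then show ?thesis using i(2)[OF j] by auto
  qed
  have RR: "(p j, z) \<in> E \<longleftrightarrow> j = e - 1 \<or> j = e" if z: "z \<in> R" and j: "j \<le> e" for z j
  proof -
    have zV: "z \<in> ?V" "pos z = e" "z \<in> V - p ` {..e}" using z out by (auto simp: R_def)
    obtain i where i: "i < e" "\<And>j. j \<le> e \<Longrightarrow> (p j, z) \<in> E \<longleftrightarrow> j = i \<or> j = Suc i" using nb[OF zV(3)] by blast
    have top: "pos (p k) = e - 1" if "1 \<le> k" "k \<le> e - 1" "(p k, z) \<in> E" for k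
      using adj[OF pV'[OF that(1,2)] zV(1)] that(3) zV(2) pmid[OF that(1,2)] by auto
    have "i = e - 1"
    proof (rule ccontr)
      assume ne: "i \<noteq> e - 1"
      then have a: "pos (p (Suc i)) = e - 1" using top[of "Suc i"] i by auto
      have "i \<noteq> 0"
      proof
        assume "i = 0"
        then have "e - 1 = 1" using a p1 by simp
        then show False using e3 by simp
      qed
      then have "pos (p i) = e - 1" using top[of i] i by auto
      then have "p i = p (Suc i)"
        using uniq[of "p i" "p (Suc i)" "e - 1"] a pV'[of i] pV'[of "Suc i"] i ne \<open>i \<noteq> 0\<close> e3 by auto
      moreover have "i \<le> e" "Suc i \<le> e" using i(1) by simp_all
      ultimately have "i = Suc i" using p_inj by blast
      then show False by simp
    qed
    then show ?thesis using i(2)[OF j] e3 by auto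
  qed
  show ?thesis
  proof (rule dumb_pos_glue[OF ip e n out])
    show "L \<inter> R = {}" using e3 by (auto simp: L_def R_def)
    show "\<And>z j. z \<in> L \<Longrightarrow> j \<le> e \<Longrightarrow> (p j, z) \<in> E \<longleftrightarrow> j = 0 \<or> j = 1" by (rule LL)
    show "\<And>z j. z \<in> R \<Longrightarrow> j \<le> e \<Longrightarrow> (p j, z) \<in> E \<longleftrightarrow> j = e - 1 \<or> j = e" by (rule RR)
    show "(z, z') \<in> E" if "z \<in> L" "z' \<in> L" "z \<noteq> z'" for z z'
      using adj[of z z'] that by (auto simp: L_def)
    show "(z, z') \<in> E" if "z \<in> R" "z' \<in> R" "z \<noteq> z'" for z z'
      using adj[of z z'] that by (auto simp: R_def)
    show "(z, z') \<notin> E" if "z \<in> L" "z' \<in> R" for z z'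
      using adj[of z z'] that e3 by (auto simp: L_def R_def)
    have cV: "card ?V = n - 2"
      using n pV[of 0] pV[of e] p_inj[of 0 e] e3 finite_V by (simp add: card_Diff_subset)
    have "n - 2 + 1 = n - 1" using n e by simp
    then show "card L = (n - 1) div 2 + 1 - \<alpha>" "card R = (n - 2) div 2 + 1 - \<alpha>"
      using d cV e unfolding dumb_pos_def L_def R_def by auto
  qed
qed

text \<open>What is missing for the oriented version is that the inner path runs exactly through the
  middle positions of the smaller dumbbell, up to reversal. For \<open>n = 2 * \<alpha> + 1\<close>
  the smaller graph has an empty end fibre, which gives no hold for this; only one vertex lies off
  the path then, and it is treated directly.\<close>

lemma (in sgraph) dumb_pos_extend:
  assumes ip: "ipath p e" and e: "e = 2 * \<alpha> - 1" "2 \<le> \<alpha>" and n: "card V = n" "2 * \<alpha> + 1 \<le> n"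
    and nb: "\<And>z. z \<in> V - p ` {..e} \<Longrightarrow> \<exists>i<e. \<forall>j\<le>e. (p j, z) \<in> E \<longleftrightarrow> j = i \<or> j = Suc i"
    and d: "dumb_pos (V - {p 0, p e}) (E \<inter> (V - {p 0, p e}) \<times> (V - {p 0, p e})) \<alpha> pos"
  shows "\<exists>pos. dumb_pos V E \<alpha> pos"
proof -
  let ?V = "V - {p 0, p e}"
  define q where "q = (\<lambda>i. p (e - i))"
  have e3: "3 \<le> e" using e by simp
  have pV: "p i \<in> V" if "i \<le> e" for i using ip that by (auto simp: ipath_def)
  have p_inj: "p i = p j \<longleftrightarrow> i = j" if "i \<le> e" "j \<le> e" for i j
    using ip that by (auto simp: ipath_def inj_on_def)
  have pV': "p i \<in> ?V" if "1 \<le> i" "i \<le> e - 1" for i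
    using pV[of i] p_inj[of i 0] p_inj[of i e] that e3 by auto
  have adj: "(u, v) \<in> E \<longleftrightarrow> u \<noteq> v \<and> pos u \<le> Suc (pos v) \<and> pos v \<le> Suc (pos u)" if "u \<in> ?V" "v \<in> ?V" for u v
    using d that by (auto simp: dumb_pos_def)
  have bnd: "pos v \<le> e" if "v \<in> ?V" for v using d that e by (auto simp: dumb_pos_def)
  have split: "{..e} = insert 0 (insert e {1..e - 1})" using e3 by auto
  have out: "V - p ` {..e} = ?V - p ` {1..e - 1}" unfolding split by auto
  have cV: "card ?V = n - 2"
    using n pV[of 0] pV[of e] p_inj[of 0 e] e3 finite_V by (simp add: card_Diff_subset)
  have n1: "n - 2 + 1 = n - 1" using n e by simp
  have fibs: "card {v \<in> ?V. pos v = 0} = (n - 1) div 2 + 1 - \<alpha>" "card {v \<in> ?V. pos v = e} = (n - 2) div 2 + 1 - \<alpha>"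
    using d e n1 unfolding dumb_pos_def cV by auto
  have uniq: "u = v" if uv: "u \<in> ?V" "v \<in> ?V" "pos u = i" "pos v = i" "1 \<le> i" "i \<le> e - 1" for u v i
  proof -
    have "card {v \<in> ?V. pos v = i} = 1" using d uv e by (auto simp: dumb_pos_def)
    then obtain w where w: "{v \<in> ?V. pos v = i} = {w}" by (auto simp: card_1_singleton_iff)
    have "u \<in> {v \<in> ?V. pos v = i}" "v \<in> {v \<in> ?V. pos v = i}" using uv by simp_all
    then show ?thesis unfolding w by simp
  qed
  have q: "ipath q e" "q ` {..e} = p ` {..e}" using ipath_rev[OF ip] by (simp_all add: q_def)
  have q_ends: "{q 0, q e} = {p 0, p e}" by (auto simp: q_def)
  have nbq: "\<exists>i<e. \<forall>j\<le>e. (q j, z) \<in> E \<longleftrightarrow> j = i \<or> j = Suc i" if zq: "z \<in> V - q ` {..e}" for z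
  proof -
    obtain i where i: "i < e" "\<forall>j\<le>e. (p j, z) \<in> E \<longleftrightarrow> j = i \<or> j = Suc i" using nb[of z] zq q by auto
    have "(q j, z) \<in> E \<longleftrightarrow> j = e - 1 - i \<or> j = Suc (e - 1 - i)" if "j \<le> e" for j
    proof -
      have "(q j, z) \<in> E \<longleftrightarrow> e - j = i \<or> e - j = Suc i" using i(2) by (simp add: q_def)
      then show ?thesis using i(1) that by arith
    qed
    moreover have "e - 1 - i < e" using i by simp
    ultimately show ?thesis by blast
  qed
  show ?thesis
  proof (cases "n = 2 * \<alpha> + 1")
    case True
    have "card (V - p ` {..e}) = 1"
    proof -
      have "card (p ` {..e}) = e + 1" "p ` {..e} \<subseteq> V" using ip by (auto simp: ipath_def card_image)
      then show ?thesis using n True e finite_V by (simp add: card_Diff_subset finite_subset)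
    qed
    then obtain z where z: "V - p ` {..e} = {z}" by (auto simp: card_1_singleton_iff)
    have zV: "z \<in> ?V" using z out by blast
    have glue: "\<exists>pos. dumb_pos V E \<alpha> pos"
      if r: "ipath r e" "r ` {..e} = p ` {..e}" "\<And>j. j \<le> e \<Longrightarrow> (r j, z) \<in> E \<longleftrightarrow> j = 0 \<or> j = 1" for r
      by (rule dumb_pos_glue[OF r(1) e n, of "{z}" "{}"]) (use r z True e(2) in auto)
    obtain i where i: "i < e" "\<And>j. j \<le> e \<Longrightarrow> (p j, z) \<in> E \<longleftrightarrow> j = i \<or> j = Suc i" using nb[of z] z by auto
    have inj: "u = v" if uv: "u \<in> ?V" "v \<in> ?V" "pos u = pos v" for u v
    proof -
      have "card {v \<in> ?V. pos v = pos u} \<le> 1"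
      proof -
        consider "pos u = 0" | "pos u = e" | "1 \<le> pos u" "pos u \<le> 2 * \<alpha> - 2" using bnd[OF uv(1)] e by linarith
        then show ?thesis
        proof cases
          case 3
          then show ?thesis using d by (auto simp: dumb_pos_def)
        qed (use fibs True in auto)
      qed
      moreover define F where "F = {v \<in> ?V. pos v = pos u}"
      ultimately have "card F \<le> Suc 0" by simp
      moreover have "finite F" unfolding F_def using finite_V by simp
      ultimately have "\<forall>a\<in>F. \<forall>b\<in>F. a = b" using card_le_Suc0_iff_eq by blast
      moreover have "u \<in> F" "v \<in> F" unfolding F_def using uv by simp_all
      ultimately show ?thesis by blast
    qed
    have "i = 0 \<or> i = e - 1"
    proof (rule ccontr)
      assume "\<not> ?thesis"
      then have r: "1 \<le> i" "i \<le> e - 1" "1 \<le> Suc i" "Suc i \<le> e - 1" using i(1) by auto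
      have a: "(p i, z) \<in> E" "(p (Suc i), z) \<in> E" using i by auto
      have b: "(p i, p (Suc i)) \<in> E" using ip i(1) by (auto simp: ipath_def)
      note V' = pV'[OF r(1,2)] pV'[OF r(3,4)]
      \<comment> \<open>The three vertices would form a triangle, but positions are injective here
        and three different integers cannot pairwise differ by at most one.\<close>
      have "pos (p i) \<noteq> pos z" "pos (p (Suc i)) \<noteq> pos z" "pos (p i) \<noteq> pos (p (Suc i))"
        using inj[OF V'(1) zV] inj[OF V'(2) zV] inj[OF V'] a b irrefl_E by metis+
      then show False using adj[OF V'(1) zV] adj[OF V'(2) zV] adj[OF V'] a b by linarith
    qed
    then show ?thesis
    proof
      assume "i = 0"
      then show ?thesis using i ip by (intro glue[of p]) auto
    next
      assume "i = e - 1"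
      then have "(q j, z) \<in> E \<longleftrightarrow> j = 0 \<or> j = 1" if "j \<le> e" for j
        using i(2)[of "e - j"] that e3 unfolding q_def by auto
      then show ?thesis using q by (intro glue[of q]) auto
    qed
  next
    case False
    let ?M = "p ` {1..e - 1}"
    have n2: "2 * \<alpha> + 2 \<le> n" using n False by simp
    have near: "\<exists>u\<in>?M. pos u \<le> Suc (pos v) \<and> pos v \<le> Suc (pos u)" if v: "v \<in> ?V" for v
    proof (cases "v \<in> ?M")
      case True
      then show ?thesis by (intro bexI[of _ v]) simp_all
    next
      case False
      then have "v \<in> V - p ` {..e}" using v out by auto
      then obtain i where i: "i < e" "\<And>j. j \<le> e \<Longrightarrow> (p j, v) \<in> E \<longleftrightarrow> j = i \<or> j = Suc i" using nb by blast
      \<comment> \<open>At least one of the two consecutive neighbours \<open>p i\<close>,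
        \<open>p (Suc i)\<close> is an inner vertex of the path.\<close>
      define j where "j = (if i = 0 then 1 else i)"
      have "1 \<le> j" "j \<le> e - 1" "(p j, v) \<in> E" using i e3 by (auto simp: j_def)
      then show ?thesis using adj[OF pV' v, of j] by (intro bexI[of _ "p j"]) auto
    qed
    have ne: "S \<noteq> {}" if "card S \<noteq> 0" for S :: "'a set" using that by auto
    have "{v \<in> ?V. pos v = 0} \<noteq> {}" "{v \<in> ?V. pos v = e} \<noteq> {}"
      using fibs n2 by (intro ne; simp)+
    then obtain z0 ze where z0: "z0 \<in> ?V" "pos z0 = 0" and ze: "ze \<in> ?V" "pos ze = e"
      by blast
    obtain lo where lo: "lo \<in> ?M" "pos lo \<le> 1" using near[OF z0(1)] z0(2) by auto
    obtain hi where hi: "hi \<in> ?M" "pos ze \<le> Suc (pos hi)" using near[OF ze(1)] by blast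
    then have hi2: "e - 1 \<le> pos hi" using ze(2) by simp
    have MV: "?M \<subseteq> ?V" using pV' by auto
    have cM: "conn_on E ?M" using conn_segment[OF ip, of 1 "e - 1"] e3 by simp
    \<comment> \<open>A discrete intermediate value argument: the inner path is connected, adjacent
      positions differ by at most one, and the path reaches from position at most 1 to position at
      least \<open>e - 1\<close>. As it has only \<open>e - 1\<close> vertices, it takes each middle
      position once and no other.\<close>
    have attain: "k \<in> pos ` ?M" if k: "k \<in> {1..e - 1}" for k
    proof (rule ccontr)
      assume no: "k \<notin> pos ` ?M"
      let ?X = "{u \<in> ?M. pos u < k}"
      have ne: "pos u \<noteq> k" if "u \<in> ?M" for u using no that by blast
      have "pos lo < k" using lo(2) ne[OF lo(1)] k by simp
      then have "lo \<in> ?X" using lo by simp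
      moreover have "hi \<in> ?M - ?X" using hi(1) hi2 k by simp
      ultimately obtain a b where ab: "a \<in> ?X" "b \<in> ?M - ?X" "(a, b) \<in> E"
        using conn_on_boundary[OF cM, of ?X lo hi] by blast
      have "pos b \<noteq> k" using ne ab by blast
      moreover have "pos b \<le> Suc (pos a)" using adj[of a b] ab MV by blast
      ultimately show False using ab by auto
    qed
    have "inj_on p {1..e - 1}"
    proof (rule inj_on_subset)
      show "inj_on p {..e}" using ip by (simp add: ipath_def)
    qed auto
    then have "card ?M = e - 1" by (simp add: card_image)
    then have "card (pos ` ?M) \<le> card {1..e - 1}" using card_image_le[of ?M pos] by simp
    then have posM: "pos ` ?M = {1..e - 1}" using attain by (intro card_seteq[symmetric]) auto
    have mid: "?M = {v \<in> ?V. 1 \<le> pos v \<and> pos v \<le> e - 1}"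
    proof
      show "?M \<subseteq> {v \<in> ?V. 1 \<le> pos v \<and> pos v \<le> e - 1}"
      proof
        fix u assume u: "u \<in> ?M"
        then have "pos u \<in> {1..e - 1}" using posM by blast
        then show "u \<in> {v \<in> ?V. 1 \<le> pos v \<and> pos v \<le> e - 1}" using u MV by auto
      qed
      show "{v \<in> ?V. 1 \<le> pos v \<and> pos v \<le> e - 1} \<subseteq> ?M"
      proof
        fix v assume v: "v \<in> {v \<in> ?V. 1 \<le> pos v \<and> pos v \<le> e - 1}"
        then have "pos v \<in> pos ` ?M" using posM by auto
        then obtain u where u: "pos v = pos u" "u \<in> ?M" by (rule imageE)
        then have uV: "u \<in> ?V" using MV by blast
        have v': "v \<in> ?V" "1 \<le> pos v" "pos v \<le> e - 1" using v by blast+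
        have "u = v" by (rule uniq[OF uV v'(1) u(1)[symmetric] refl v'(2,3)])
        then show "v \<in> ?M" using u(2) by simp
      qed
    qed
    have "z0 \<notin> ?M" using mid z0 by auto
    then have "z0 \<in> V - p ` {..e}" using z0 out by auto
    then obtain i where i: "i < e" "\<And>j. j \<le> e \<Longrightarrow> (p j, z0) \<in> E \<longleftrightarrow> j = i \<or> j = Suc i" using nb by blast
    have one: "pos (p k) = 1" if k: "1 \<le> k" "k \<le> e - 1" "(p k, z0) \<in> E" for k
    proof -
      have "p k \<in> ?M" using k by auto
      then have "1 \<le> pos (p k)" unfolding mid by simp
      moreover have "pos (p k) \<le> 1" using adj[OF pV'[OF k(1,2)] z0(1)] k z0 by simp
      ultimately show ?thesis by simp
    qed
    have "i = 0 \<or> i = e - 1"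
    proof (rule ccontr)
      assume "\<not> ?thesis"
      then have r: "1 \<le> i" "i \<le> e - 1" "1 \<le> Suc i" "Suc i \<le> e - 1" using i(1) by auto
      have "pos (p i) = 1" "pos (p (Suc i)) = 1" using one r i by auto
      then have "p i = p (Suc i)" using uniq[of "p i" "p (Suc i)" 1] pV'[OF r(1,2)] pV'[OF r(3,4)] e3 by auto
      then have "i = Suc i" using p_inj i(1) by (metis Suc_leI less_imp_le_nat)
      then show False by simp
    qed
    then show ?thesis
    proof
      assume "i = 0"
      then have "pos (p 1) = 1" using one[of 1] i(2)[of 1] e3 by auto
      then show ?thesis using dumb_pos_extend_oriented[OF ip e n nb d mid] by blast
    next
      assume "i = e - 1"
      then have "pos (p (e - 1)) = 1" using one[of "e - 1"] i(2)[of "e - 1"] e3 by auto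
      then have q1: "pos (q 1) = 1" by (simp add: q_def)
      have dq: "dumb_pos (V - {q 0, q e}) (E \<inter> (V - {q 0, q e}) \<times> (V - {q 0, q e})) \<alpha> pos"
        unfolding q_ends by (rule d)
      have "q ` {1..e - 1} = ?M"
      proof -
        have "k \<in> (\<lambda>i. e - i) ` {1..e - 1}" if "k \<in> {1..e - 1}" for k
          using that by (intro image_eqI[of _ _ "e - k"]) auto
        then have "(\<lambda>i. e - i) ` {1..e - 1} = {1..e - 1}" by auto
        then show ?thesis unfolding q_def by (metis image_image)
      qed
      then have midq: "q ` {1..e - 1} = {v \<in> V - {q 0, q e}. 1 \<le> pos v \<and> pos v \<le> e - 1}"
        unfolding q_ends using mid by simp
      show ?thesis using dumb_pos_extend_oriented[OF q(1) e n nbq dq midq q1] by blast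
    qed
  qed
qed

subsection \<open>The extremal bound\<close>

lemma (in cgraph) ex_nbr:
  assumes "card V \<ge> 2" "x \<in> V"
  obtains w where "(x, w) \<in> E"
proof -
  obtain e where "1 \<le> e" "vdist E x ` (V - {x}) = {1..e}" using ecc_profile[OF assms(2,1)] by blast
  then have "1 \<in> vdist E x ` (V - {x})" by simp
  then obtain w where "1 = vdist E x w" "w \<in> V - {x}" by (rule imageE)
  then show ?thesis using that vdist_eq_1[of x w] assms by auto
qed

text \<open>The situation of the induction step. \<open>IH\<close> is available for any connected
  remainder, since depending on the case one vertex or two are deleted.\<close>

locale extremal_setup = cgraph_f +
  fixes \<alpha> n :: nat
  assumes \<alpha>2: "2 \<le> \<alpha>" and n_card: "card V = n" and n_big: "2 * \<alpha> + 1 \<le> n"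
    and alpha_le: "\<forall>I. I \<subseteq> V \<longrightarrow> indep E I \<longrightarrow> card I \<le> \<alpha>"
    and IH: "\<And>X. X \<subseteq> V \<Longrightarrow> X \<noteq> {} \<Longrightarrow> card X < n \<Longrightarrow> conn_on E (V - X) \<Longrightarrow>
      wien f (V - X) (E \<inter> (V - X) \<times> (V - X)) \<le> wmax f \<alpha> (n - card X) \<and>
      (wien f (V - X) (E \<inter> (V - X) \<times> (V - X)) = wmax f \<alpha> (n - card X) \<longrightarrow> 2 * \<alpha> - 1 \<le> n - card X \<longrightarrow>
        (\<exists>pos. dumb_pos (V - X) (E \<inter> (V - X) \<times> (V - X)) \<alpha> pos))"
begin

lemma strict_of_single:
  assumes "x \<in> V" "conn_on E (V - {x})" "(\<Sum>z\<in>V - {x}. vdist E x z) \<le> \<alpha> * (n - 2)"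
  shows "wien f V E < wmax f \<alpha> n"
proof -
  obtain k where k: "n = Suc k" using n_big by (cases n) auto
  have "wien f V E \<le> wien f (V - {x}) (E \<inter> (V - {x}) \<times> (V - {x})) + (\<Sum>z\<in>V - {x}. f (vdist E x z))"
    using assms by (intro wien_remove)
  also have "(\<Sum>z\<in>V - {x}. f (vdist E x z)) < single_target f \<alpha> n"
    using assms \<alpha>2 n_card n_big alpha_le by (intro single_step) auto
  also have "wien f (V - {x}) (E \<inter> (V - {x}) \<times> (V - {x})) \<le> wmax f \<alpha> (n - card {x})"
    using IH[of "{x}"] assms n_big \<alpha>2 by simp
  finally show ?thesis by (simp add: k wmax_Suc)
qed

text \<open>Every transmission is \<open>n - 1\<close>, which is already at most
  \<open>\<alpha> * (n - 2)\<close>, so deleting any vertex gives a strict inequality.\<close>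

lemma complete_strict:
  assumes "\<And>u v. u \<in> V \<Longrightarrow> v \<in> V \<Longrightarrow> u \<noteq> v \<Longrightarrow> (u, v) \<in> E"
  shows "wien f V E < wmax f \<alpha> n"
proof -
  have "V \<noteq> {}" using n_card n_big by auto
  then obtain x where x: "x \<in> V" by blast
  have "(\<Sum>z\<in>V - {x}. vdist E x z) = (\<Sum>z\<in>V - {x}. 1)"
    using x assms vdist_adj by (intro sum.cong) auto
  also have "\<dots> = n - 1" using x n_card finite_V by simp
  also have "n - 1 \<le> 2 * (n - 2)" using n_big \<alpha>2 by simp
  also have "\<dots> \<le> \<alpha> * (n - 2)" using \<alpha>2 by (intro mult_right_mono) auto
  finally have sum: "(\<Sum>z\<in>V - {x}. vdist E x z) \<le> \<alpha> * (n - 2)" .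
  have "conn_on E (V - {x})"
    unfolding conn_on_def
  proof (intro ballI)
    fix u v assume "u \<in> V - {x}" "v \<in> V - {x}"
    then show "(u, v) \<in> (E \<inter> (V - {x}) \<times> (V - {x}))\<^sup>*"
      using assms[of u v] by (cases "u = v") auto
  qed
  then show ?thesis using x sum by (intro strict_of_single[of x])
qed

lemma extremal_step:
  "wien f V E \<le> wmax f \<alpha> n \<and> (wien f V E = wmax f \<alpha> n \<longrightarrow> (\<exists>pos. dumb_pos V E \<alpha> pos))"
proof -
  have n2: "2 \<le> card V" using n_card n_big \<alpha>2 by simp
  obtain p e where ip: "ipath p e" and gd: "good (p ` {..e})"
    and longest: "\<And>q d. ipath q d \<Longrightarrow> good (q ` {..d}) \<Longrightarrow> d \<le> e"
    using longest_good_ipath[OF n2] by metis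
  define P where "P = p ` {..e}"
  have PV: "P \<subseteq> V" "P \<noteq> {}" using ip by (auto simp: ipath_def P_def)
  \<comment> \<open>Such a vertex would prolong the path at this end, and the longer path is still
    good. The parameter \<open>q\<close> covers both directions of the path.\<close>
  have noext: "E `` {w} \<inter> P \<noteq> {q e}" if "w \<in> V - P" "ipath q e" "q ` {..e} = P" for w q
  proof
    assume "E `` {w} \<inter> P = {q e}"
    then have "ipath (q(Suc e := w)) (Suc e)" "q(Suc e := w) ` {..Suc e} = insert w P"
      using ipath_extend[of q e w] that by auto
    moreover have "good (insert w P)"
      using good_mono[OF gd] ball1_mono[of P "insert w P"] by (auto simp: P_def)
    ultimately show False using longest[of "q(Suc e := w)" "Suc e"] by simp
  qed
  have noext_e: "E `` {w} \<inter> P \<noteq> {p e}" if "w \<in> V - P" for w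
    using noext[OF that ip] by (simp add: P_def)
  have noext_0: "E `` {w} \<inter> P \<noteq> {p 0}" if "w \<in> V - P" for w
    using noext[OF that ipath_rev(1)[OF ip]] ipath_rev(2)[OF ip] by (simp add: P_def)
  have e1: "1 \<le> e"
  proof (rule ccontr)
    assume "\<not> 1 \<le> e"
    then have e0: "e = 0" by simp
    then have "P = {p 0}" by (simp add: P_def)
    obtain w where w: "(p 0, w) \<in> E" using ex_nbr[OF n2, of "p 0"] PV \<open>P = {p 0}\<close> by auto
    have "w \<in> V - P" using w E_sub irrefl_E \<open>P = {p 0}\<close> by auto
    moreover have "E `` {w} \<inter> P = {p 0}" using w E_sym \<open>P = {p 0}\<close> by auto
    ultimately show False using noext_0 by blast
  qed
  interpret gp: gpath V E p e \<alpha>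
    using ip gd e1 alpha_le by unfold_locales auto
  have gP: "gp.P = P" by (simp add: gp.P_def P_def)
  have nbr: "\<exists>j\<le>e. (p j, w) \<in> E \<and> j \<noteq> k" if w: "w \<in> V - P" "w \<in> E `` P" and k: "k = 0 \<or> k = e" for w k
  proof (rule ccontr)
    assume no: "\<not> ?thesis"
    obtain j where "j \<le> e" "(p j, w) \<in> E" using w(2) by (auto simp: P_def)
    then have "(p k, w) \<in> E" using no by blast
    then have "E `` {w} \<inter> P = {p k}" using no E_comm[of w] k by (auto simp: P_def)
    then show False using noext_0[OF w(1)] noext_e[OF w(1)] k by auto
  qed
  show ?thesis
  proof (cases "e = 1")
    case True
    \<comment> \<open>For \<open>e = 1\<close> every neighbour of the path also sees
      \<open>p 0\<close>, so the closed neighbourhood of \<open>p 0\<close> alone contains that of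
      the path.\<close>
    have good_x: "good S" if "p 0 \<in> S" for S
    proof (rule good_mono[OF gd])
      have "v \<in> ball1 {p 0}" if v: "v \<in> ball1 P" for v
      proof (cases "v \<in> P")
        case True
        then have "v = p 0 \<or> v = p 1" using \<open>e = 1\<close> by (auto simp: P_def le_Suc_eq)
        then show ?thesis using gp.p_adj[of 0 1] \<open>e = 1\<close> by (auto simp: ball1_def)
      next
        case False
        then have "v \<in> V - P" "v \<in> E `` P" using v E_sub by (auto simp: ball1_def)
        then obtain j where "j \<le> e" "(p j, v) \<in> E" "j \<noteq> e" using nbr[of v e] by blast
        moreover from this have "j = 0" using \<open>e = 1\<close> by linarith
        ultimately show ?thesis by (auto simp: ball1_def)
      qed
      then show "ball1 (p ` {..e}) \<subseteq> ball1 S"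
        using ball1_mono[of "{p 0}" S] that by (auto simp: P_def)
    qed
    \<comment> \<open>An induced path on three vertices through \<open>p 0\<close> would be a longer
      good path. Hence \<open>p 0\<close> is adjacent to all vertices, and any two of its neighbours
      are adjacent: the graph is complete.\<close>
    have no3: False if abc: "a \<in> V" "c \<in> V" "(a, b) \<in> E" "(b, c) \<in> E" "(a, c) \<notin> E" "a \<noteq> c" "p 0 \<in> {a, b, c}" for a b c
    proof -
      have "good ((\<lambda>i. if i = 0 then a else if i = (1::nat) then b else c) ` {..2})"
        unfolding ipath3(2)[OF abc(1-6)] by (rule good_x[OF abc(7)])
      from longest[OF ipath3(1)[OF abc(1-6)] this] show False using True by simp
    qed
    have xV: "p 0 \<in> V" using gp.pV by simp
    have all: "(p 0, v) \<in> E" if v: "v \<in> V" "v \<noteq> p 0" for v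
    proof (rule ccontr)
      assume nv: "(p 0, v) \<notin> E"
      have "vdist E (p 0) v \<noteq> 0" "vdist E (p 0) v \<noteq> 1"
        using vdist_eq_0[OF xV v(1)] vdist_eq_1[OF xV v(1)] nv v(2) by auto
      then have "2 \<le> vdist E (p 0) v" by linarith
      then obtain z where z: "z \<in> V" "vdist E (p 0) z = Suc 1"
        using sdist_level[of "{p 0}" v 2] xV v by auto
      then obtain w where w: "(w, z) \<in> E" "vdist E (p 0) w = 1"
        using sdist_pred[of "{p 0}" z 1] xV by auto
      have wV: "w \<in> V" using w E_sub by auto
      have "(p 0, w) \<in> E" using w(2) vdist_eq_1[OF xV wV] by simp
      moreover have "(p 0, z) \<notin> E" "p 0 \<noteq> z"
        using z(2) vdist_eq_1[OF xV z(1)] vdist_eq_0[OF xV z(1)] by auto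
      ultimately show False using no3[OF xV z(1) _ w(1)] by blast
    qed
    have "(u, v) \<in> E" if uv: "u \<in> V" "v \<in> V" "u \<noteq> v" for u v
    proof (cases "u = p 0 \<or> v = p 0")
      case True
      then show ?thesis using all uv E_sym by blast
    next
      case False
      then have "(u, p 0) \<in> E" "(p 0, v) \<in> E" using all uv E_sym by blast+
      then show ?thesis using no3[OF uv(1,2)] uv(3) by blast
    qed
    then show ?thesis using complete_strict by simp
  next
    case False
    then have e2: "2 \<le> e" using e1 by simp
    let ?x = "p 0" and ?y = "p e"
    let ?t = "\<Sum>z\<in>V - {?x, ?y}. vdist E ?x z + vdist E ?y z"
    have xy: "?x \<in> V" "?y \<in> V" "?x \<noteq> ?y" using gp.pV gp.p_inj[of 0 e] e1 by auto
    have Pint: "P - {?x, ?y} = p ` {1..e - 1}" "P - {?x} = p ` {1..e}" "P - {?y} = p ` {0..e - 1}"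
    proof -
      have x: "?x \<notin> p ` {1..j}" if "j \<le> e" for j
      proof
        assume "?x \<in> p ` {1..j}"
        then obtain i where "p 0 = p i" "i \<in> {1..j}" by (rule imageE)
        then show False using gp.p_inj[of 0 i] that by simp
      qed
      have y: "?y \<notin> p ` {j..e - 1}" for j
      proof
        assume "?y \<in> p ` {j..e - 1}"
        then obtain i where i: "p e = p i" "i \<in> {j..e - 1}" by (rule imageE)
        then have "i < e" using e2 by auto
        then show False using gp.p_inj[of e i] i(1) by simp
      qed
      have s: "{..e} = insert 0 {1..e}" "{..e} = insert e {0..e - 1}" "{..e} = insert 0 (insert e {1..e - 1})"
        using e2 by auto
      have "P = insert ?x (p ` {1..e})" unfolding P_def s(1) by simp
      then show "P - {?x} = p ` {1..e}" using x[of e] by blast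
      have "P = insert ?y (p ` {0..e - 1})" unfolding P_def s(2) by simp
      then show "P - {?y} = p ` {0..e - 1}" using y[of 0] by blast
      have "P = insert ?x (insert ?y (p ` {1..e - 1}))" unfolding P_def s(3) by simp
      then show "P - {?x, ?y} = p ` {1..e - 1}" using x[of "e - 1"] y[of 1] by auto
    qed
    have cx: "conn_on E (V - {?x})"
    proof (rule conn_remove[of P])
      show "conn_on E (P - {?x})" unfolding Pint using conn_segment[OF ip, of 1 e] e1 by simp
      show "w \<in> E `` (P - {?x})" if w: "w \<in> V - P" "w \<in> E `` P" for w
      proof -
        obtain j where "j \<le> e" "(p j, w) \<in> E" "j \<noteq> 0" using nbr[OF w, of 0] by blast
        then show ?thesis unfolding Pint by (intro ImageI[of "p j"]) auto
      qed
    qed (use PV e2 Pint in \<open>auto simp: P_def\<close>)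
    have cy: "conn_on E (V - {?y})"
    proof (rule conn_remove[of P])
      show "conn_on E (P - {?y})" unfolding Pint using conn_segment[OF ip, of 0 "e - 1"] e1 by simp
      show "w \<in> E `` (P - {?y})" if w: "w \<in> V - P" "w \<in> E `` P" for w
      proof -
        obtain j where "j \<le> e" "(p j, w) \<in> E" "j \<noteq> e" using nbr[OF w, of e] by blast
        then show ?thesis unfolding Pint by (intro ImageI[of "p j"]) auto
      qed
    qed (use PV e2 Pint in \<open>auto simp: P_def\<close>)
    have bnd: "vdist E ?x z + vdist E ?y z \<le> e + 1 + gp.single + 2 * (gp.ht z - 1)" if "z \<in> V - P" for z
      using gp.dist_sum_le[of z] gp.sdist_le_ht[of z] that unfolding gP
      by (meson add_left_mono diff_le_mono le_trans mult_le_mono2)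
    have ex: "(n - 2) * (e + 1 + gp.single + gp.excess) \<le> 2 * \<alpha> * (n - 2)"
      using mult_left_mono[OF gp.excess_bounds(3), of "n - 2"] by (simp add: mult.commute)
    have \<delta>: "vdist E ?x ?y \<le> e" using gp.vdist_p[of 0 e] by simp
    show ?thesis
    proof (cases "\<forall>w\<in>V - P. w \<in> E `` P \<longrightarrow> w \<in> E `` (P - {?x, ?y})")
      case True
      have cxy: "conn_on E (V - {?x, ?y})"
      proof (rule conn_remove[of P])
        show "conn_on E (P - {?x, ?y})" unfolding Pint using conn_segment[OF ip, of 1 "e - 1"] e2 by simp
        show "P - {?x, ?y} \<noteq> {}" unfolding Pint using e2 by simp
      qed (use True PV in \<open>auto simp: P_def\<close>)
      \<comment> \<open>The saving \<open>e - 1\<close> against the added distance of at most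
        \<open>e\<close> leaves the \<open>+ 1\<close> of the budget.\<close>
      have "?t + (e - 1) * (1 + gp.single) + 0 \<le> (n - 2) * (e + 1 + gp.single + gp.excess)"
        using gp.transmission_bound[OF n_card, of "\<lambda>_. 0"] bnd unfolding gP by simp
      moreover have "e - 1 \<le> (e - 1) * (1 + gp.single)" by simp
      ultimately have lin: "?t + vdist E ?x ?y \<le> 2 * \<alpha> * (n - 2) + 1"
        using ex \<delta> by linarith
      note ps = pair_step[OF alpha_le _ n_card n_big xy cx cy lin]
      have IHxy: "wien f (V - {?x, ?y}) (E \<inter> (V - {?x, ?y}) \<times> (V - {?x, ?y})) \<le> wmax f \<alpha> (n - 2)"
        "wien f (V - {?x, ?y}) (E \<inter> (V - {?x, ?y}) \<times> (V - {?x, ?y})) = wmax f \<alpha> (n - 2) \<Longrightarrow>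
          \<exists>pos. dumb_pos (V - {?x, ?y}) (E \<inter> (V - {?x, ?y}) \<times> (V - {?x, ?y})) \<alpha> pos"
        using IH[of "{?x, ?y}"] xy cxy n_big \<alpha>2 by (auto simp: numeral_2_eq_2)
      note rem = wien_remove2[OF xy cxy]
      have wm: "wmax f \<alpha> n = wmax f \<alpha> (n - 2) + pair_target f (2 * \<alpha> - 1) n"
        using wmax_pair[OF n_big] \<alpha>2 by simp
      have le: "wien f V E \<le> wmax f \<alpha> n"
        using rem ps(1) IHxy(1) \<alpha>2 unfolding wm by simp
      have "\<exists>pos. dumb_pos V E \<alpha> pos" if eq: "wien f V E = wmax f \<alpha> n"
      proof -
        have "\<not> ?t + vdist E ?x ?y < 2 * \<alpha> * (n - 2) + 1"
          using rem ps(2) IHxy(1) eq \<alpha>2 unfolding wm by auto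
        then have teq: "?t + vdist E ?x ?y = 2 * \<alpha> * (n - 2) + 1" using lin by linarith
        have n3: "3 \<le> n" using n_big \<alpha>2 by simp
        have es: "e = 2 * \<alpha> - 1" using gp.equality_structure(1)[OF n_card n3 e2 teq] .
        have nb: "\<exists>i<e. \<forall>j\<le>e. (p j, z) \<in> E \<longleftrightarrow> j = i \<or> j = Suc i" if "z \<in> V - p ` {..e}" for z
          using gp.equality_structure(2)[OF n_card n3 e2 teq, of z] that unfolding gP P_def by blast
        have "wien f (V - {?x, ?y}) (E \<inter> (V - {?x, ?y}) \<times> (V - {?x, ?y})) = wmax f \<alpha> (n - 2)"
          using rem ps(1) IHxy(1) eq \<alpha>2 unfolding wm by simp
        then obtain pos where "dumb_pos (V - {?x, ?y}) (E \<inter> (V - {?x, ?y}) \<times> (V - {?x, ?y})) \<alpha> pos"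
          using IHxy(2) by blast
        then show ?thesis using dumb_pos_extend[OF ip es \<alpha>2 n_card n_big nb] by blast
      qed
      then show ?thesis using le by blast
    next
      case False
      then obtain w where w: "w \<in> V - P" "w \<in> E `` P" "w \<notin> E `` (P - {?x, ?y})" by blast
      \<comment> \<open>\<open>w\<close> has no inner neighbour on the path, and by
        \<open>nbr\<close> it is attached to both ends; this closes the cycle and brings the ends
        within distance 2.\<close>
      have only: "j = 0 \<or> j = e" if "j \<le> e" "(p j, w) \<in> E" for j
        using w(3) that gp.p_inj[of j 0] gp.p_inj[of j e] by (auto simp: P_def)
      have wx: "(?x, w) \<in> E" "(?y, w) \<in> E"
        using nbr[OF w(1,2), of e] nbr[OF w(1,2), of 0] only by blast+
      have d1: "vdist E ?x w = 1" "vdist E ?y w = 1" using wx vdist_adj by auto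
      have d2: "vdist E ?x ?y \<le> 2"
        using vdist_triangle[of ?x w ?y] vdist_comm[of w ?y] d1 xy w(1) by simp
      \<comment> \<open>The distance sum of \<open>w\<close> is 2, whereas at least
        \<open>e + 1\<close> was allowed.\<close>
      let ?g = "\<lambda>z. if z = w then e - 1 else 0"
      have "?t + (e - 1) * (1 + gp.single) + (\<Sum>z\<in>V - P. ?g z) \<le> (n - 2) * (e + 1 + gp.single + gp.excess)"
        using gp.transmission_bound[OF n_card, of ?g] bnd d1 unfolding gP by force
      moreover have "(\<Sum>z\<in>V - P. ?g z) = e - 1" using w(1) finite_V by simp
      ultimately have tb: "?t + (e - 1) * (1 + gp.single) + (e - 1) \<le> (n - 2) * (e + 1 + gp.single + gp.excess)"
        by simp
      \<comment> \<open>The two transmissions add up to \<open>?t\<close> and twice a distance of at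
        most 2. A margin of 3 leaves at most \<open>2 * \<alpha> * (n - 2) + 1\<close>, so one of
        them is at most \<open>\<alpha> * (n - 2)\<close>.\<close>
      have t3: "?t + 3 \<le> 2 * \<alpha> * (n - 2)"
      proof (cases "e = 2 \<and> gp.single = 0")
        case True
        \<comment> \<open>Here the savings amount to 2 only. Because \<open>e\<close> is even, the
          independence bound has an extra unit, which is worth another \<open>n - 2\<close>.\<close>
        have "e + 2 + gp.excess \<le> 2 * \<alpha>" using gp.excess_bounds(1) True by simp
        then have "(n - 2) * (e + 2 + gp.excess) \<le> (n - 2) * (2 * \<alpha>)" by (intro mult_left_mono) auto
        moreover have "(n - 2) * (e + 2 + gp.excess) = (n - 2) * (e + 1 + gp.excess) + (n - 2)"
          by (simp add: algebra_simps)
        moreover have "?t + 2 \<le> (n - 2) * (e + 1 + gp.excess)"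
        proof -
          have s0: "gp.single = 0" using True by (rule conjunct2)
          have "(e - 1) + (e - 1) = 2" using True by simp
          then show ?thesis using tb unfolding s0 by simp
        qed
        moreover have "3 \<le> n - 2" using n_big \<alpha>2 by linarith
        moreover have "(n - 2) * (2 * \<alpha>) = 2 * \<alpha> * (n - 2)" by (rule mult.commute)
        ultimately show ?thesis by linarith
      next
        case False
        then have "3 \<le> (e - 1) * (1 + gp.single) + (e - 1)"
          using e2 by (cases "e = 2") (auto simp: Suc_le_eq)
        then show ?thesis using tb ex by linarith
      qed
      have sumx: "(\<Sum>z\<in>V - {?x}. vdist E ?x z) = vdist E ?x ?y + (\<Sum>z\<in>V - {?x, ?y}. vdist E ?x z)"
        using sum.remove[of "V - {?x}" ?y "vdist E ?x"] finite_V xy by (simp add: Diff_insert2[symmetric] insert_commute)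
      have sumy: "(\<Sum>z\<in>V - {?y}. vdist E ?y z) = vdist E ?x ?y + (\<Sum>z\<in>V - {?x, ?y}. vdist E ?y z)"
        using sum.remove[of "V - {?y}" ?x "vdist E ?y"] finite_V xy vdist_comm[of ?x ?y]
        by (simp add: Diff_insert2[symmetric] insert_commute)
      have "?t = (\<Sum>z\<in>V - {?x, ?y}. vdist E ?x z) + (\<Sum>z\<in>V - {?x, ?y}. vdist E ?y z)"
        by (simp add: sum.distrib)
      then have "(\<Sum>z\<in>V - {?x}. vdist E ?x z) + (\<Sum>z\<in>V - {?y}. vdist E ?y z) \<le> 2 * (\<alpha> * (n - 2)) + 1"
        using t3 d2 unfolding sumx sumy by simp
      then have "(\<Sum>z\<in>V - {?x}. vdist E ?x z) \<le> \<alpha> * (n - 2) \<or> (\<Sum>z\<in>V - {?y}. vdist E ?y z) \<le> \<alpha> * (n - 2)"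
        by linarith
      then have "wien f V E < wmax f \<alpha> n"
        using strict_of_single[OF xy(1) cx] strict_of_single[OF xy(2) cy] by blast
      then show ?thesis by simp
    qed
  qed
qed

end

text \<open>\<open>\<alpha>\<close> is an upper bound for independent sets rather than the
  independence number, so that the hypothesis passes to the graphs left after deletions. Up to order
  \<open>2 * \<alpha>\<close>, removing a single vertex that is not a cut vertex suffices.\<close>

lemma wien_le_wmax:
  assumes cf: "convex_inc f" and \<alpha>2: "2 \<le> \<alpha>"
    and "cgraph V E" "V \<noteq> {}" "\<forall>I. I \<subseteq> V \<longrightarrow> indep E I \<longrightarrow> card I \<le> \<alpha>"
  shows "wien f V E \<le> wmax f \<alpha> (card V) \<and>
    (wien f V E = wmax f \<alpha> (card V) \<longrightarrow> 2 * \<alpha> - 1 \<le> card V \<longrightarrow> (\<exists>pos. dumb_pos V E \<alpha> pos))"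
  using assms(3-5)
proof (induction "card V" arbitrary: V E rule: less_induct)
  case less
  interpret cgraph_f V E f using less.prems(1) cf by (intro cgraph_f.intro)
  have IH: "wien f (V - X) (E \<inter> (V - X) \<times> (V - X)) \<le> wmax f \<alpha> (card V - card X) \<and>
      (wien f (V - X) (E \<inter> (V - X) \<times> (V - X)) = wmax f \<alpha> (card V - card X) \<longrightarrow> 2 * \<alpha> - 1 \<le> card V - card X \<longrightarrow>
        (\<exists>pos. dumb_pos (V - X) (E \<inter> (V - X) \<times> (V - X)) \<alpha> pos))"
    if X: "X \<subseteq> V" "X \<noteq> {}" "card X < card V" "conn_on E (V - X)" for X
  proof -
    have fX: "finite X" using X finite_V finite_subset by blast
    have c: "card (V - X) = card V - card X" using X fX by (simp add: card_Diff_subset)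
    have "0 < card X" using X fX by (simp add: card_gt_0_iff)
    then have lt: "card (V - X) < card V" using c X by simp
    have ne: "V - X \<noteq> {}" using c X(3) by (metis card.empty zero_less_diff less_irrefl)
    have ind: "\<forall>I. I \<subseteq> V - X \<longrightarrow> indep (E \<inter> (V - X) \<times> (V - X)) I \<longrightarrow> card I \<le> \<alpha>"
    proof (intro allI impI)
      fix I assume I: "I \<subseteq> V - X" "indep (E \<inter> (V - X) \<times> (V - X)) I"
      then have "indep E I" unfolding indep_def by blast
      moreover have "I \<subseteq> V" using I by blast
      ultimately show "card I \<le> \<alpha>" using less.prems(3) by blast
    qed
    show ?thesis
      using less.hyps[OF lt cgraph_restrict[OF X(4)] ne ind] unfolding c .
  qed
  have "0 < card V" using less.prems(2) finite_V by (simp add: card_gt_0_iff)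
  then consider "card V = 1" | "2 \<le> card V" "card V \<le> 2 * \<alpha>" | "2 * \<alpha> + 1 \<le> card V" by linarith
  then show ?case
  proof cases
    case 1
    then obtain v where v: "V = {v}" by (auto simp: card_1_singleton_iff)
    have "wien f V E = 0" by (simp add: v wien_def psum_def)
    moreover have "wmax f \<alpha> (card V) = 0" using \<alpha>2 by (simp add: 1 wmax_def single_target_def)
    moreover have "\<not> 2 * \<alpha> - 1 \<le> card V" using 1 \<alpha>2 by simp
    ultimately show ?thesis by (simp only: order_refl simp_thms)
  next
    case 2
    obtain x where x: "x \<in> V" "conn_on E (V - {x})" using ex_noncut[OF 2(1)] by blast
    obtain e where e: "1 \<le> e" "vdist E x ` (V - {x}) = {1..e}" using ecc_profile[OF x(1) 2(1)] by blast
    obtain k where k: "card V = Suc k" using 2 by (cases "card V") auto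
    have IHx: "wien f (V - {x}) (E \<inter> (V - {x}) \<times> (V - {x})) \<le> wmax f \<alpha> k"
      using IH[of "{x}"] x 2 k by simp
    have fin: "finite (V - {x})" and cx: "card (V - {x}) = card V - 1" using finite_V x by auto
    have st: "single_target f \<alpha> (Suc k) = (\<Sum>t=1..<card V. f t)" using 2 k by (simp add: single_target_def)
    note prof = path_profile[OF fin e(2) cx e(1)]
    note rem = wien_remove[OF x]
    have le: "wien f V E \<le> wmax f \<alpha> (card V)"
      using rem IHx prof(1) unfolding k wmax_Suc st[unfolded k] by simp
    have "\<exists>pos. dumb_pos V E \<alpha> pos" if eq: "wien f V E = wmax f \<alpha> (card V)" and big: "2 * \<alpha> - 1 \<le> card V"
    proof -
      have "e = card V - 1"
        using prof(2) rem IHx eq unfolding k wmax_Suc st[unfolded k] by force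
      then have im: "vdist E x ` (V - {x}) = {1..card V - 1}" using e by simp
      have "card V = 2 * \<alpha> - 1 \<or> card V = 2 * \<alpha>" using big 2 by linarith
      then show ?thesis using geodesic_dumb_pos[OF x(1) im refl _ \<alpha>2] by blast
    qed
    then show ?thesis using le by blast
  next
    case 3
    interpret extremal_setup V E f \<alpha> "card V"
    proof (intro extremal_setup.intro extremal_setup_axioms.intro)
      show "cgraph_f V E f" by unfold_locales
    qed (rule \<alpha>2 refl 3 less.prems(3) IH; assumption?)+
    show ?thesis using extremal_step by blast
  qed
qed

subsection \<open>The Wiener index of a dumbbell\<close>

text \<open>One of the truncated differences is 0, so their sum is the absolute difference. The
  maximum with 1 accounts for two different clique vertices in the same position.\<close>

definition pos_dist :: "nat \<Rightarrow> nat \<Rightarrow> nat" where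
  "pos_dist a b = max 1 ((a - b) + (b - a))"

lemma psum_path:
  assumes "finite W" "inj_on pos W" "pos ` W = {..<k}" "k \<le> 2 * \<alpha>"
  shows "psum (\<lambda>u v. f (pos_dist (pos u) (pos v))) W = wmax f \<alpha> k"
  using assms
proof (induction k arbitrary: W)
  case 0
  then show ?case by (simp add: psum_def wmax_def)
next
  case (Suc k)
  let ?g = "\<lambda>u v. f (pos_dist (pos u) (pos v))"
  have "k \<in> pos ` W" using Suc.prems by auto
  then obtain x where x: "k = pos x" "x \<in> W" by (rule imageE)
  have im: "pos ` (W - {x}) = {..<k}"
  proof -
    have "pos ` (W - {x}) = pos ` W - pos ` {x}" using Suc.prems(2) x(2) by (intro inj_on_image_set_diff[of _ W]) auto
    also have "\<dots> = {..<Suc k} - {k}" using Suc.prems(3) x(1) by simp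
    also have "\<dots> = {..<k}" by auto
    finally show ?thesis .
  qed
  have inj: "inj_on pos (W - {x})" using Suc.prems(2) by (rule inj_on_subset) auto
  have "psum ?g W = psum ?g (W - {x}) + (\<Sum>v\<in>W - {x}. ?g x v)"
    using Suc.prems x by (intro psum_remove) (auto simp: pos_dist_def add.commute)
  also have "psum ?g (W - {x}) = wmax f \<alpha> k"
    using Suc.prems im inj by (intro Suc.IH) auto
  also have "(\<Sum>v\<in>W - {x}. ?g x v) = (\<Sum>i<k. f (pos_dist k i))"
    unfolding x(1)[symmetric] im[symmetric] using inj by (simp add: sum.reindex)
  also have "\<dots> = (\<Sum>i<k. f (k - i))"
    by (intro sum.cong) (auto simp: pos_dist_def max_def)
  also have "\<dots> = (\<Sum>t=1..<Suc k. f t)"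
    by (rule sum.reindex_bij_witness[of _ "\<lambda>t. k - t" "\<lambda>i. k - i"]) auto
  also have "\<dots> = single_target f \<alpha> (Suc k)" using Suc.prems by (simp add: single_target_def)
  finally show ?case by (simp add: wmax_Suc)
qed

lemma sum_over_fibres:
  fixes F :: "nat \<Rightarrow> real"
  assumes "finite W" "\<And>v. v \<in> W \<Longrightarrow> pos v \<le> m"
  shows "(\<Sum>v\<in>W. F (pos v)) = (\<Sum>i\<le>m. real (card {v \<in> W. pos v = i}) * F i)"
proof -
  have "(\<Sum>v\<in>W. F (pos v)) = (\<Sum>i\<le>m. \<Sum>v\<in>{v \<in> W. pos v = i}. F (pos v))"
    using assms by (intro sum.group[symmetric]) auto
  also have "\<dots> = (\<Sum>i\<le>m. real (card {v \<in> W. pos v = i}) * F i)"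
    by (intro sum.cong) auto
  finally show ?thesis .
qed

text \<open>Vertices are deleted one at a time from the ends until a path of order
  \<open>2 * \<alpha> - 1\<close> is left; each deletion removes exactly one summand
  \<open>single_target\<close> of \<open>wmax\<close>.\<close>

lemma psum_dumbbell:
  assumes "2 \<le> \<alpha>" "finite W" "2 * \<alpha> - 1 \<le> card W" "\<And>v. v \<in> W \<Longrightarrow> pos v \<le> 2 * \<alpha> - 1"
    and "\<And>i. 1 \<le> i \<Longrightarrow> i \<le> 2 * \<alpha> - 2 \<Longrightarrow> card {v \<in> W. pos v = i} = 1"
    and "card {v \<in> W. pos v = 0} = (card W + 1) div 2 + 1 - \<alpha>"
    and "card {v \<in> W. pos v = 2 * \<alpha> - 1} = card W div 2 + 1 - \<alpha>"
  shows "psum (\<lambda>u v. f (pos_dist (pos u) (pos v))) W = wmax f \<alpha> (card W)"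
  using assms(2-)
proof (induction "card W" arbitrary: W rule: less_induct)
  case less
  let ?g = "\<lambda>u v. f (pos_dist (pos u) (pos v))"
  let ?m = "2 * \<alpha> - 1"
  define N where "N = card W"
  note L = less.prems[folded N_def]
  show ?case
  proof (cases "N = ?m")
    case True
    have c0: "card {v \<in> W. pos v = 0} = 1" and cm: "card {v \<in> W. pos v = ?m} = 0"
      using L(5,6) True assms(1) by auto
    have "{v \<in> W. pos v = ?m} = {}" using cm L(1) by simp
    then have lt: "pos v < ?m" if "v \<in> W" for v using L(3)[OF that] that by (metis (mono_tags, lifting) empty_iff le_neq_implies_less mem_Collect_eq)
    have one: "card {v \<in> W. pos v = i} = 1" if "i < ?m" for i
      using c0 L(4)[of i] that by (cases "i = 0") auto
    have im: "pos ` W = {..<?m}"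
    proof
      show "pos ` W \<subseteq> {..<?m}" using lt by auto
      show "{..<?m} \<subseteq> pos ` W"
      proof
        fix i assume "i \<in> {..<?m}"
        then have "card {v \<in> W. pos v = i} = 1" using one by simp
        then obtain v where "{v \<in> W. pos v = i} = {v}" by (auto simp: card_1_singleton_iff)
        then have "v \<in> W" "pos v = i" by blast+
        then show "i \<in> pos ` W" by blast
      qed
    qed
    moreover have "inj_on pos W" using im L(1) True N_def by (intro eq_card_imp_inj_on) auto
    ultimately have "psum ?g W = wmax f \<alpha> ?m" using L(1) by (intro psum_path) auto
    then show ?thesis using True N_def by simp
  next
    case False
    then have N: "2 * \<alpha> \<le> N" using L(2) by simp
    \<comment> \<open>The end fibre whose size drops when the order decreases from \<open>N\<close>
      to \<open>N - 1\<close>, so that the remaining fibres again have the prescribed sizes.\<close>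
    define y where "y = (if even N then ?m else 0)"
    have "card {v \<in> W. pos v = y} \<noteq> 0"
      using L(5,6) N by (auto simp: y_def)
    then have "{v \<in> W. pos v = y} \<noteq> {}" by (metis card.empty)
    then obtain x where x: "x \<in> W" "pos x = y" by blast
    obtain k where k: "N = Suc k" using N assms(1) by (cases N) auto
    have cW: "card (W - {x}) = k" using x k L(1) by (simp add: N_def[symmetric])
    have fib: "card {v \<in> W - {x}. pos v = i} = card {v \<in> W. pos v = i} - (if i = y then 1 else 0)" for i
    proof (cases "i = y")
      case True
      have "{v \<in> W - {x}. pos v = i} = {v \<in> W. pos v = i} - {x}" by auto
      then show ?thesis using True x L(1) by simp
    next
      case False
      then have "{v \<in> W - {x}. pos v = i} = {v \<in> W. pos v = i}" using x by auto
      then show ?thesis using False by simp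
    qed
    have y_ends: "y = 0 \<or> y = ?m" by (simp add: y_def)
    have mid: "card {v \<in> W - {x}. pos v = i} = 1" if "1 \<le> i" "i \<le> 2 * \<alpha> - 2" for i
      unfolding fib using L(4)[OF that] y_ends that by auto
    have c0: "card {v \<in> W - {x}. pos v = 0} = (k + 1) div 2 + 1 - \<alpha>"
      and cm: "card {v \<in> W - {x}. pos v = ?m} = k div 2 + 1 - \<alpha>"
      unfolding fib using L(5,6) assms(1) N k by (auto simp: y_def elim!: evenE oddE)
    have "psum ?g W = psum ?g (W - {x}) + (\<Sum>v\<in>W - {x}. ?g x v)"
      using L(1) x by (intro psum_remove) (auto simp: pos_dist_def add.commute)
    also have "psum ?g (W - {x}) = wmax f \<alpha> k"
    proof -
      have "psum ?g (W - {x}) = wmax f \<alpha> (card (W - {x}))"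
      proof (rule less.hyps)
        show "card (W - {x}) < card W" using cW k N_def by simp
        show "finite (W - {x})" using L(1) by simp
        show "?m \<le> card (W - {x})" using cW k N by simp
        show "pos v \<le> ?m" if "v \<in> W - {x}" for v using L(3) that by blast
      qed (use mid c0 cm cW in simp_all)
      then show ?thesis using cW by simp
    qed
    also have "(\<Sum>v\<in>W - {x}. ?g x v) = single_target f \<alpha> N"
    proof -
      have "(\<Sum>v\<in>W - {x}. ?g x v) = (\<Sum>i\<le>?m. real (card {v \<in> W - {x}. pos v = i}) * f (pos_dist y i))"
        unfolding x(2) using L by (intro sum_over_fibres[where F = "\<lambda>i. f (pos_dist y i)"]) auto
      also have "{..?m} = insert 0 (insert ?m {1..2 * \<alpha> - 2})" using assms(1) by auto
      also have "(\<Sum>i\<in>\<dots>. real (card {v \<in> W - {x}. pos v = i}) * f (pos_dist y i))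
          = real (card {v \<in> W - {x}. pos v = 0}) * f (pos_dist y 0)
          + (real (card {v \<in> W - {x}. pos v = ?m}) * f (pos_dist y ?m)
          + (\<Sum>i\<in>{1..2 * \<alpha> - 2}. real (card {v \<in> W - {x}. pos v = i}) * f (pos_dist y i)))"
        using assms(1) by (subst sum.insert, simp, simp, subst sum.insert) auto
      also have "(\<Sum>i\<in>{1..2 * \<alpha> - 2}. real (card {v \<in> W - {x}. pos v = i}) * f (pos_dist y i))
          = (\<Sum>i\<in>{1..2 * \<alpha> - 2}. f (pos_dist y i))"
        using mid by (intro sum.cong) auto
      also have "\<dots> = (\<Sum>i\<in>{1..2 * \<alpha> - 2}. f i)"
      proof (cases "even N")
        case True
        have "(\<Sum>i\<in>{1..2 * \<alpha> - 2}. f (pos_dist y i)) = (\<Sum>i\<in>{1..2 * \<alpha> - 2}. f (?m - i))"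
          using True by (intro sum.cong) (auto simp: y_def pos_dist_def max_def)
        also have "\<dots> = (\<Sum>i\<in>{1..2 * \<alpha> - 2}. f i)"
          by (rule sum.reindex_bij_witness[of _ "\<lambda>t. ?m - t" "\<lambda>i. ?m - i"]) auto
        finally show ?thesis .
      next
        case False
        then show ?thesis by (intro sum.cong) (auto simp: y_def pos_dist_def max_def)
      qed
      finally have eq: "(\<Sum>v\<in>W - {x}. ?g x v) = real ((k + 1) div 2 + 1 - \<alpha>) * f (pos_dist y 0)
          + (real (k div 2 + 1 - \<alpha>) * f (pos_dist y ?m) + (\<Sum>i\<in>{1..2 * \<alpha> - 2}. f i))"
        unfolding c0 cm .
      have sm: "(\<Sum>i\<in>{1..?m}. f i) = (\<Sum>i\<in>{1..2 * \<alpha> - 2}. f i) + f ?m"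
      proof -
        have "{1..?m} = insert ?m {1..2 * \<alpha> - 2}" using assms(1) by auto
        moreover have "?m \<notin> {1..2 * \<alpha> - 2}" using assms(1) by auto
        ultimately show ?thesis by (simp add: add.commute)
      qed
      show ?thesis
      proof (cases "even N")
        case True
        then obtain j where j: "N = 2 * j" by (rule evenE)
        have d: "pos_dist y 0 = ?m" "pos_dist y ?m = 1" using True assms(1) by (auto simp: y_def pos_dist_def)
        have c: "(k + 1) div 2 + 1 - \<alpha> = Suc (j - \<alpha>)" "k div 2 + 1 - \<alpha> = j - \<alpha>"
          "(N + 1) div 2 - \<alpha> = j - \<alpha>" "N div 2 - \<alpha> = j - \<alpha>"
          using j k N by auto
        have "single_target f \<alpha> N = (\<Sum>t=1..?m. f t) + real (j - \<alpha>) * f 1 + real (j - \<alpha>) * f ?m"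
          using single_target_big[OF N, of f] assms(1) c by simp
        then show ?thesis unfolding eq d c sm by (simp add: algebra_simps)
      next
        case False
        then obtain j where j: "N = 2 * j + 1" by (rule oddE)
        have d: "pos_dist y 0 = 1" "pos_dist y ?m = ?m" using False assms(1) by (auto simp: y_def pos_dist_def)
        have c: "(k + 1) div 2 + 1 - \<alpha> = Suc j - \<alpha>" "k div 2 + 1 - \<alpha> = Suc (j - \<alpha>)"
          "(N + 1) div 2 - \<alpha> = Suc j - \<alpha>" "N div 2 - \<alpha> = j - \<alpha>"
          using j k N by auto
        have "single_target f \<alpha> N = (\<Sum>t=1..?m. f t) + real (Suc j - \<alpha>) * f 1 + real (j - \<alpha>) * f ?m"
          using single_target_big[OF N, of f] assms(1) c by simp
        then show ?thesis unfolding eq d c sm by (simp add: algebra_simps)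
      qed
    qed
    finally show ?thesis using k N_def by (simp add: wmax_Suc)
  qed
qed

lemma dumb_pos_cgraph:
  assumes "sgraph V E" "dumb_pos V E \<alpha> pos" "2 \<le> \<alpha>"
  shows "cgraph V E"
proof -
  interpret sgraph V E by fact
  have adj: "\<And>u v. u \<in> V \<Longrightarrow> v \<in> V \<Longrightarrow> (u, v) \<in> E \<longleftrightarrow> u \<noteq> v \<and> pos u \<le> Suc (pos v) \<and> pos v \<le> Suc (pos u)"
    and fib: "\<And>i. 1 \<le> i \<Longrightarrow> i \<le> 2 * \<alpha> - 2 \<Longrightarrow> card {v \<in> V. pos v = i} = 1"
    and bnd: "\<And>v. v \<in> V \<Longrightarrow> pos v \<le> 2 * \<alpha> - 1"
    using assms(2) by (auto simp: dumb_pos_def)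
  have ex: "\<exists>v. v \<in> V \<and> pos v = i" if i: "1 \<le> i" "i \<le> 2 * \<alpha> - 2" for i
  proof -
    obtain v where "{v \<in> V. pos v = i} = {v}" using fib[OF i] by (auto simp: card_1_singleton_iff)
    then show ?thesis by blast
  qed
  have "1 \<le> 2 * \<alpha> - 2" using assms(3) by simp
  then obtain c where c: "c \<in> V" "pos c = 1" using ex[of 1] by blast
  have "(c, v) \<in> (E \<inter> V \<times> V)\<^sup>*" if "v \<in> V" for v
    using that
  proof (induction "pos v" arbitrary: v rule: less_induct)
    case less
    show ?case
    proof (cases "pos v \<le> 2")
      case True
      then show ?thesis using adj[OF c(1) less.prems] c less.prems by (cases "c = v") auto
    next
      case False
      then have "1 \<le> pos v - 1" "pos v - 1 \<le> 2 * \<alpha> - 2" using bnd[OF less.prems] by simp_all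
      then obtain u where u: "u \<in> V" "pos u = pos v - 1" using ex by blast
      then have "(u, v) \<in> E" using adj[OF u(1) less.prems] False by auto
      then have "(u, v) \<in> E \<inter> V \<times> V" using u less.prems by simp
      moreover have "(c, u) \<in> (E \<inter> V \<times> V)\<^sup>*" using less.hyps[of u] u False by simp
      ultimately show ?thesis by (rule rtrancl_into_rtrancl[rotated])
    qed
  qed
  then have "conn_on E V" using sym_E c by (intro conn_onI_root[of E c])
  then show ?thesis by unfold_locales
qed

text \<open>Positions change by at most one along an edge, so a distance is at least the difference
  of the positions. This inequality is enough, as \<open>wien_le_wmax\<close> bounds the competing
  graphs by the same number.\<close>

lemma wmax_le_wien:
  assumes f: "convex_inc f" and \<alpha>: "2 \<le> \<alpha>" and G: "sgraph V E" and d: "dumb_pos V E \<alpha> pos" and n: "2 * \<alpha> - 1 \<le> card V"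
  shows "wmax f \<alpha> (card V) \<le> wien f V E"
proof -
  interpret cgraph V E using dumb_pos_cgraph[OF G d \<alpha>] .
  interpret convex_inc f by fact
  have lip: "pos u \<le> pos v + k \<and> pos v \<le> pos u + k" if "(u, v) \<in> E ^^ k" for u v k
    using that
  proof (induction k arbitrary: v)
    case (Suc k)
    then obtain w where w: "(u, w) \<in> E ^^ k" "(w, v) \<in> E" by auto
    then have "pos w \<le> Suc (pos v) \<and> pos v \<le> Suc (pos w)" using d E_sub by (auto simp: dumb_pos_def)
    then show ?case using Suc.IH[OF w(1)] by linarith
  qed simp
  have "wmax f \<alpha> (card V) = psum (\<lambda>u v. f (pos_dist (pos u) (pos v))) V"
    using d n finite_V \<alpha> by (intro psum_dumbbell[symmetric]) (auto simp: dumb_pos_def)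
  also have "\<dots> \<le> wien f V E"
    unfolding wien_def
  proof (intro psum_mono f_le)
    fix u v assume uv: "u \<in> V" "v \<in> V" "u \<noteq> v"
    show "1 \<le> pos_dist (pos u) (pos v)" by (simp add: pos_dist_def)
    show "pos_dist (pos u) (pos v) \<le> vdist E u v"
      using lip[OF vdist_walk[OF uv(1,2)]] vdist_ge_1[OF uv] by (auto simp: pos_dist_def)
  qed
  finally show ?thesis .
qed

subsection \<open>Pair graphs and isomorphisms\<close>

lemma awalk_iff_relpow:
  assumes "pair_graph G" "u \<in> pverts G"
  shows "(\<exists>p. pre_digraph.awalk (with_proj G) u p v \<and> length p = k) \<longleftrightarrow> (u, v) \<in> parcs G ^^ k"
  using assms(2)
proof (induction k arbitrary: u)
  case 0
  then show ?case by (auto simp: pre_digraph.awalk_def cas_with_proj_eq)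
next
  case (Suc k)
  interpret pair_graph G by fact
  have step: "(\<exists>p. pre_digraph.awalk (with_proj G) u p v \<and> length p = Suc k)
      \<longleftrightarrow> (\<exists>w. (u, w) \<in> parcs G \<and> (\<exists>p. pre_digraph.awalk (with_proj G) w p v \<and> length p = k))"
  proof
    assume "\<exists>p. pre_digraph.awalk (with_proj G) u p v \<and> length p = Suc k"
    then obtain p where p: "pre_digraph.awalk (with_proj G) u p v" "length p = Suc k" by blast
    then obtain a q where q: "p = a # q" "length q = k" by (cases p) auto
    then show "\<exists>w. (u, w) \<in> parcs G \<and> (\<exists>p. pre_digraph.awalk (with_proj G) w p v \<and> length p = k)"
      using p by (cases a) (auto simp: pre_digraph.awalk_def cas_with_proj_eq intro: in_arcsD2)
  next
    assume "\<exists>w. (u, w) \<in> parcs G \<and> (\<exists>p. pre_digraph.awalk (with_proj G) w p v \<and> length p = k)"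
    then obtain w p where w: "(u, w) \<in> parcs G" "pre_digraph.awalk (with_proj G) w p v" "length p = k" by blast
    then show "\<exists>p. pre_digraph.awalk (with_proj G) u p v \<and> length p = Suc k"
      using Suc.prems by (intro exI[of _ "(u, w) # p"]) (auto simp: pre_digraph.awalk_def cas_with_proj_eq)
  qed
  have "(u, v) \<in> parcs G ^^ Suc k \<longleftrightarrow> (\<exists>w. (u, w) \<in> parcs G \<and> (w, v) \<in> parcs G ^^ k)"
    by (meson relpow_Suc_D2 relpow_Suc_I2)
  then show ?case unfolding step using Suc.IH in_arcsD2 by blast
qed

lemma graph_dist_eq_vdist:
  assumes "pair_graph G" "u \<in> pverts G"
  shows "graph_dist G u v = vdist (parcs G) u v"
  unfolding graph_dist_def sdist_def using awalk_iff_relpow[OF assms, of v] by simp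

lemma wiener_eq_wien:
  assumes "pair_graph G"
  shows "wiener f G = wien (\<lambda>t. f (real t)) (pverts G) (parcs G)"
  unfolding wiener_def wien_def psum_def using graph_dist_eq_vdist[OF assms]
  by (simp cong: sum.cong)

lemma pair_graph_sgraph:
  assumes "pair_graph G"
  shows "sgraph (pverts G) (parcs G)"
proof -
  interpret pair_graph G by fact
  have "sym (parcs G)" using sym_arcs by (simp add: symmetric_def)
  moreover have "(u, u) \<notin> parcs G" for u using no_loops' by blast
  ultimately show ?thesis
    using in_arcsD1 in_arcsD2 by unfold_locales auto
qed

lemma connected_cgraph:
  assumes "pair_graph G" "Digraph_Component.connected (with_proj G)"
  shows "cgraph (pverts G) (parcs G)" "pverts G \<noteq> {}"
proof -
  interpret pg: pair_graph G by fact
  interpret sgraph "pverts G" "parcs G" by (rule pair_graph_sgraph) fact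
  \<comment> \<open>Connectedness is defined through the symmetric closure, which changes nothing
    for a symmetric graph.\<close>
  have arcs: "parcs (mk_symmetric (with_proj G)) = parcs G"
    using pg.adj_mk_symmetric_eq pg.sym_arcs by simp
  have sc: "strongly_connected (with_proj (mk_symmetric (with_proj G)))"
    using assms(2) by (simp add: connected_def)
  then show "pverts G \<noteq> {}" by (simp add: strongly_connected_def)
  have "(u, v) \<in> (parcs G)\<^sup>*" if "u \<in> pverts G" "v \<in> pverts G" for u v
  proof -
    have "u \<rightarrow>\<^sup>*\<^bsub>with_proj (mk_symmetric (with_proj G))\<^esub> v"
      using sc that by (simp add: strongly_connected_def)
    then show ?thesis
      using arcs by (auto simp: reachable_def dest: rtrancl_on_rtranclI)
  qed
  moreover have "parcs G \<inter> pverts G \<times> pverts G = parcs G" using E_sub by blast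
  ultimately show "cgraph (pverts G) (parcs G)"
    by unfold_locales (simp add: conn_on_def)
qed

lemma independence_number_ge:
  assumes "finite (pverts G)" "I \<subseteq> pverts G" "indep (parcs G) I"
  shows "card I \<le> independence_number G"
  unfolding independence_number_def
proof (rule Max_ge)
  have "{card S |S. independent_set G S} \<subseteq> card ` Pow (pverts G)"
    by (auto simp: independent_set_def)
  then show "finite {card S |S. independent_set G S}"
    by (rule finite_subset) (simp add: assms(1))
  show "card I \<in> {card S |S. independent_set G S}"
    using assms(2,3) by (auto simp: independent_set_def indep_def)
qed

section \<open>Isomorphisms between dumbbells and invariance of the index\<close>

lemma fibrewise_bij:
  fixes a :: "'a \<Rightarrow> nat" and b :: "'b \<Rightarrow> nat"
  assumes "finite V" "finite W" "\<And>i. card {v \<in> V. a v = i} = card {w \<in> W. b w = i}"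
  shows "\<exists>h. bij_betw h V W \<and> (\<forall>v\<in>V. b (h v) = a v)"
proof -
  have "\<exists>h. bij_betw h {v \<in> V. a v = i} {w \<in> W. b w = i}" for i
    using assms by (intro finite_same_card_bij) auto
  then obtain g where g: "\<And>i. bij_betw (g i) {v \<in> V. a v = i} {w \<in> W. b w = i}" by metis
  define h where "h = (\<lambda>v. g (a v) v)"
  have h: "h v \<in> W" "b (h v) = a v" if "v \<in> V" for v
  proof -
    have "g (a v) v \<in> {w \<in> W. b w = a v}"
      using bij_betw_apply[OF g[of "a v"], of v] that by simp
    then show "h v \<in> W" "b (h v) = a v" by (simp_all add: h_def)
  qed
  have "inj_on h V"
  proof (rule inj_onI)
    fix u v assume uv: "u \<in> V" "v \<in> V" "h u = h v"
    then have "a u = a v" using h by metis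
    then show "u = v"
      using uv bij_betw_imp_inj_on[OF g[of "a v"]] by (auto simp: h_def inj_on_def)
  qed
  moreover have "h ` V = W"
  proof
    show "h ` V \<subseteq> W" using h by blast
    show "W \<subseteq> h ` V"
    proof
      fix w assume "w \<in> W"
      then have "w \<in> g (b w) ` {v \<in> V. a v = b w}"
        using bij_betw_imp_surj_on[OF g[of "b w"]] by blast
      then obtain v where v: "v \<in> V" "a v = b w" "w = g (b w) v" by blast
      have "h v = g (b w) v" by (simp add: h_def v(2))
      then have "h v = w" using v(3) by (rule trans[OF _ sym])
      then show "w \<in> h ` V" using v(1) by blast
    qed
  qed
  ultimately show ?thesis using h by (auto simp: bij_betw_def)
qed

lemma dumb_pos_fibre:
  assumes "dumb_pos V E \<alpha> pos" "2 \<le> \<alpha>"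
  shows "card {v \<in> V. pos v = i} = (if i = 0 then (card V + 1) div 2 + 1 - \<alpha>
    else if i \<le> 2 * \<alpha> - 2 then 1 else if i = 2 * \<alpha> - 1 then card V div 2 + 1 - \<alpha> else 0)"
proof -
  consider "i = 0" | "1 \<le> i" "i \<le> 2 * \<alpha> - 2" | "i = 2 * \<alpha> - 1" | "2 * \<alpha> - 1 < i" by linarith
  then show ?thesis
  proof cases
    case 4
    have "pos v \<le> 2 * \<alpha> - 1" if "v \<in> V" for v using assms(1) that by (simp add: dumb_pos_def)
    then have "{v \<in> V. pos v = i} = {}" using 4 by fastforce
    then show ?thesis using 4 by (simp only: card.empty) simp
  qed (use assms in \<open>auto simp: dumb_pos_def\<close>)
qed

text \<open>The order and \<open>\<alpha>\<close> determine the sizes of all fibres, and positions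
  determine adjacency. Any bijection that preserves positions is thus an isomorphism.\<close>

lemma dumb_pos_iso:
  assumes G: "pair_graph G" and H: "pair_graph H" and \<alpha>: "2 \<le> \<alpha>"
    and dG: "dumb_pos (pverts G) (parcs G) \<alpha> a" and dH: "dumb_pos (pverts H) (parcs H) \<alpha> b"
    and n: "card (pverts G) = card (pverts H)"
  shows "digraph_iso (with_proj G) (with_proj H)"
proof -
  interpret G: pair_graph G by fact
  interpret H: pair_graph H by fact
  have "card {v \<in> pverts G. a v = i} = card {v \<in> pverts H. b v = i}" for i
    unfolding dumb_pos_fibre[OF dG \<alpha>] dumb_pos_fibre[OF dH \<alpha>] n ..
  then obtain h where h: "bij_betw h (pverts G) (pverts H)" "\<forall>v\<in>pverts G. b (h v) = a v"
    using fibrewise_bij[OF G.finite_verts H.finite_verts] by (metis (full_types) with_proj_simps(1))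
  have inj: "inj_on h (pverts G)" and im: "h ` pverts G = pverts H" using h(1) by (auto simp: bij_betw_def)
  have arc: "(h u, h v) \<in> parcs H \<longleftrightarrow> (u, v) \<in> parcs G" if uv: "u \<in> pverts G" "v \<in> pverts G" for u v
  proof -
    have "h u \<in> pverts H" "h v \<in> pverts H" using im uv by auto
    then have "(h u, h v) \<in> parcs H \<longleftrightarrow> h u \<noteq> h v \<and> b (h u) \<le> Suc (b (h v)) \<and> b (h v) \<le> Suc (b (h u))"
      using dH by (auto simp: dumb_pos_def)
    also have "\<dots> \<longleftrightarrow> u \<noteq> v \<and> a u \<le> Suc (a v) \<and> a v \<le> Suc (a u)"
      using h(2) uv inj by (auto simp: inj_on_def)
    also have "\<dots> \<longleftrightarrow> (u, v) \<in> parcs G" using dG uv by (auto simp: dumb_pos_def)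
    finally show ?thesis .
  qed
  define hom where "hom = \<lparr> iso_verts = h, iso_arcs = map_prod h h, iso_head = snd, iso_tail = fst \<rparr>"
  have "pre_digraph.digraph_isomorphism (with_proj G) hom"
    unfolding pre_digraph.digraph_isomorphism_def
  proof (intro conjI ballI)
    show "wf_digraph (with_proj G)" by unfold_locales
    show "inj_on (iso_verts hom) (verts (with_proj G))" using inj by (simp add: hom_def)
    have "inj_on (map_prod h h) (pverts G \<times> pverts G)" using inj by (intro map_prod_inj_on)
    then show "inj_on (iso_arcs hom) (arcs (with_proj G))"
      using G.in_arcsD1 G.in_arcsD2 by (auto simp: hom_def intro: inj_on_subset)
  qed (auto simp: hom_def)
  moreover have "with_proj H = app_iso hom (with_proj G)"
  proof -
    have "parcs H = map_prod h h ` parcs G"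
    proof
      show "parcs H \<subseteq> map_prod h h ` parcs G"
      proof
        fix e assume e: "e \<in> parcs H"
        obtain u' v' where e': "e = (u', v')" by (cases e)
        then have "u' \<in> h ` pverts G" "v' \<in> h ` pverts G" using e im H.in_arcsD1 H.in_arcsD2 by auto
        then obtain u v where "u \<in> pverts G" "v \<in> pverts G" "u' = h u" "v' = h v" by blast
        then show "e \<in> map_prod h h ` parcs G" using e e' arc[of u v] by force
      qed
      show "map_prod h h ` parcs G \<subseteq> parcs H" using arc G.in_arcsD1 G.in_arcsD2 by auto
    qed
    then show ?thesis using im by (simp add: app_iso_def with_proj_def hom_def)
  qed
  ultimately show ?thesis unfolding digraph_iso_def by blast
qed

lemma vdist_iso:
  assumes inj: "inj_on h V" and E: "E \<subseteq> V \<times> V" and u: "u \<in> V" and v: "v \<in> V"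
  shows "vdist (map_prod h h ` E) (h u) (h v) = vdist E u v"
proof -
  have "(h u, w) \<in> (map_prod h h ` E) ^^ k \<longleftrightarrow> (\<exists>v\<in>V. w = h v \<and> (u, v) \<in> E ^^ k)" for k w
  proof (induction k arbitrary: w)
    case 0
    then show ?case using u by auto
  next
    case (Suc k)
    show ?case
    proof
      assume "(h u, w) \<in> (map_prod h h ` E) ^^ Suc k"
      then obtain y where y: "(h u, y) \<in> (map_prod h h ` E) ^^ k" "(y, w) \<in> map_prod h h ` E" by auto
      obtain z where z: "z \<in> V" "y = h z" "(u, z) \<in> E ^^ k" using y(1) Suc.IH by blast
      obtain z' t where t: "(z', t) \<in> E" "y = h z'" "w = h t" using y(2) by auto
      have "z' = z" using t z E inj by (auto dest: inj_onD)
      then show "\<exists>v\<in>V. w = h v \<and> (u, v) \<in> E ^^ Suc k" using t z E by auto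
    next
      assume "\<exists>v\<in>V. w = h v \<and> (u, v) \<in> E ^^ Suc k"
      then obtain v z where v: "w = h v" "(u, z) \<in> E ^^ k" "(z, v) \<in> E" by auto
      then have "(h u, h z) \<in> (map_prod h h ` E) ^^ k" using Suc.IH[of "h z"] E by auto
      moreover have "(h z, w) \<in> map_prod h h ` E" using v by force
      ultimately show "(h u, w) \<in> (map_prod h h ` E) ^^ Suc k" by auto
    qed
  qed
  then have "(h u, h v) \<in> (map_prod h h ` E) ^^ k \<longleftrightarrow> (u, v) \<in> E ^^ k" for k
    using inj v by (auto dest: inj_onD)
  then show ?thesis by (simp add: sdist_def)
qed

lemma wiener_iso:
  assumes G: "pair_graph G" and H: "pair_graph H" and iso: "digraph_iso (with_proj G) (with_proj H)"
  shows "wiener f G = wiener f H"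
proof -
  interpret G: pair_graph G by fact
  obtain hom where hom: "pre_digraph.digraph_isomorphism (with_proj G) hom" "with_proj H = app_iso hom (with_proj G)"
    using iso by (auto simp: digraph_iso_def)
  define h where "h = iso_verts hom"
  have inj: "inj_on h (pverts G)" using hom(1) by (simp add: pre_digraph.digraph_isomorphism_def h_def)
  have vH: "pverts H = h ` pverts G" and aH: "parcs H = iso_arcs hom ` parcs G"
    and t: "iso_tail hom = fst" "iso_head hom = snd"
    using hom(2) by (auto simp: app_iso_def with_proj_def h_def)
  have "iso_arcs hom (u, v) = (h u, h v)" if "(u, v) \<in> parcs G" for u v
  proof -
    have "h u = fst (iso_arcs hom (u, v))" "h v = snd (iso_arcs hom (u, v))"
      using hom(1) that t by (auto simp: pre_digraph.digraph_isomorphism_def h_def)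
    then show ?thesis by simp
  qed
  then have "parcs H = map_prod h h ` parcs G" unfolding aH by (intro image_cong) auto
  moreover have "parcs G \<subseteq> pverts G \<times> pverts G" using G.in_arcsD1 G.in_arcsD2 by auto
  ultimately have d: "vdist (parcs H) (h u) (h v) = vdist (parcs G) u v" if "u \<in> pverts G" "v \<in> pverts G" for u v
    using vdist_iso[OF inj _ that] by simp
  have "(\<Sum>u'\<in>pverts H. \<Sum>v'\<in>pverts H - {u'}. f (real (vdist (parcs H) u' v')))
      = (\<Sum>u\<in>pverts G. \<Sum>v'\<in>pverts H - {h u}. f (real (vdist (parcs H) (h u) v')))"
    unfolding vH using inj by (simp add: sum.reindex)
  also have "\<dots> = (\<Sum>u\<in>pverts G. \<Sum>v\<in>pverts G - {u}. f (real (vdist (parcs G) u v)))"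
  proof (rule sum.cong[OF refl])
    fix u assume u: "u \<in> pverts G"
    have im: "pverts H - {h u} = h ` (pverts G - {u})"
      using inj u unfolding vH by (auto dest: inj_onD)
    have inj': "inj_on h (pverts G - {u})" using inj by (rule inj_on_subset) auto
    show "(\<Sum>v'\<in>pverts H - {h u}. f (real (vdist (parcs H) (h u) v'))) = (\<Sum>v\<in>pverts G - {u}. f (real (vdist (parcs G) u v)))"
      unfolding im using inj' d u by (simp add: sum.reindex)
  qed
  finally show ?thesis
    by (simp add: wiener_eq_wien[OF G] wiener_eq_wien[OF H] wien_def psum_def)
qed

text \<open>Here \<open>c\<close> is the last vertex of the first clique and \<open>c + l\<close>
  the first vertex of the second, the two ends of the connecting path. They receive positions
  \<open>1\<close> and \<open>l + 1\<close>, which leaves \<open>0\<close> and \<open>l + 2\<close>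
  for the other clique vertices.\<close>

lemma dumbbell_position_adjacent:
  fixes c l u v :: nat and pos :: "nat \<Rightarrow> nat"
  assumes l: "1 \<le> l" and uv: "u < v"
   and pos: "\<And>u. pos u = (if u < c then 0 else if u \<le> c + l then Suc (u - c) else l + 2)"
  shows "pos u \<le> Suc (pos v)"
    and "v \<le> c \<or> c + l \<le> u \<or> v = Suc u \<and> c \<le> u \<and> u < c + l \<longleftrightarrow> pos v \<le> Suc (pos u)"
proof -
  show "pos u \<le> Suc (pos v)" using uv l unfolding pos by auto
  consider (a) "u < c" | (b) "c \<le> u" "u < c + l" | (c) "c + l \<le> u" by linarith
  then show "v \<le> c \<or> c + l \<le> u \<or> v = Suc u \<and> c \<le> u \<and> u < c + l \<longleftrightarrow> pos v \<le> Suc (pos u)"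
  proof cases
    case a
    then have "pos u = 0" by (simp add: pos)
    moreover have "pos v \<le> 1 \<longleftrightarrow> v \<le> c" using l by (auto simp: pos)
    ultimately show ?thesis using a uv by auto
  next
    case b
    then have "pos u = Suc (u - c)" by (simp add: pos)
    moreover have "pos v \<le> Suc (Suc (u - c)) \<longleftrightarrow> v = Suc u" using b uv by (auto simp: pos)
    ultimately show ?thesis using b uv by auto
  next
    case c
    then have "l + 1 \<le> pos u" by (auto simp: pos)
    moreover have "pos v = l + 2" using c uv by (simp add: pos)
    ultimately show ?thesis using c by simp
  qed
qed

lemma balanced_dumbbell_dumb_pos:
  assumes "2 \<le> \<alpha>" "2 * \<alpha> < n"
  shows "\<exists>pos. dumb_pos (pverts (balanced_dumbbell n \<alpha>)) (parcs (balanced_dumbbell n \<alpha>)) \<alpha> pos"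
proof -
  \<comment> \<open>One less than the order of the first clique: the number of its vertices off the
    connecting path and, counting from 0, the index of its last vertex.\<close>
  define c where "c = (n + 1) div 2 - \<alpha> + 1"
  define b where "b = n div 2 - \<alpha> + 2"
  define l where "l = 2 * \<alpha> - 3"
  define pos where "pos = (\<lambda>u. if u < c then 0 else if u \<le> c + l then Suc (u - c) else l + 2)"
  let ?D = "dumbbell (Suc c) b l"
  have D: "balanced_dumbbell n \<alpha> = ?D"
    by (simp add: balanced_dumbbell_def c_def b_def l_def)
  have ab: "2 \<le> c" "2 \<le> b" "1 \<le> l" "c + b + l = n" "l + 2 = 2 * \<alpha> - 1"
    using assms by (auto simp: c_def b_def l_def)
  have V: "pverts ?D = {0..<n}" using ab by (simp add: dumbbell_def)
  have sym: "(u, v) \<in> parcs ?D \<longleftrightarrow> (v, u) \<in> parcs ?D" and loop: "(u, u) \<notin> parcs ?D" for u v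
  proof -
    interpret sgraph "pverts ?D" "parcs ?D"
      using ab by (intro pair_graph_sgraph pair_graph_dumbbell) auto
    show "(u, v) \<in> parcs ?D \<longleftrightarrow> (v, u) \<in> parcs ?D" "(u, u) \<notin> parcs ?D"
      by (rule E_comm, rule irrefl_E)
  qed
  have arc: "(u, v) \<in> parcs ?D \<longleftrightarrow> v \<le> c \<or> c + l \<le> u \<or> v = Suc u \<and> c \<le> u \<and> u < c + l"
    if uv: "u < v" "v < n" for u v
  proof -
    have "(u, v) \<in> parcs ?D \<longleftrightarrow> v \<le> c \<or> c + l \<le> u \<or> (\<exists>i<l. u = c + i \<and> v = Suc c + i)"
      unfolding dumbbell_def using ab uv by auto
    moreover have "(\<exists>i<l. u = c + i \<and> v = Suc c + i) \<longleftrightarrow> v = Suc u \<and> c \<le> u \<and> u < c + l"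
    proof
      assume "v = Suc u \<and> c \<le> u \<and> u < c + l"
      then show "\<exists>i<l. u = c + i \<and> v = Suc c + i" by (intro exI[of _ "u - c"]) auto
    qed auto
    ultimately show ?thesis by simp
  qed
  have lt: "(u, v) \<in> parcs ?D \<longleftrightarrow> pos u \<le> Suc (pos v) \<and> pos v \<le> Suc (pos u)" if "u < v" "v < n" for u v
    using dumbbell_position_adjacent[OF ab(3) that(1), of pos c] arc[OF that] by (simp add: pos_def)
  have adj: "(u, v) \<in> parcs ?D \<longleftrightarrow> u \<noteq> v \<and> pos u \<le> Suc (pos v) \<and> pos v \<le> Suc (pos u)"
    if "u < n" "v < n" for u v
  proof (cases u v rule: linorder_cases)
    case less
    then show ?thesis using lt[OF less that(2)] by simp
  next
    case equal
    then show ?thesis using loop by simp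
  next
    case greater
    then show ?thesis using lt[OF greater that(1)] sym[of u v] by auto
  qed
  have le: "pos u \<le> 2 * \<alpha> - 1" for u unfolding ab(5)[symmetric] by (auto simp: pos_def)
  have f0: "{v \<in> {0..<n}. pos v = 0} = {0..<c}" using ab by (auto simp: pos_def split: if_splits)
  have fi: "{v \<in> {0..<n}. pos v = i} = {c + i - 1}" if "1 \<le> i" "i \<le> 2 * \<alpha> - 2" for i
  proof -
    have i: "i \<le> l + 1" using that ab by linarith
    show ?thesis using that(1) i ab by (auto simp: pos_def split: if_splits)
  qed
  have fm: "{v \<in> {0..<n}. pos v = 2 * \<alpha> - 1} = {c + l + 1..<n}"
    unfolding ab(5)[symmetric] using ab by (auto simp: pos_def split: if_splits)
  have "dumb_pos {0..<n} (parcs ?D) \<alpha> pos"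
    unfolding dumb_pos_def f0 fm
  proof (intro conjI allI impI)
    show "card {v \<in> {0..<n}. pos v = i} = 1" if "1 \<le> i" "i \<le> 2 * \<alpha> - 2" for i
      unfolding fi[OF that] by simp
    show "card {0..<c} = (card {0..<n} + 1) div 2 + 1 - \<alpha>"
      using assms by (simp add: c_def)
    have "n - (c + l + 1) = b - 1" using ab by linarith
    then show "card {c + l + 1..<n} = card {0..<n} div 2 + 1 - \<alpha>"
      using assms by (simp add: b_def)
  qed (use adj le in auto)
  then show ?thesis unfolding D V by blast
qed

theorem theorem8:
  fixes f :: "real \<Rightarrow> real" and G :: "'a pair_pre_digraph" and n \<alpha> :: nat
  assumes "convex_on {0..} f" and "f 0 = 0" and "strict_mono_on {0<..} f"
    and "pair_graph G" and "Digraph_Component.connected (with_proj G)"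
    and "card (pverts G) = n" and "independence_number G = \<alpha>"
    and "2 \<le> \<alpha>" and "real \<alpha> < real n / 2"
  shows "wiener f G \<le> wiener f (balanced_dumbbell n \<alpha>)
    \<and> (wiener f G = wiener f (balanced_dumbbell n \<alpha>)
        \<longleftrightarrow> digraph_iso (with_proj G) (with_proj (balanced_dumbbell n \<alpha>)))"
proof -
  let ?D = "balanced_dumbbell n \<alpha>" and ?f = "\<lambda>t. f (real t)"
  have n: "2 * \<alpha> < n" using assms(9) by linarith
  have f: "convex_inc ?f" using assms(1,3) by (rule convex_inc_of_real)
  have D: "pair_graph ?D"
    unfolding balanced_dumbbell_def using assms(8) n by (intro pair_graph_dumbbell) auto
  have cD: "card (pverts ?D) = n" using assms(8,9) by (rule card_balanced_dumbbell)
  obtain pos where pos: "dumb_pos (pverts ?D) (parcs ?D) \<alpha> pos"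
    using balanced_dumbbell_dumb_pos[OF assms(8) n] by blast
  have lower: "wmax ?f \<alpha> n \<le> wiener f ?D"
    using wmax_le_wien[OF f assms(8) pair_graph_sgraph[OF D] pos] n unfolding cD wiener_eq_wien[OF D] by simp
  have finG: "finite (pverts G)" using pair_graph_sgraph[OF assms(4)] by (simp add: sgraph_def)
  have indep: "\<forall>I. I \<subseteq> pverts G \<longrightarrow> indep (parcs G) I \<longrightarrow> card I \<le> \<alpha>"
    using independence_number_ge[OF finG] assms(7) by blast
  note upper = wien_le_wmax[OF f assms(8) connected_cgraph[OF assms(4,5)] indep,
      unfolded assms(6), folded wiener_eq_wien[OF assms(4)]]
  have "digraph_iso (with_proj G) (with_proj ?D)" if eq: "wiener f G = wiener f ?D"
  proof -
    \<comment> \<open>\<open>wmax\<close> lies between the two indices, so their equality forces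
      equality in the upper bound for \<open>G\<close>.\<close>
    have "wiener f G = wmax ?f \<alpha> n" using eq upper lower by linarith
    then obtain a where "dumb_pos (pverts G) (parcs G) \<alpha> a" using upper n by auto
    then show ?thesis using dumb_pos_iso[OF assms(4) D assms(8) _ pos] assms(6) cD by simp
  qed
  then show ?thesis using wiener_iso[OF assms(4) D] upper lower by force
qed

end
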